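(* Let $\Omega\in\mathcal{O}_C$ have thickness function $d:\partial C\to\mathbb{R}_+$ of class $C^2$ and return map $F:\partial C\to\partial C$, and let $c^*\in\partial C$ be a nondegenerate critical point of $d$. Then $DF(c^* )$ determines the composite operator $$A(c^* )\,\mathrm{Hess}_{\partial C}d(c^* ).$$ Consequently: (1) the stability type of $c^*$ is determined by the spectrum of $DF(c^* )$; (2) the local second-order geometry of $d$ at $c^*$ is observable only through the geometric mask $A(c^* )$; (3) without independent knowledge of $A(c^* )$, the Hessian $\mathrm{Hess}_{\partial C}d(c^* )$ is not uniquely identifiable from $DF(c^* )$; (4) if $A(c^* )$ is known, then $$\mathrm{Hess}_{\partial C}d(c^* )=A(c^* )^{-1}\bigl(I-DF(c^* )\bigr).$$
   Context: Convex core. $C\subset\mathbb{R}^N$ is a compact convex set with nonempty interior whose boundary $\partial C$ is a hypersurface of class $C^2$, with the induced Riemannian structure and outward unit normal $\nu(c)$ at $c\in\partial C$. $\nabla_{\partial C}$ and $\mathrm{Hess}_{\partial C}$ are the Riemannian gradient and Hessian (the latter as a self-adjoint operator on $T_c(\partial C)$). The shape operator $S_c$ is defined by $D\nu(c)[v]=-S_cv$. Class $\mathcal{O}_C$. An open set $\Omega\subset\mathbb{R}^N$ belongs to $\mathcal{O}_C$ if: (1) $\mathrm{int}(C)\subset\Omega$; (2) $\partial\Omega$ is Lipschitz outside $C$; (3) for every $c\in\partial C$ the ray $\{c+t\nu(c):t\ge 0\}$ intersects $\Omega$ in a connected set; (4) for almost every $x\in\partial\Omega$ at which the inward unit normal $n(x)$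 exists, the half-line $\{x+tn(x):t\ge0\}$ intersects $C$. Thickness function: $d(c)=\sup\{r\ge0: c+r\nu(c)\in\Omega\}$. Radial map: $\Phi:\partial C\to\partial\Omega$, $\Phi(c)=c+d(c)\nu(c)$. Reciprocal map: $\pi:\partial\Omega\setminus C\to\partial C$, $\pi(x)=x+t(x)n(x)$, where $n(x)$ is the inward unit normal to $\partial\Omega$ at $x$ and $t(x)$ is the smallest nonnegative number with $x+t(x)n(x)\in C$. Return map: $F=\pi\circ\Phi:\partial C\to\partial C$. Geometric operator. At a nondegenerate critical point $c^*$ of $d$ (gradient zero, Hessian invertible), the linearization of $F$ is written $DF(c^* )=I-A(c^* )\,\mathrm{Hess}_{\partial C}d(c^* )$, where $A(c^* )$ is the linear operator on $T_{c^*}(\partial C)$, called the geometric mask, given in the paper by $A(c^* )=2d(c^* )(I-d(c^* )S_{c^*})^{-1}$. The stability type of $c^*$ is its type (contraction, expansion, marginal) as a fixed point of $F$.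
   Formalization: The geometric mask is taken as A(c* ) = -d(c* )(I-d(c* )S)^{-1} instead of 2d(c* )(I-d(c* )S)^{-1}, which contradicts DF = I - A Hess d (e.g. for a disc inside an off-centre disc); the dimension N is at least 2, since (3) fails for N = 1. *)

theory Defs
  imports "HOL-Analysis.Analysis"
begin

section \<open>Hypersurfaces of class C2 and unit normals\<close>

definition C2_on :: "'a::euclidean_space set \<Rightarrow> ('a \<Rightarrow> real) \<Rightarrow> bool" where
  "C2_on U f \<longleftrightarrow> (\<exists>G H. (\<forall>x\<in>U. (f has_derivative (\<lambda>v. G x \<bullet> v)) (at x)) \<and>
      (\<forall>x\<in>U. (G has_derivative H x) (at x)) \<and>
      (\<forall>v::'a. continuous_on U (\<lambda>x. H x v :: 'a)))"

definition C2_hypersurface :: "'a::euclidean_space set \<Rightarrow> bool" where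
  "C2_hypersurface M \<longleftrightarrow> (\<forall>p\<in>M. \<exists>U g. open U \<and> p \<in> U \<and> C2_on U g \<and>
      \<not> (g has_derivative (\<lambda>v. 0)) (at p) \<and> M \<inter> U = {x \<in> U. g x = 0})"

definition C2_on_hypersurface :: "'a::euclidean_space set \<Rightarrow> ('a \<Rightarrow> real) \<Rightarrow> bool" where
  "C2_on_hypersurface M f \<longleftrightarrow> (\<forall>p\<in>M. \<exists>U g. open U \<and> p \<in> U \<and> C2_on U g \<and>
      (\<forall>x\<in>M \<inter> U. f x = g x))"

text \<open>Near \<open>x\<close>, the set \<open>S\<close> contains every cone around \<open>n\<close> and misses every cone around \<open>-n\<close>
  whose axis opening is less than a right angle. When \<open>S\<close> lies locally on one side of a Lipschitz
  graph this says that the graph is differentiable at \<open>x\<close> and \<open>n\<close> is its normal pointing into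
  \<open>S\<close>. Such an \<open>n\<close> is unique.\<close>

definition is_inward_unit_normal :: "'a::euclidean_space set \<Rightarrow> 'a \<Rightarrow> 'a \<Rightarrow> bool" where
  "is_inward_unit_normal S x n \<longleftrightarrow> norm n = 1 \<and>
     (\<forall>e>0. \<forall>\<^sub>F y in at x. ((y - x) \<bullet> n > e * norm (y - x) \<longrightarrow> y \<in> S) \<and>
                            ((y - x) \<bullet> n < - e * norm (y - x) \<longrightarrow> y \<notin> S))"

definition inward_unit_normal :: "'a::euclidean_space set \<Rightarrow> 'a \<Rightarrow> 'a" where
  "inward_unit_normal S x = (THE n. is_inward_unit_normal S x n)"

section \<open>The convex core and the geometry of its boundary\<close>

definition convex_core :: "'a::euclidean_space set \<Rightarrow> bool" where
  "convex_core C \<longleftrightarrow> compact C \<and> convex C \<and> interior C \<noteq> {} \<and> C2_hypersurface (frontier C)"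

definition outward_normal :: "'a::euclidean_space set \<Rightarrow> 'a \<Rightarrow> 'a" where
  "outward_normal C c = - inward_unit_normal C c"

definition tangent_space :: "'a::euclidean_space set \<Rightarrow> 'a \<Rightarrow> 'a set" where
  "tangent_space C c = {v. v \<bullet> outward_normal C c = 0}"

definition tangent_proj :: "'a::euclidean_space set \<Rightarrow> 'a \<Rightarrow> 'a \<Rightarrow> 'a" where
  "tangent_proj C c w = w - (w \<bullet> outward_normal C c) *\<^sub>R outward_normal C c"

text \<open>Operators on the tangent space at \<open>c\<close> are represented by functions \<open>'a \<Rightarrow> 'a\<close> of which only
  the values on \<^term>\<open>tangent_space C c\<close> matter. The derivative of a map along the boundary is the
  Frechet derivative at \<open>c\<close> within \<^term>\<open>frontier C\<close>; on tangent vectors it does not depend on the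
  choice made by \<^const>\<open>frechet_derivative\<close>.\<close>

definition shape_operator :: "'a::euclidean_space set \<Rightarrow> 'a \<Rightarrow> 'a \<Rightarrow> 'a" where
  "shape_operator C c v = - frechet_derivative (outward_normal C) (at c within frontier C) v"

definition surface_grad :: "'a::euclidean_space set \<Rightarrow> ('a \<Rightarrow> real) \<Rightarrow> 'a \<Rightarrow> 'a" where
  "surface_grad C f c = (THE g. g \<in> tangent_space C c \<and>
      (f has_derivative (\<lambda>v. g \<bullet> v)) (at c within frontier C))"

text \<open>The Levi-Civita derivative of a tangent field on a hypersurface with the induced metric is the
  tangential part of its ambient derivative; the Hessian operator is \<open>v \<mapsto> \<nabla>\<^sub>v grad f\<close>.\<close>

definition surface_hess :: "'a::euclidean_space set \<Rightarrow> ('a \<Rightarrow> real) \<Rightarrow> 'a \<Rightarrow> 'a \<Rightarrow> 'a" where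
  "surface_hess C f c v =
     tangent_proj C c (frechet_derivative (surface_grad C f) (at c within frontier C) v)"

definition nondegenerate_critical :: "'a::euclidean_space set \<Rightarrow> ('a \<Rightarrow> real) \<Rightarrow> 'a \<Rightarrow> bool" where
  "nondegenerate_critical C f c \<longleftrightarrow> c \<in> frontier C \<and> surface_grad C f c = 0 \<and>
     bij_betw (surface_hess C f c) (tangent_space C c) (tangent_space C c)"

section \<open>The class of domains\<close>

text \<open>Vanishing of the \<open>s\<close>-dimensional Hausdorff measure, for \<open>s > 0\<close>. Almost every point of a
  boundary refers to \<open>s = N - 1\<close>.\<close>

definition hausdorff_null :: "nat \<Rightarrow> 'a::euclidean_space set \<Rightarrow> bool" where
  "hausdorff_null s A \<longleftrightarrow> (\<forall>\<delta>>0. \<forall>\<epsilon>>0. \<exists>U::nat \<Rightarrow> 'a set. A \<subseteq> (\<Union>i. U i) \<and>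
      (\<forall>i. bounded (U i) \<and> diameter (U i) \<le> \<delta>) \<and>
      summable (\<lambda>i. diameter (U i) ^ s) \<and> (\<Sum>i. diameter (U i) ^ s) < \<epsilon>)"

text \<open>Near \<open>x\<close> the set is the strict epigraph, in direction \<open>e\<close>, of a Lipschitz function on the
  hyperplane orthogonal to \<open>e\<close>.\<close>

definition lipschitz_boundary_at :: "'a::euclidean_space set \<Rightarrow> 'a \<Rightarrow> bool" where
  "lipschitz_boundary_at \<Omega> x \<longleftrightarrow> (\<exists>e \<phi> L r. norm e = 1 \<and> r > 0 \<and>
      L-lipschitz_on {z. z \<bullet> e = 0} (\<phi> :: 'a \<Rightarrow> real) \<and>
      (\<forall>y\<in>ball x r. y \<in> \<Omega> \<longleftrightarrow> \<phi> (y - (y \<bullet> e) *\<^sub>R e) < y \<bullet> e))"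

definition halfline_meets :: "'a::euclidean_space set \<Rightarrow> 'a \<Rightarrow> 'a \<Rightarrow> bool" where
  "halfline_meets C x n \<longleftrightarrow> (\<exists>t\<ge>0. x + t *\<^sub>R n \<in> C)"

definition domain_class :: "'a::euclidean_space set \<Rightarrow> 'a set set" where
  "domain_class C = {\<Omega>. open \<Omega> \<and> interior C \<subseteq> \<Omega> \<and>
     (\<forall>x\<in>frontier \<Omega> - C. lipschitz_boundary_at \<Omega> x) \<and>
     (\<forall>c\<in>frontier C. connected ({c + t *\<^sub>R outward_normal C c |t. 0 \<le> t} \<inter> \<Omega>)) \<and>
     hausdorff_null (DIM('a) - 1)
       {x \<in> frontier \<Omega>. \<exists>n. is_inward_unit_normal \<Omega> x n \<and> \<not> halfline_meets C x n}}"

section \<open>Thickness, radial, reciprocal and return maps\<close>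

definition thickness_set :: "'a::euclidean_space set \<Rightarrow> 'a set \<Rightarrow> 'a \<Rightarrow> real set" where
  "thickness_set C \<Omega> c = {r. 0 \<le> r \<and> c + r *\<^sub>R outward_normal C c \<in> \<Omega>}"

text \<open>The supremum is taken in \<open>[0,\<infinity>)\<close>: inserting \<open>0\<close> only fixes the value for an empty set.\<close>

definition thickness :: "'a::euclidean_space set \<Rightarrow> 'a set \<Rightarrow> 'a \<Rightarrow> real" where
  "thickness C \<Omega> c = Sup (insert 0 (thickness_set C \<Omega> c))"

definition radial_map :: "'a::euclidean_space set \<Rightarrow> 'a set \<Rightarrow> 'a \<Rightarrow> 'a" where
  "radial_map C \<Omega> c = c + thickness C \<Omega> c *\<^sub>R outward_normal C c"

definition reciprocal_domain :: "'a::euclidean_space set \<Rightarrow> 'a set \<Rightarrow> 'a set" where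
  "reciprocal_domain C \<Omega> =
     {x \<in> frontier \<Omega> - C. \<exists>n. is_inward_unit_normal \<Omega> x n \<and> halfline_meets C x n}"

definition reciprocal_map :: "'a::euclidean_space set \<Rightarrow> 'a set \<Rightarrow> 'a \<Rightarrow> 'a" where
  "reciprocal_map C \<Omega> x =
     (let n = inward_unit_normal \<Omega> x; t = (LEAST t::real. 0 \<le> t \<and> x + t *\<^sub>R n \<in> C)
      in x + t *\<^sub>R n)"

definition return_map :: "'a::euclidean_space set \<Rightarrow> 'a set \<Rightarrow> 'a \<Rightarrow> 'a" where
  "return_map C \<Omega> = reciprocal_map C \<Omega> \<circ> radial_map C \<Omega>"

definition return_deriv :: "'a::euclidean_space set \<Rightarrow> 'a set \<Rightarrow> 'a \<Rightarrow> 'a \<Rightarrow> 'a" where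
  "return_deriv C \<Omega> c = frechet_derivative (return_map C \<Omega>) (at c within frontier C)"

definition thickness_hess :: "'a::euclidean_space set \<Rightarrow> 'a set \<Rightarrow> 'a \<Rightarrow> 'a \<Rightarrow> 'a" where
  "thickness_hess C \<Omega> c = surface_hess C (thickness C \<Omega>) c"

text \<open>The mask is the operator \<open>A\<close> with \<open>DF = I - A Hess d\<close> at a critical point of \<open>d\<close>. To first
  order in \<open>h = c - c*\<close> the tangential part of \<open>\<Phi>\<close> is \<open>(I - d S) h\<close> and that of the inward normal
  at \<open>\<Phi> c\<close> is \<open>S h + (I - d S)\<^sup>-\<^sup>1 Hess d h\<close>, while the travel time is \<open>d\<close>. Adding up gives
  \<open>DF = I + d (I - d S)\<^sup>-\<^sup>1 Hess d\<close>, so the scalar factor of the mask is \<open>-d\<close>. (The factor \<open>2 d\<close>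
  also found for this operator is not compatible with these maps.)\<close>

definition geometric_mask :: "'a::euclidean_space set \<Rightarrow> 'a set \<Rightarrow> 'a \<Rightarrow> 'a \<Rightarrow> 'a" where
  "geometric_mask C \<Omega> c v = - (thickness C \<Omega> c *\<^sub>R
     inv_into (tangent_space C c) (\<lambda>u. u - thickness C \<Omega> c *\<^sub>R shape_operator C c u) v)"

text \<open>\<open>d\<close> is finite and of class C2, \<open>F = \<pi> \<circ> \<Phi>\<close> is defined on the whole boundary of the core, and
  \<open>c\<close> is a nondegenerate critical point. Since \<open>\<pi>\<close> is defined off \<open>C\<close> only, \<open>d > 0\<close> is implied.\<close>

definition return_configuration :: "'a::euclidean_space set \<Rightarrow> 'a set \<Rightarrow> 'a \<Rightarrow> bool" where
  "return_configuration C \<Omega> c \<longleftrightarrow> convex_core C \<and> \<Omega> \<in> domain_class C \<and>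
     (\<forall>b\<in>frontier C. bdd_above (thickness_set C \<Omega> b)) \<and>
     C2_on_hypersurface (frontier C) (thickness C \<Omega>) \<and>
     radial_map C \<Omega> ` frontier C \<subseteq> reciprocal_domain C \<Omega> \<and>
     nondegenerate_critical C (thickness C \<Omega>) c"

section \<open>Stability type and spectrum\<close>

datatype stability_type = Contraction | Expansion | Marginal

text \<open>The type of a fixed point \<open>p\<close> of a map \<open>F\<close> of \<open>M\<close>, defined by the map itself and not by its
  linearization. Contraction: some iterate shrinks the distance to \<open>p\<close> by a factor below 1 near
  \<open>p\<close>. Expansion: the iterates magnify the distance to \<open>p\<close>, for points arbitrarily near \<open>p\<close>, by
  arbitrarily large factors. Marginal: neither.\<close>

definition fixpoint_type :: "'a::metric_space set \<Rightarrow> ('a \<Rightarrow> 'a) \<Rightarrow> 'a \<Rightarrow> stability_type" where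
  "fixpoint_type M F p =
     (if \<exists>n. \<exists>k<1. \<forall>\<^sub>F c in at p within M. dist ((F ^^ n) c) p \<le> k * dist c p then Contraction
      else if \<forall>K. \<exists>n. \<exists>\<^sub>F c in at p within M. K * dist c p \<le> dist ((F ^^ n) c) p then Expansion
      else Marginal)"

text \<open>The complex spectrum of a real operator on the subspace \<open>T\<close>:
  \<open>L (u + i v) = (a + i b) (u + i v)\<close> in the complexification.\<close>

definition spectrum_on :: "'a::real_vector set \<Rightarrow> ('a \<Rightarrow> 'a) \<Rightarrow> complex set" where
  "spectrum_on T L = {Complex a b |a b. \<exists>u\<in>T. \<exists>v\<in>T. (u \<noteq> 0 \<or> v \<noteq> 0) \<and>
      L u = a *\<^sub>R u - b *\<^sub>R v \<and> L v = b *\<^sub>R u + a *\<^sub>R v}"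

end

theory Submission
  imports Defs
begin

text \<open>Let \<open>W = D \<nu>\<close> on the tangent space at \<open>p\<close>; convexity makes \<open>W\<close> symmetric and positive
  semidefinite, so \<open>J = I + d W\<close> is invertible. The inward normal of \<open>\<Omega>\<close> at \<open>\<Phi> c\<close> is orthogonal to the
  image of \<open>D \<Phi> c\<close>; writing it as \<open>w - b \<nu>\<close> with \<open>w\<close> tangent to the core this reads
  \<open>w + d W w = b grad d\<close>, whose linearization at the critical point is \<open>J w = Hess d\<close>. Since the travel
  time back to the core is stationary, \<open>J (DF - I) = d Hess d\<close>. Hence \<open>DF\<close> is self-adjoint for the inner
  product \<open>u \<bullet> J v\<close>: its spectrum is real and its norm is the spectral radius, which settles the stability
  type even in the marginal case. A homothety centred at \<open>p\<close> preserves \<open>DF\<close> but rescales the Hessian,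
  so the latter cannot be read off from the former.\<close>

section \<open>Second derivatives\<close>

text \<open>No differentiability of the normal of \<open>\<Omega>\<close> is assumed, so the normal
  field along \<open>radial_map\<close> has no derivative to start from. Its tangential part
  \<open>w\<close> is controlled by algebra instead: pairing the orthogonality relation with
  \<open>w\<close> and using the positivity of \<open>W\<close> bounds \<open>norm w\<close> by the
  norm of the gradient of \<open>d\<close>. With this first-order bound the relation at
  \<open>c\<close> may be replaced by the one at \<open>p\<close>, and the latter is solved by
  inverting \<open>J\<close>. The travel time is a \<open>LEAST\<close>; its derivative comes from
  trapping it between a cone inside the core and a supporting half-space. Derivatives are taken
  within a frontier that is given by level sets and not by charts. Two devices replace charts: every
  tangent vector is a limit of scaled secants, so a derivative is determined on tangent vectors; and
  the normal component of a frontier displacement is of higher order, so the linear extension off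
  the tangent space can be chosen freely. Self-adjointness is decisive at spectral radius one: a
  general linear map could have Jordan blocks with growing powers, and then the type would not be a
  function of the spectrum.\<close>

text \<open>The mean value theorem in the direction \<open>u\<close> turns the second difference
  into a difference of gradients, which differentiability of \<open>G\<close> at the single point
  \<open>p\<close> evaluates up to a multiple of \<open>t\<close>. No continuity of second
  derivatives enters.\<close>

lemma second_difference_quotient:
  fixes f :: "'a::euclidean_space \<Rightarrow> real"
  assumes U: "open U" "p \<in> U"
    and f: "\<And>x. x \<in> U \<Longrightarrow> (f has_derivative (\<lambda>v. G x \<bullet> v)) (at x)"
    and G: "(G has_derivative H) (at p)" and e: "e > 0"
  shows "\<exists>\<delta>>0. \<forall>t. 0 < t \<and> t < \<delta> \<longrightarrow>
    \<bar>f (p + t *\<^sub>R u + t *\<^sub>R v) - f (p + t *\<^sub>R u) - f (p + t *\<^sub>R v) + f p - t\<^sup>2 * (H v \<bullet> u)\<bar> \<le> e * t\<^sup>2"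
proof -
  define K where "K = norm u + norm v + 1"
  \<comment> \<open>Two gradient errors, each at most \<open>e' * t * K\<close>, get paired with
    \<open>u\<close>; this choice keeps their total below \<open>e * t\<close>.\<close>
  define e' where "e' = e / (2 * K * (norm u + 1))"
  have K: "K > 0" unfolding K_def by (simp add: add_nonneg_pos)
  have nu: "norm u + 1 > 0" by (simp add: add_nonneg_pos)
  have e': "e' > 0" unfolding e'_def using K nu e by simp
  have e'e: "2 * e' * K * norm u \<le> e"
  proof -
    have "2 * e' * K * (norm u + 1) = e" unfolding e'_def using K nu by simp
    moreover have "2 * e' * K * norm u \<le> 2 * e' * K * (norm u + 1)"
      using e' K by (intro mult_left_mono) auto
    ultimately show ?thesis by simp
  qed
  have Hl: "linear H" using G has_derivative_linear by blast
  obtain r where r: "r > 0" "ball p r \<subseteq> U" using U open_contains_ball by blast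
  obtain d where d: "d > 0"
    "\<And>y. norm (y - p) < d \<Longrightarrow> norm (G y - G p - H (y - p)) \<le> e' * norm (y - p)"
    using G e' unfolding has_derivative_within_alt by (metis UNIV_I)
  show ?thesis
  proof (intro exI conjI allI impI)
    show "min d r / K > 0" using d r K by simp
    fix t assume t: "0 < t \<and> t < min d r / K"
    then have tK: "t * K < d" "t * K < r" using K by (auto simp: pos_less_divide_eq)
    have nrm: "norm (s *\<^sub>R u + t' *\<^sub>R v) \<le> t * K" if "0 \<le> s" "s \<le> t" "0 \<le> t'" "t' \<le> t" for s t'
    proof -
      have "norm (s *\<^sub>R u + t' *\<^sub>R v) \<le> s * norm u + t' * norm v"
        using norm_triangle_ineq[of "s *\<^sub>R u" "t' *\<^sub>R v"] that by simp
      also have "\<dots> \<le> t * norm u + t * norm v" using that by (intro add_mono mult_right_mono) auto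
      also have "\<dots> \<le> t * K" unfolding K_def using t by (simp add: algebra_simps)
      finally show ?thesis .
    qed
    have inU: "p + s *\<^sub>R u + t' *\<^sub>R v \<in> U" if "0 \<le> s" "s \<le> t" "0 \<le> t'" "t' \<le> t" for s t'
    proof -
      have "dist p (p + s *\<^sub>R u + t' *\<^sub>R v) = norm (s *\<^sub>R u + t' *\<^sub>R v)"
        by (metis add.assoc add_diff_cancel_left' dist_commute dist_norm)
      then show ?thesis using nrm[OF that] tK r by (auto simp: mem_ball)
    qed
    have Gest: "norm (G (p + s *\<^sub>R u + t' *\<^sub>R v) - G p - H (s *\<^sub>R u + t' *\<^sub>R v)) \<le> e' * (t * K)"
      if "0 \<le> s" "s \<le> t" "0 \<le> t'" "t' \<le> t" for s t'
    proof -
      have "norm (G (p + s *\<^sub>R u + t' *\<^sub>R v) - G p - H (s *\<^sub>R u + t' *\<^sub>R v))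
         \<le> e' * norm (s *\<^sub>R u + t' *\<^sub>R v)"
        using d(2)[of "p + s *\<^sub>R u + t' *\<^sub>R v"] nrm[OF that] tK by (simp add: add.assoc)
      also have "\<dots> \<le> e' * (t * K)" using nrm[OF that] e' by simp
      finally show ?thesis .
    qed
    define h where "h = (\<lambda>s. f (p + s *\<^sub>R u + t *\<^sub>R v) - f (p + s *\<^sub>R u))"
    have "\<exists>z>0. z < t \<and> h t - h 0 = (t - 0) * ((G (p + z *\<^sub>R u + t *\<^sub>R v) - G (p + z *\<^sub>R u)) \<bullet> u)"
    proof (rule MVT2)
      show "0 < t" using t by simp
      fix s assume s: "0 \<le> s" "s \<le> t"
      have 1: "((\<lambda>s. f (p + s *\<^sub>R u + t *\<^sub>R v)) has_derivative (\<lambda>z. G (p + s *\<^sub>R u + t *\<^sub>R v) \<bullet> (z *\<^sub>R u))) (at s)"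
        by (rule has_derivative_compose[of "\<lambda>s. p + s *\<^sub>R u + t *\<^sub>R v", OF _ f])
          (use inU[of s t] s t in \<open>auto intro!: derivative_eq_intros\<close>)
      have 2: "((\<lambda>s. f (p + s *\<^sub>R u)) has_derivative (\<lambda>z. G (p + s *\<^sub>R u) \<bullet> (z *\<^sub>R u))) (at s)"
        by (rule has_derivative_compose[of "\<lambda>s. p + s *\<^sub>R u", OF _ f])
          (use inU[of s 0] s t in \<open>auto intro!: derivative_eq_intros\<close>)
      show "(h has_real_derivative (G (p + s *\<^sub>R u + t *\<^sub>R v) - G (p + s *\<^sub>R u)) \<bullet> u) (at s)"
        unfolding has_field_derivative_def h_def using has_derivative_diff[OF 1 2]
        by (rule has_derivative_eq_rhs) (auto simp: algebra_simps)
    qed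
    then obtain z where z: "0 < z" "z < t"
      "h t - h 0 = t * ((G (p + z *\<^sub>R u + t *\<^sub>R v) - G (p + z *\<^sub>R u)) \<bullet> u)" by auto
    let ?a = "G (p + z *\<^sub>R u + t *\<^sub>R v) - G p - H (z *\<^sub>R u + t *\<^sub>R v)"
    let ?b = "G (p + z *\<^sub>R u) - G p - H (z *\<^sub>R u)"
    have ab: "norm ?a \<le> e' * (t * K)" "norm ?b \<le> e' * (t * K)"
      using Gest[of z t] Gest[of z 0] z t by auto
    have "f (p + t *\<^sub>R u + t *\<^sub>R v) - f (p + t *\<^sub>R u) - f (p + t *\<^sub>R v) + f p - t\<^sup>2 * (H v \<bullet> u)
        = t * ((?a - ?b) \<bullet> u)"
      using z(3) unfolding h_def
      by (simp add: linear_add[OF Hl] linear_scale[OF Hl] algebra_simps power2_eq_square)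
    moreover have "\<bar>(?a - ?b) \<bullet> u\<bar> \<le> e * t"
    proof -
      have "\<bar>(?a - ?b) \<bullet> u\<bar> \<le> norm (?a - ?b) * norm u" by (rule Cauchy_Schwarz_ineq2)
      also have "\<dots> \<le> (2 * e' * K * t) * norm u"
        using ab norm_triangle_ineq4[of ?a ?b] by (intro mult_right_mono) (auto simp: algebra_simps)
      also have "\<dots> = (2 * e' * K * norm u) * t" by simp
      also have "\<dots> \<le> e * t" using e'e t by (intro mult_right_mono) auto
      finally show ?thesis .
    qed
    ultimately show "\<bar>f (p + t *\<^sub>R u + t *\<^sub>R v) - f (p + t *\<^sub>R u) - f (p + t *\<^sub>R v) + f p - t\<^sup>2 * (H v \<bullet> u)\<bar> \<le> e * t\<^sup>2"
      using t by (simp add: abs_mult power2_eq_square mult.left_commute)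
  qed
qed

text \<open>The second difference is symmetric in \<open>u\<close> and \<open>v\<close>, so its two
  asymptotic values must agree.\<close>

lemma symmetric_second_derivative_at:
  fixes f :: "'a::euclidean_space \<Rightarrow> real"
  assumes U: "open U" "p \<in> U"
    and f: "\<And>x. x \<in> U \<Longrightarrow> (f has_derivative (\<lambda>v. G x \<bullet> v)) (at x)"
    and G: "(G has_derivative H) (at p)"
  shows "H u \<bullet> v = H v \<bullet> u"
proof (rule ccontr)
  assume ne: "H u \<bullet> v \<noteq> H v \<bullet> u"
  \<comment> \<open>A quarter of the gap: the two errors together reach only half of it.\<close>
  define e where "e = \<bar>H u \<bullet> v - H v \<bullet> u\<bar> / 4"
  have e: "e > 0" unfolding e_def using ne by simp
  obtain d1 where d1: "d1 > 0" "\<And>t. 0 < t \<Longrightarrow> t < d1 \<Longrightarrow>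
    \<bar>f (p + t *\<^sub>R u + t *\<^sub>R v) - f (p + t *\<^sub>R u) - f (p + t *\<^sub>R v) + f p - t\<^sup>2 * (H v \<bullet> u)\<bar> \<le> e * t\<^sup>2"
    using second_difference_quotient[OF U f G e, of u v] by auto
  obtain d2 where d2: "d2 > 0" "\<And>t. 0 < t \<Longrightarrow> t < d2 \<Longrightarrow>
    \<bar>f (p + t *\<^sub>R v + t *\<^sub>R u) - f (p + t *\<^sub>R v) - f (p + t *\<^sub>R u) + f p - t\<^sup>2 * (H u \<bullet> v)\<bar> \<le> e * t\<^sup>2"
    using second_difference_quotient[OF U f G e, of v u] by auto
  define t where "t = min d1 d2 / 2"
  have t: "0 < t" "t < d1" "t < d2" unfolding t_def using d1(1) d2(1) by auto
  have sw: "p + t *\<^sub>R v + t *\<^sub>R u = p + t *\<^sub>R u + t *\<^sub>R v" by simp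
  have "\<bar>t\<^sup>2 * (H u \<bullet> v) - t\<^sup>2 * (H v \<bullet> u)\<bar> \<le> 2 * (e * t\<^sup>2)"
    using d1(2)[OF t(1,2)] d2(2)[OF t(1,3)] unfolding sw by linarith
  moreover have "\<bar>t\<^sup>2 * (H u \<bullet> v) - t\<^sup>2 * (H v \<bullet> u)\<bar> = t\<^sup>2 * (4 * e)"
    unfolding e_def right_diff_distrib[symmetric] abs_mult by simp
  ultimately have "2 * (e * t\<^sup>2) \<le> 0" by (simp add: algebra_simps)
  then show False using e t by (simp add: mult_le_0_iff)
qed

section \<open>Tangent vectors of a frontier\<close>

lemma is_inward_unit_normalE:
  assumes "is_inward_unit_normal S x n" "e > 0"
  obtains d where "d > 0"
    "\<And>y. y \<noteq> x \<Longrightarrow> norm (y - x) < d \<Longrightarrow> (y - x) \<bullet> n > e * norm (y - x) \<Longrightarrow> y \<in> S"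
    "\<And>y. y \<noteq> x \<Longrightarrow> norm (y - x) < d \<Longrightarrow> (y - x) \<bullet> n < - e * norm (y - x) \<Longrightarrow> y \<notin> S"
  using assms unfolding is_inward_unit_normal_def eventually_at dist_norm by (metis UNIV_I)

text \<open>With \<open>e\<close> equal to half the cosine of the angle between \<open>v\<close> and
  \<open>n\<close>, the ray runs strictly inside the cone that the definition places in
  \<open>S\<close>.\<close>

lemma inward_ray_in:
  assumes n: "is_inward_unit_normal S x n" and v: "v \<bullet> n > 0"
  shows "\<exists>d>0. \<forall>s. 0 < s \<and> s < d \<longrightarrow> x + s *\<^sub>R v \<in> S"
proof -
  have v0: "norm v > 0" using v by auto
  define e where "e = v \<bullet> n / (2 * norm v)"
  have e: "e > 0" "e * norm v < v \<bullet> n" unfolding e_def using v v0 by auto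
  obtain d where d: "d > 0" "\<And>y. y \<noteq> x \<Longrightarrow> norm (y - x) < d \<Longrightarrow> (y - x) \<bullet> n > e * norm (y - x) \<Longrightarrow> y \<in> S"
    using is_inward_unit_normalE[OF n e(1)] by metis
  show ?thesis
  proof (intro exI conjI allI impI)
    show "d / norm v > 0" using d v0 by simp
    fix s assume s: "0 < s \<and> s < d / norm v"
    have "s * (e * norm v) < s * (v \<bullet> n)" using s e by simp
    then show "x + s *\<^sub>R v \<in> S"
      using s v0 by (intro d(2)) (auto simp: pos_less_divide_eq mult.left_commute)
  qed
qed

lemma inward_ray_out:
  assumes n: "is_inward_unit_normal S x n" and v: "v \<bullet> n < 0"
  shows "\<exists>d>0. \<forall>s. 0 < s \<and> s < d \<longrightarrow> x + s *\<^sub>R v \<notin> S"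
proof -
  have v0: "norm v > 0" using v by auto
  define e where "e = - (v \<bullet> n) / (2 * norm v)"
  have e: "e > 0" "v \<bullet> n < - e * norm v" unfolding e_def using v v0 by (auto simp: divide_neg_pos)
  obtain d where d: "d > 0" "\<And>y. y \<noteq> x \<Longrightarrow> norm (y - x) < d \<Longrightarrow> (y - x) \<bullet> n < - e * norm (y - x) \<Longrightarrow> y \<notin> S"
    using is_inward_unit_normalE[OF n e(1)] by metis
  show ?thesis
  proof (intro exI conjI allI impI)
    show "d / norm v > 0" using d v0 by simp
    fix s assume s: "0 < s \<and> s < d / norm v"
    have "s * (v \<bullet> n) < s * (- e * norm v)" using s e by (intro mult_strict_left_mono) auto
    then show "x + s *\<^sub>R v \<notin> S"
      using s v0 by (intro d(2)) (auto simp: pos_less_divide_eq mult.left_commute)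
  qed
qed

text \<open>Two distinct unit vectors have inner product below 1, so \<open>n - m\<close> would
  point strictly inward for \<open>n\<close> and strictly outward for \<open>m\<close>.\<close>

lemma is_inward_unit_normal_unique:
  assumes n: "is_inward_unit_normal S x n" and m: "is_inward_unit_normal S x m"
  shows "n = m"
proof (rule ccontr)
  assume "n \<noteq> m"
  have nm: "norm n = 1" "norm m = 1" using n m unfolding is_inward_unit_normal_def by auto
  have nn: "n \<bullet> n = 1" "m \<bullet> m = 1" using nm by (auto simp: norm_eq_1)
  have "(n - m) \<bullet> (n - m) > 0" using \<open>n \<noteq> m\<close> by simp
  then have "n \<bullet> m < 1" using nn by (simp add: inner_diff inner_commute)
  then have "(n - m) \<bullet> n > 0" "(n - m) \<bullet> m < 0"
    using nn by (auto simp: inner_diff inner_commute)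
  then obtain a b where ab: "a > 0" "\<And>s. 0 < s \<Longrightarrow> s < a \<Longrightarrow> x + s *\<^sub>R (n - m) \<in> S"
    "b > 0" "\<And>s. 0 < s \<Longrightarrow> s < b \<Longrightarrow> x + s *\<^sub>R (n - m) \<notin> S"
    using inward_ray_in[OF n] inward_ray_out[OF m] by metis
  have "0 < min a b / 2" "min a b / 2 < a" "min a b / 2 < b" using ab(1,3) by (auto simp: min_def)
  then show False using ab(2,4) by blast
qed

lemma inward_unit_normal_eq: "is_inward_unit_normal S x n \<Longrightarrow> inward_unit_normal S x = n"
  unfolding inward_unit_normal_def using is_inward_unit_normal_unique by blast

text \<open>The two cones of the definition are open near \<open>x\<close>, so one lies in the
  interior of \<open>S\<close> and the other in the interior of the complement; the frontier is left
  with the thin region around the tangent plane.\<close>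

lemma frontier_near_tangent:
  assumes n: "is_inward_unit_normal S x n" and e: "e > 0"
  shows "\<exists>d>0. \<forall>y\<in>frontier S. norm (y - x) < d \<longrightarrow> \<bar>(y - x) \<bullet> n\<bar> \<le> e * norm (y - x)"
proof -
  obtain d where d: "d > 0"
    "\<And>y. y \<noteq> x \<Longrightarrow> norm (y - x) < d \<Longrightarrow> (y - x) \<bullet> n > e * norm (y - x) \<Longrightarrow> y \<in> S"
    "\<And>y. y \<noteq> x \<Longrightarrow> norm (y - x) < d \<Longrightarrow> (y - x) \<bullet> n < - e * norm (y - x) \<Longrightarrow> y \<notin> S"
    using is_inward_unit_normalE[OF n e] by metis
  define V where "V = {y. norm (y - x) < d \<and> (y - x) \<bullet> n > e * norm (y - x)} - {x}"
  define W where "W = {y. norm (y - x) < d \<and> (y - x) \<bullet> n < - e * norm (y - x)} - {x}"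
  have "open V" "open W" unfolding V_def W_def
    by (intro open_Diff open_Collect_conj open_Collect_less continuous_intros; simp)+
  moreover have "V \<subseteq> S" "W \<subseteq> - S" unfolding V_def W_def using d(2,3) by blast+
  moreover have "V \<noteq> {} \<longrightarrow> True" by simp
  ultimately have VW: "V \<subseteq> interior S" "W \<subseteq> interior (- S)" by (simp_all add: interior_maximal)
  have "\<bar>(y - x) \<bullet> n\<bar> \<le> e * norm (y - x)" if y: "y \<in> frontier S" "norm (y - x) < d" for y
  proof (rule ccontr)
    assume a: "\<not> \<bar>(y - x) \<bullet> n\<bar> \<le> e * norm (y - x)"
    then have "y \<noteq> x" by auto
    with a y have "y \<in> V \<or> y \<in> W" unfolding V_def W_def by auto
    then show False using VW y(1) unfolding frontier_def by (auto simp: interior_complement)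
  qed
  then show ?thesis using d(1) by blast
qed

text \<open>A substitute for a curve with velocity \<open>v\<close>. A short segment across the
  tangent plane at \<open>x + s v\<close> starts in \<open>S\<close> and ends outside, hence meets
  the frontier at distance at most \<open>e * s\<close> from \<open>x + s v\<close>.\<close>

lemma tangent_sequence:
  assumes n: "is_inward_unit_normal S x n" and v: "v \<bullet> n = 0"
  obtains y where "\<And>k. y k \<in> frontier S" "(\<lambda>k. real (Suc k) *\<^sub>R (y k - x)) \<longlonglongrightarrow> v"
proof -
  have nn: "n \<bullet> n = 1" "norm n = 1" using n unfolding is_inward_unit_normal_def by (auto simp: norm_eq_1)
  have near: "\<exists>d>0. \<forall>s. 0 < s \<and> s < d \<longrightarrow> (\<exists>z\<in>frontier S. norm (z - (x + s *\<^sub>R v)) \<le> e * s)"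
    if e: "e > 0" for e
  proof -
    have "(v + e *\<^sub>R n) \<bullet> n > 0" "(v - e *\<^sub>R n) \<bullet> n < 0" using v nn e by (auto simp: inner_left_distrib inner_diff_left)
    then obtain a b where ab: "a > 0" "\<And>s. 0 < s \<Longrightarrow> s < a \<Longrightarrow> x + s *\<^sub>R (v + e *\<^sub>R n) \<in> S"
      "b > 0" "\<And>s. 0 < s \<Longrightarrow> s < b \<Longrightarrow> x + s *\<^sub>R (v - e *\<^sub>R n) \<notin> S"
      using inward_ray_in[OF n] inward_ray_out[OF n] by metis
    show ?thesis
    proof (intro exI[of _ "min a b"] conjI allI impI)
      show "0 < min a b" using ab by simp
      fix s assume s: "0 < s \<and> s < min a b"
      let ?I = "closed_segment (x + s *\<^sub>R (v + e *\<^sub>R n)) (x + s *\<^sub>R (v - e *\<^sub>R n))"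
      have "?I \<inter> frontier S \<noteq> {}"
        using ab(2)[of s] ab(4)[of s] s by (intro connected_Int_frontier) auto
      then obtain z where z: "z \<in> ?I" "z \<in> frontier S" by blast
      have "?I \<subseteq> cball (x + s *\<^sub>R v) (e * s)"
        by (intro closed_segment_subset) (use s e nn in \<open>auto simp: dist_norm algebra_simps\<close>)
      then show "\<exists>z\<in>frontier S. norm (z - (x + s *\<^sub>R v)) \<le> e * s"
        using z by (auto simp: dist_norm norm_minus_commute intro!: bexI[of _ z])
    qed
  qed
  define s where "s k = inverse (real (Suc k))" for k
  have s0: "s k > 0" for k unfolding s_def by simp
  \<comment> \<open>Taking the closest point gives one sequence that is good for every
    \<open>e\<close>; the crossing points themselves depend on \<open>e\<close>.\<close>
  define y where "y k = closest_point (frontier S) (x + s k *\<^sub>R v)" for k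
  have ne: "frontier S \<noteq> {}" using near[of 1] by (metis empty_iff field_lbound_gt_zero zero_less_one)
  have yf: "y k \<in> frontier S" for k unfolding y_def using ne by (intro closest_point_in_set) auto
  have "(\<lambda>k. real (Suc k) *\<^sub>R (y k - x)) \<longlonglongrightarrow> v"
  proof (rule tendstoI)
    fix e :: real assume e: "e > 0"
    obtain d where d: "d > 0" "\<And>s. 0 < s \<Longrightarrow> s < d \<Longrightarrow> \<exists>z\<in>frontier S. norm (z - (x + s *\<^sub>R v)) \<le> (e/2) * s"
      using near[of "e/2"] e by auto
    have "eventually (\<lambda>k. s k < d) sequentially"
      unfolding s_def using LIMSEQ_inverse_real_of_nat d(1) by (rule order_tendstoD)
    then show "eventually (\<lambda>k. dist (real (Suc k) *\<^sub>R (y k - x)) v < e) sequentially"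
    proof eventually_elim
      case (elim k)
      then obtain z where z: "z \<in> frontier S" "norm (z - (x + s k *\<^sub>R v)) \<le> (e/2) * s k"
        using d(2)[OF s0] by blast
      have "dist (x + s k *\<^sub>R v) (y k) \<le> dist (x + s k *\<^sub>R v) z"
        unfolding y_def using z(1) by (intro closest_point_le) auto
      then have "norm (y k - (x + s k *\<^sub>R v)) \<le> (e/2) * s k"
        using z(2) by (simp add: dist_norm norm_minus_commute)
      then have "real (Suc k) * norm (y k - (x + s k *\<^sub>R v)) \<le> real (Suc k) * ((e/2) * s k)"
        by (intro mult_left_mono) auto
      also have "\<dots> = e / 2" unfolding s_def by (simp del: of_nat_Suc)
      finally have "norm (real (Suc k) *\<^sub>R (y k - (x + s k *\<^sub>R v))) \<le> e / 2" by (simp del: of_nat_Suc)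
      moreover have "real (Suc k) *\<^sub>R (y k - (x + s k *\<^sub>R v)) = real (Suc k) *\<^sub>R (y k - x) - v"
        unfolding s_def by (simp add: algebra_simps del: of_nat_Suc)
      ultimately show ?case using e by (simp add: dist_norm del: of_nat_Suc)
    qed
  qed
  then show thesis using yf that by blast
qed

lemma tangent_sequence_tendsto:
  fixes x :: "'a::real_normed_vector"
  assumes "(\<lambda>k. real (Suc k) *\<^sub>R (y k - x)) \<longlonglongrightarrow> v"
  shows "y \<longlonglongrightarrow> x"
proof -
  have "(\<lambda>k. inverse (real (Suc k)) *\<^sub>R (real (Suc k) *\<^sub>R (y k - x))) \<longlonglongrightarrow> 0 *\<^sub>R v"
    by (intro tendsto_scaleR assms LIMSEQ_inverse_real_of_nat)
  then have "(\<lambda>k. y k - x) \<longlonglongrightarrow> 0" by (simp del: of_nat_Suc)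
  then show ?thesis using LIM_zero_iff by blast
qed

text \<open>The displacements \<open>y k - x\<close> are of order \<open>1 / Suc k\<close>, so the
  remainder of the derivative still vanishes after multiplication by \<open>Suc k\<close>. This is
  why a derivative within a frontier has well-defined values on tangent vectors.\<close>

lemma tangent_sequence_derivative:
  fixes x :: "'a::euclidean_space" and f :: "'a \<Rightarrow> 'b::real_normed_vector"
  assumes f: "(f has_derivative A) (at x within M)"
    and yM: "\<And>k. y k \<in> M" and y: "(\<lambda>k. real (Suc k) *\<^sub>R (y k - x)) \<longlonglongrightarrow> v"
  shows "(\<lambda>k. real (Suc k) *\<^sub>R (f (y k) - f x)) \<longlonglongrightarrow> A v"
proof -
  have bl: "bounded_linear A" using f has_derivative_bounded_linear by blast
  have lin: "linear A" using bl bounded_linear.linear by blast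
  let ?g = "\<lambda>k. real (Suc k) *\<^sub>R (y k - x)"
  have 1: "(\<lambda>k. A (?g k)) \<longlonglongrightarrow> A v" using bl y by (rule bounded_linear.tendsto)
  have 2: "(\<lambda>k. real (Suc k) *\<^sub>R (f (y k) - f x) - A (?g k)) \<longlonglongrightarrow> 0"
  proof (rule tendstoI)
    fix e :: real assume e: "e > 0"
    define e' where "e' = e / (norm v + 2)"
    have nv: "norm v + 2 > 0" by (simp add: add_nonneg_pos)
    have e': "e' > 0" unfolding e'_def using nv e by simp
    obtain d where d: "d > 0" "\<And>z. z \<in> M \<Longrightarrow> norm (z - x) < d \<Longrightarrow> norm (f z - f x - A (z - x)) \<le> e' * norm (z - x)"
      using f e' unfolding has_derivative_within_alt by metis
    have "eventually (\<lambda>k. dist (y k) x < d) sequentially"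
      using tangent_sequence_tendsto[OF y] d(1) tendstoD by blast
    moreover have "eventually (\<lambda>k. norm (?g k) < norm v + 1) sequentially"
      by (rule order_tendstoD(2)[OF tendsto_norm[OF y]]) simp
    ultimately show "eventually (\<lambda>k. dist (real (Suc k) *\<^sub>R (f (y k) - f x) - A (?g k)) 0 < e) sequentially"
    proof eventually_elim
      case (elim k)
      have "norm (f (y k) - f x - A (y k - x)) \<le> e' * norm (y k - x)"
        using d(2)[OF yM] elim by (simp add: dist_norm)
      then have "real (Suc k) * norm (f (y k) - f x - A (y k - x)) \<le> real (Suc k) * (e' * norm (y k - x))"
        by (intro mult_left_mono) auto
      then have "norm (real (Suc k) *\<^sub>R (f (y k) - f x - A (y k - x))) \<le> e' * norm (?g k)"
        by (simp add: mult.left_commute del: of_nat_Suc)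
      also have "\<dots> \<le> e' * (norm v + 1)" using elim e' by (intro mult_left_mono) auto
      also have "\<dots> < e' * (norm v + 2)" using e' by simp
      also have "\<dots> = e" unfolding e'_def using nv by simp
      finally show ?case
        by (simp add: scaleR_diff_right linear_scale[OF lin] linear_diff[OF lin] del: of_nat_Suc)
    qed
  qed
  show ?thesis using tendsto_add[OF 1 2] by simp
qed

text \<open>The estimate survives the limit along a tangent sequence. It converts a metric bound on
  an iterate of the return map into a bound on the corresponding power of the linearization.\<close>

lemma derivative_tangent_le:
  fixes f :: "'a::euclidean_space \<Rightarrow> 'b::real_normed_vector"
  assumes n: "is_inward_unit_normal S x n" and v: "v \<bullet> n = 0"
    and f: "(f has_derivative A) (at x within frontier S)"
    and le: "\<forall>\<^sub>F y in at x within frontier S. norm (f y - f x) \<le> k * norm (y - x)"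
  shows "norm (A v) \<le> k * norm v"
proof -
  obtain y where y: "\<And>k. y k \<in> frontier S" "(\<lambda>k. real (Suc k) *\<^sub>R (y k - x)) \<longlonglongrightarrow> v"
    using tangent_sequence[OF n v] by blast
  obtain d where d: "d > 0" "\<And>z. z \<in> frontier S \<Longrightarrow> dist z x < d \<Longrightarrow> norm (f z - f x) \<le> k * norm (z - x)"
  proof -
    obtain d where "d > 0" "\<And>z. z \<in> frontier S \<Longrightarrow> z \<noteq> x \<Longrightarrow> dist z x < d \<Longrightarrow> norm (f z - f x) \<le> k * norm (z - x)"
      using le unfolding eventually_at by blast
    \<comment> \<open>The filter omits \<open>x\<close>, but a tangent sequence may visit it; there
      both sides are zero.\<close>
    then show thesis by (intro that[of d]) (auto, metis cancel_comm_monoid_add_class.diff_cancel mult_zero_right norm_zero order_refl)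
  qed
  have ev: "eventually (\<lambda>j. dist (y j) x < d) sequentially"
    using tangent_sequence_tendsto[OF y(2)] d(1) tendstoD by blast
  show ?thesis
  proof (rule tendsto_le[OF sequentially_bot])
    show "(\<lambda>j. k * norm (real (Suc j) *\<^sub>R (y j - x))) \<longlonglongrightarrow> k * norm v"
      by (intro tendsto_intros y)
    show "(\<lambda>j. norm (real (Suc j) *\<^sub>R (f (y j) - f x))) \<longlonglongrightarrow> norm (A v)"
      by (intro tendsto_norm tangent_sequence_derivative[OF f y])
    show "eventually (\<lambda>j. norm (real (Suc j) *\<^sub>R (f (y j) - f x)) \<le> k * norm (real (Suc j) *\<^sub>R (y j - x))) sequentially"
      using ev
    proof eventually_elim
      case (elim j)
      then have "norm (f (y j) - f x) \<le> k * norm (y j - x)" using d(2) y(1) by blast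
      then have "real (Suc j) * norm (f (y j) - f x) \<le> real (Suc j) * (k * norm (y j - x))"
        by (intro mult_left_mono) auto
      then show ?case by (simp add: mult.left_commute del: of_nat_Suc)
    qed
  qed
qed

lemma derivative_tangent_unique:
  fixes f :: "'a::euclidean_space \<Rightarrow> 'b::real_normed_vector"
  assumes n: "is_inward_unit_normal S x n" and v: "v \<bullet> n = 0"
    and f: "(f has_derivative A) (at x within frontier S)"
    and g: "(f has_derivative B) (at x within frontier S)"
  shows "A v = B v"
proof -
  obtain y where y: "\<And>k. y k \<in> frontier S" "(\<lambda>k. real (Suc k) *\<^sub>R (y k - x)) \<longlonglongrightarrow> v"
    using tangent_sequence[OF n v] by blast
  show ?thesis
    using tangent_sequence_derivative[OF f y] tangent_sequence_derivative[OF g y] LIMSEQ_unique by blast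
qed

text \<open>\<open>A h - B h\<close> is \<open>h \<bullet> n\<close> times a fixed vector, and
  \<open>h \<bullet> n\<close> is of higher order for frontier displacements. Hence the value of a
  derivative on the normal may be replaced at will.\<close>

lemma has_derivative_frontier_cong:
  fixes f :: "'a::euclidean_space \<Rightarrow> 'b::real_normed_vector"
  assumes n: "is_inward_unit_normal S x n"
    and f: "(f has_derivative A) (at x within frontier S)"
    and B: "linear B" and AB: "\<And>v. v \<bullet> n = 0 \<Longrightarrow> A v = B v"
  shows "(f has_derivative B) (at x within frontier S)"
  unfolding has_derivative_within_alt
proof (intro conjI allI impI)
  show "bounded_linear B" using B linear_conv_bounded_linear by blast
  have nn: "n \<bullet> n = 1" using n unfolding is_inward_unit_normal_def by (auto simp: norm_eq_1)
  have lA: "linear A" using f has_derivative_linear by blast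
  have AB': "A h - B h = (h \<bullet> n) *\<^sub>R (A n - B n)" for h
  proof -
    have "(h - (h \<bullet> n) *\<^sub>R n) \<bullet> n = 0" using nn by (simp add: inner_diff_left)
    from AB[OF this] show ?thesis
      by (simp add: linear_diff[OF lA] linear_diff[OF B] linear_scale[OF lA] linear_scale[OF B] algebra_simps)
  qed
  fix e :: real assume e: "e > 0"
  define e' where "e' = e / (2 * (norm (A n - B n) + 1))"
  have nz: "norm (A n - B n) + 1 > 0" by (simp add: add_nonneg_pos)
  have e': "e' > 0" unfolding e'_def using e nz by simp
  have e'e: "e' * norm (A n - B n) \<le> e / 2"
  proof -
    have "e' * norm (A n - B n) \<le> e' * (norm (A n - B n) + 1)" using e' by simp
    also have "\<dots> = e / 2"     proof -
      have "e / (2 * c) * c = e / 2" if "c > 0" for c :: real using that by simp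
      from this[OF nz] show ?thesis unfolding e'_def .
    qed
    finally show ?thesis .
  qed
  obtain d1 where d1: "d1 > 0" "\<And>y. y \<in> frontier S \<Longrightarrow> norm (y - x) < d1 \<Longrightarrow> \<bar>(y - x) \<bullet> n\<bar> \<le> e' * norm (y - x)"
    using frontier_near_tangent[OF n e'] by blast
  obtain d2 where d2: "d2 > 0" "\<And>y. y \<in> frontier S \<Longrightarrow> norm (y - x) < d2 \<Longrightarrow> norm (f y - f x - A (y - x)) \<le> e / 2 * norm (y - x)"
    using f e unfolding has_derivative_within_alt by (metis half_gt_zero)
  show "\<exists>d>0. \<forall>y\<in>frontier S. norm (y - x) < d \<longrightarrow> norm (f y - f x - B (y - x)) \<le> e * norm (y - x)"
  proof (intro exI[of _ "min d1 d2"] conjI ballI impI)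
    show "0 < min d1 d2" using d1 d2 by simp
    fix y assume y: "y \<in> frontier S" "norm (y - x) < min d1 d2"
    have "norm (A (y - x) - B (y - x)) \<le> e / 2 * norm (y - x)"
    proof -
      have "norm (A (y - x) - B (y - x)) = \<bar>(y - x) \<bullet> n\<bar> * norm (A n - B n)" by (subst AB') simp
      also have "\<dots> \<le> e' * norm (y - x) * norm (A n - B n)" using d1 y by (intro mult_right_mono) auto
      also have "\<dots> = (e' * norm (A n - B n)) * norm (y - x)" by simp
      also have "\<dots> \<le> e / 2 * norm (y - x)" using e'e by (intro mult_right_mono) auto
      finally show ?thesis .
    qed
    moreover have "norm (f y - f x - A (y - x)) \<le> e / 2 * norm (y - x)" using d2 y by simp
    ultimately show "norm (f y - f x - B (y - x)) \<le> e * norm (y - x)"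
      using norm_triangle_ineq[of "f y - f x - A (y - x)" "A (y - x) - B (y - x)"]
      by (simp add: algebra_simps)
  qed
qed

section \<open>The boundary of a convex core\<close>

lemma convex_core_simps:
  assumes "convex_core C"
  shows "compact C" "closed C" "convex C" "interior C \<noteq> {}" "frontier C \<subseteq> C"
  using assms compact_imp_closed frontier_subset_closed unfolding convex_core_def by auto

text \<open>The level-set description says nothing about the side on which \<open>C\<close> lies.
  Near \<open>p\<close> the cones around the gradient and its negative avoid the zero set; being
  connected, each is either inside \<open>C\<close> or disjoint from it. The interior point
  \<open>z\<close> and convexity decide which.\<close>

lemma inward_normal_of_gradient:
  fixes C :: "'a::euclidean_space set"
  assumes C: "convex C" "closed C" and p: "p \<in> frontier C" and U: "open U" "p \<in> U"
    and g: "(g has_derivative (\<lambda>v. \<gamma> \<bullet> v)) (at p)" and fr: "frontier C \<inter> U = {x \<in> U. g x = 0}"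
    and z: "z \<in> interior C" "(z - p) \<bullet> \<gamma> > 0"
  shows "is_inward_unit_normal C p (\<gamma> /\<^sub>R norm \<gamma>)"
proof -
  have \<gamma>0: "norm \<gamma> > 0" using z(2) by auto
  define m where "m = \<gamma> /\<^sub>R norm \<gamma>"
  have "norm m = 1" unfolding m_def using \<gamma>0 by simp
  then have m: "norm m = 1" "m \<bullet> m = 1" by (auto simp: norm_eq_1)
  have \<gamma>m: "\<gamma> = norm \<gamma> *\<^sub>R m" unfolding m_def using \<gamma>0 by simp
  have pC: "p \<in> C" using p C(2) frontier_subset_closed by blast
  have pi: "p \<notin> interior C" using p unfolding frontier_def by simp
  have gp: "g p = 0" using fr p U by blast
  have zm: "(z - p) \<bullet> m > 0" unfolding m_def using z(2) \<gamma>0 by simp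
  have zp: "norm (z - p) > 0" using zm by auto
  \<comment> \<open>Half the cosine of the angle at which \<open>z\<close> is seen: for
    \<open>e <= e1\<close> the cone contains the direction of \<open>z\<close>, and
    \<open>e1 < 1\<close> keeps its own axis inside.\<close>
  define e1 where "e1 = (z - p) \<bullet> m / (2 * norm (z - p))"
  have e1: "e1 > 0" "e1 * norm (z - p) < (z - p) \<bullet> m" unfolding e1_def using zm zp by auto
  have "(z - p) \<bullet> m \<le> norm (z - p)" using norm_cauchy_schwarz[of "z - p" m] m by simp
  then have "(z - p) \<bullet> m < 2 * norm (z - p)" using zp by linarith
  then have e1l: "e1 < 1" unfolding e1_def using zp by (simp add: divide_less_eq)
  have key: "\<exists>d>0. \<forall>y. y \<noteq> p \<longrightarrow> norm (y - p) < d \<longrightarrow>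
      ((y - p) \<bullet> m > e * norm (y - p) \<longrightarrow> y \<in> C) \<and> ((y - p) \<bullet> m < - e * norm (y - p) \<longrightarrow> y \<notin> C)"
    if e: "0 < e" "e \<le> e1" for e
  proof -
    obtain r where r: "r > 0" "ball p r \<subseteq> U" using U open_contains_ball by blast
    have "e * norm \<gamma> > 0" using e \<gamma>0 by simp
    then obtain d' where d': "d' > 0"
      "\<And>y. norm (y - p) < d' \<Longrightarrow> norm (g y - g p - \<gamma> \<bullet> (y - p)) \<le> e * norm \<gamma> * norm (y - p)"
      using g unfolding has_derivative_within_alt by (metis UNIV_I)
    define d where "d = min d' r"
    have d: "d > 0" unfolding d_def using d' r by simp
    have nofr: "y \<notin> frontier C" if y: "norm (y - p) < d" "\<bar>(y - p) \<bullet> m\<bar> > e * norm (y - p)" for y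
    proof
      assume "y \<in> frontier C"
      moreover have yU: "y \<in> U" using y(1) r unfolding d_def by (auto simp: dist_norm norm_minus_commute subset_eq)
      ultimately have "g y = 0" using fr by blast
      then have "\<bar>\<gamma> \<bullet> (y - p)\<bar> \<le> e * norm \<gamma> * norm (y - p)" using d'(2)[of y] y(1) gp unfolding d_def by simp
      moreover have "\<gamma> \<bullet> (y - p) = norm \<gamma> * ((y - p) \<bullet> m)" by (subst \<gamma>m) (simp add: inner_commute)
      ultimately have "norm \<gamma> * \<bar>(y - p) \<bullet> m\<bar> \<le> norm \<gamma> * (e * norm (y - p))" using \<gamma>0 by (simp add: abs_mult mult_ac)
      then show False using y(2) \<gamma>0 by simp
    qed
    define K where "K \<sigma> = ball p d \<inter> {y. e * norm (y - p) < (y - p) \<bullet> (\<sigma> *\<^sub>R m)}" for \<sigma> :: real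
    have cvx: "convex {y. e * norm (y - p) < (y - p) \<bullet> a}" for a
    proof (rule convexI)
      fix x y :: 'a and u v :: real
      assume h: "x \<in> {y. e * norm (y - p) < (y - p) \<bullet> a}" "y \<in> {y. e * norm (y - p) < (y - p) \<bullet> a}"
        "0 \<le> u" "0 \<le> v" "u + v = 1"
      have eq: "u *\<^sub>R x + v *\<^sub>R y - p = u *\<^sub>R (x - p) + v *\<^sub>R (y - p)"
      proof -
        have "p = (u + v) *\<^sub>R p" using h by simp
        then show ?thesis by (simp add: algebra_simps)
      qed
      have "norm (u *\<^sub>R x + v *\<^sub>R y - p) \<le> u * norm (x - p) + v * norm (y - p)"
        unfolding eq using norm_triangle_ineq[of "u *\<^sub>R (x - p)" "v *\<^sub>R (y - p)"] h by simp
      then have "e * norm (u *\<^sub>R x + v *\<^sub>R y - p) \<le> e * (u * norm (x - p) + v * norm (y - p))"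
        using e by (intro mult_left_mono) auto
      also have "\<dots> = u * (e * norm (x - p)) + v * (e * norm (y - p))" by (simp add: algebra_simps)
      also have "\<dots> < u * ((x - p) \<bullet> a) + v * ((y - p) \<bullet> a)"
      proof (cases "u = 0")
        case True
        then show ?thesis using h by simp
      next
        case False
        then have "u * (e * norm (x - p)) < u * ((x - p) \<bullet> a)" using h by simp
        moreover have "v * (e * norm (y - p)) \<le> v * ((y - p) \<bullet> a)" using h by (intro mult_left_mono) auto
        ultimately show ?thesis by linarith
      qed
      also have "\<dots> = (u *\<^sub>R x + v *\<^sub>R y - p) \<bullet> a" unfolding eq by (simp add: inner_add_left)
      finally show "u *\<^sub>R x + v *\<^sub>R y \<in> {y. e * norm (y - p) < (y - p) \<bullet> a}" by simp
    qed
    have conn: "connected (K \<sigma>)" for \<sigma>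
      unfolding K_def by (intro convex_connected convex_Int convex_ball cvx)
    have disj: "K \<sigma> \<inter> frontier C = {}" if "\<bar>\<sigma>\<bar> = 1" for \<sigma>
      using nofr that e unfolding K_def
      by (fastforce simp: dist_norm norm_minus_commute abs_if split: if_splits)
    have dich: "K \<sigma> \<subseteq> C \<or> K \<sigma> \<inter> C = {}" if "\<bar>\<sigma>\<bar> = 1" for \<sigma>
      using connected_Int_frontier[OF conn[of \<sigma>], of C] disj[OF that] by blast
    have opK: "open (K \<sigma>)" for \<sigma> unfolding K_def
      by (intro open_Int open_ball open_Collect_less continuous_intros)
    define s where "s = min (1/2) (d / (2 * norm (z - p)))"
    have s: "0 < s" "s < 1" "s * norm (z - p) < d"
    proof -
      show "0 < s" "s < 1" unfolding s_def using d zp by auto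
      have "s * norm (z - p) \<le> d / (2 * norm (z - p)) * norm (z - p)"
        unfolding s_def by (intro mult_right_mono) auto
      also have "\<dots> < d" using d zp by simp
      finally show "s * norm (z - p) < d" .
    qed
    have "p + s *\<^sub>R (z - p) \<in> C"
      using convexD_alt[OF C(1) pC, of z s] z(1) interior_subset s by (auto simp: algebra_simps)
    moreover have "p + s *\<^sub>R (z - p) \<in> K 1"
    proof -
      have "e * norm (z - p) < (z - p) \<bullet> m"
        using e1 e mult_right_mono[of e e1 "norm (z - p)"] by (meson le_less_trans norm_ge_zero)
      then have "s * (e * norm (z - p)) < s * ((z - p) \<bullet> m)" using s by simp
      then show ?thesis using s unfolding K_def by (auto simp: dist_norm mult.left_commute)
    qed
    ultimately have K1: "K 1 \<subseteq> C" using dich[of 1] by auto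
    \<comment> \<open>If the opposite cone also lay in \<open>C\<close>, then \<open>p\<close> would
      be the midpoint of a segment from an interior point to a point of \<open>C\<close>, hence
      interior itself.\<close>
    have K2: "K (-1) \<inter> C = {}"
    proof (rule ccontr)
      assume "K (-1) \<inter> C \<noteq> {}"
      then have "K (-1) \<subseteq> C" using dich[of "-1"] by auto
      then have i: "K (-1) \<subseteq> interior C" by (intro interior_maximal opK)
      have "e < 1" using e e1l by simp
      then have "p + (d/2) *\<^sub>R m \<in> K 1" "p - (d/2) *\<^sub>R m \<in> K (-1)"
        unfolding K_def using d m e by (auto simp: dist_norm)
      then have "p + (d/2) *\<^sub>R m \<in> closure C" "p - (d/2) *\<^sub>R m \<in> interior C"
        using K1 i closure_subset by auto
      then have "open_segment (p - (d/2) *\<^sub>R m) (p + (d/2) *\<^sub>R m) \<subseteq> interior C"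
        using in_interior_closure_convex_segment[OF C(1)] by blast
      moreover have "p \<in> open_segment (p - (d/2) *\<^sub>R m) (p + (d/2) *\<^sub>R m)"
      proof -
        have "midpoint (p - (d/2) *\<^sub>R m) (p + (d/2) *\<^sub>R m) = p"
          by (simp add: midpoint_def scaleR_2[symmetric])
        moreover have "p - (d/2) *\<^sub>R m \<noteq> p + (d/2) *\<^sub>R m"
        proof
          assume "p - (d/2) *\<^sub>R m = p + (d/2) *\<^sub>R m"
          then have "d *\<^sub>R m = 0" by (simp add: algebra_simps flip: scaleR_add_left)
          then show False using d m by auto
        qed
        ultimately show ?thesis using midpoint_in_open_segment by metis
      qed
      ultimately show False using pi by blast
    qed
    have "y \<in> C" if "norm (y - p) < d" "(y - p) \<bullet> m > e * norm (y - p)" for y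
      using K1 that unfolding K_def by (auto simp: dist_norm norm_minus_commute)
    moreover have "y \<notin> C" if "norm (y - p) < d" "(y - p) \<bullet> m < - e * norm (y - p)" for y
    proof -
      have "y \<in> K (-1)" unfolding K_def using that by (auto simp: dist_norm norm_minus_commute)
      then show ?thesis using K2 by blast
    qed
    ultimately show ?thesis using d by blast
  qed
  show ?thesis
    unfolding is_inward_unit_normal_def m_def[symmetric]
  proof (intro conjI allI impI)
    show "norm m = 1" by (rule m)
    fix e :: real assume e: "e > 0"
    \<comment> \<open>Cones shrink as \<open>e\<close> grows, so the narrow range of
      \<open>e\<close> in \<open>key\<close> implies the claim for every \<open>e\<close>.\<close>
    define e' where "e' = min e e1"
    have e': "0 < e'" "e' \<le> e1" "e' \<le> e" unfolding e'_def using e e1 by auto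
    obtain d where d: "d > 0" "\<And>y. y \<noteq> p \<Longrightarrow> norm (y - p) < d \<Longrightarrow>
      ((y - p) \<bullet> m > e' * norm (y - p) \<longrightarrow> y \<in> C) \<and> ((y - p) \<bullet> m < - e' * norm (y - p) \<longrightarrow> y \<notin> C)"
      using key[OF e'(1,2)] by blast
    show "\<forall>\<^sub>F y in at p. ((y - p) \<bullet> m > e * norm (y - p) \<longrightarrow> y \<in> C) \<and>
                        ((y - p) \<bullet> m < - e * norm (y - p) \<longrightarrow> y \<notin> C)"
      unfolding eventually_at
    proof (intro exI[of _ d] conjI ballI impI; (rule d)?)
      fix y assume y: "y \<noteq> p \<and> dist y p < d"
      have le: "e' * norm (y - p) \<le> e * norm (y - p)" using e' by (intro mult_right_mono) auto

      show "y \<in> C" if "(y - p) \<bullet> m > e * norm (y - p)" using d(2)[of y] y that le by (auto simp: dist_norm)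
      show "y \<notin> C" if "(y - p) \<bullet> m < - e * norm (y - p)" using d(2)[of y] y that le by (auto simp: dist_norm)
    qed
  qed
qed

lemma has_derivative_normalize:
  fixes G :: "'a::euclidean_space \<Rightarrow> 'a"
  assumes G: "(G has_derivative H) (at x)" and G0: "G x \<noteq> 0"
  defines "N \<equiv> (\<lambda>x. G x /\<^sub>R norm (G x))"
  shows "(N has_derivative (\<lambda>h. (H h - (H h \<bullet> N x) *\<^sub>R N x) /\<^sub>R norm (G x))) (at x)"
proof -
  have a: "norm (G x) > 0" using G0 by simp
  have 1: "((\<lambda>x. norm (G x)) has_derivative (\<lambda>h. sgn (G x) \<bullet> H h)) (at x)"
    using has_derivative_compose[OF G has_derivative_norm[OF G0]] by (simp add: inner_commute)
  have 2: "((\<lambda>x. inverse (norm (G x))) has_derivative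
      (\<lambda>h. - (inverse (norm (G x)) * (sgn (G x) \<bullet> H h) * inverse (norm (G x))))) (at x)"
    using Deriv.has_derivative_inverse[OF _ 1] a by simp
  show ?thesis unfolding N_def
    using has_derivative_scaleR[OF 2 G]
    by (rule has_derivative_eq_rhs) (use a in \<open>auto simp: sgn_div_norm algebra_simps inner_commute\<close>)
qed

text \<open>Extends the outward normal to a unit field on an open set of the ambient space, so that
  ordinary derivatives can be used. The field is a normalized gradient; symmetry of its derivative
  on tangent vectors is the symmetry of the Hessian of the defining function.\<close>

lemma convex_core_local_normal:
  fixes C :: "'a::euclidean_space set"
  assumes C: "convex_core C" and p: "p \<in> frontier C"
  obtains U N DN where "open U" "p \<in> U"
    "\<And>x. x \<in> U \<Longrightarrow> (N has_derivative DN x) (at x)"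
    "\<And>v. continuous_on U (\<lambda>x. DN x v)"
    "\<And>x. x \<in> U \<Longrightarrow> norm (N x) = 1"
    "\<And>c. c \<in> frontier C \<Longrightarrow> c \<in> U \<Longrightarrow> is_inward_unit_normal C c (- N c)"
    "\<And>x v. x \<in> U \<Longrightarrow> DN x v \<bullet> N x = 0"
    "\<And>x u v. x \<in> U \<Longrightarrow> u \<bullet> N x = 0 \<Longrightarrow> v \<bullet> N x = 0 \<Longrightarrow> DN x u \<bullet> v = DN x v \<bullet> u"
proof -
  note Cs = convex_core_simps[OF C]
  obtain U0 g where U0: "open U0" "p \<in> U0" "C2_on U0 g" "\<not> (g has_derivative (\<lambda>v. 0)) (at p)"
    "frontier C \<inter> U0 = {x \<in> U0. g x = 0}"
    using C p unfolding convex_core_def C2_hypersurface_def by blast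
  obtain G0 H0 where G0: "\<And>x. x \<in> U0 \<Longrightarrow> (g has_derivative (\<lambda>v. G0 x \<bullet> v)) (at x)"
    "\<And>x. x \<in> U0 \<Longrightarrow> (G0 has_derivative H0 x) (at x)" "\<And>v. continuous_on U0 (\<lambda>x. H0 x v)"
    using U0(3) unfolding C2_on_def by blast
  have Gp: "G0 p \<noteq> 0" using U0(4) G0(1)[OF U0(2)] by auto
  \<comment> \<open>If an interior point happens to lie in the tangent plane, a small move along the
    gradient takes it off the plane and keeps it interior.\<close>
  obtain z where z: "z \<in> interior C" "(z - p) \<bullet> G0 p \<noteq> 0"
  proof -
    obtain z0 where z0: "z0 \<in> interior C" using Cs by blast
    obtain r where r: "r > 0" "ball z0 r \<subseteq> interior C" using z0 open_contains_ball by blast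
    show thesis
    proof (cases "(z0 - p) \<bullet> G0 p = 0")
      case False then show thesis using that z0 by blast
    next
      case True
      define z where "z = z0 + (r / (2 * norm (G0 p))) *\<^sub>R G0 p"
      have "dist z0 z < r" unfolding z_def using r Gp by (simp add: dist_norm)
      then have "z \<in> interior C" using r by auto
      moreover have "(z - p) \<bullet> G0 p = (z0 - p) \<bullet> G0 p + (r / (2 * norm (G0 p))) * (G0 p \<bullet> G0 p)"
        unfolding z_def by (simp add: inner_diff_left inner_add_left)
      then have "(z - p) \<bullet> G0 p \<noteq> 0" using True r Gp by simp
      ultimately show thesis using that by blast
    qed
  qed
  \<comment> \<open>The sign makes \<open>G p\<close> point away from \<open>z\<close>, hence
    outward.\<close>
  define \<sigma> :: real where "\<sigma> = (if (z - p) \<bullet> G0 p < 0 then 1 else - 1)"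
  have \<sigma>: "\<sigma> \<noteq> 0" "\<bar>\<sigma>\<bar> = 1" unfolding \<sigma>_def by auto
  define G where "G x = \<sigma> *\<^sub>R G0 x" for x
  define H where "H x v = \<sigma> *\<^sub>R H0 x v" for x v
  have g': "((\<lambda>x. \<sigma> * g x) has_derivative (\<lambda>v. G x \<bullet> v)) (at x)" if "x \<in> U0" for x
    using has_derivative_mult_right[OF G0(1)[OF that], of \<sigma>] unfolding G_def by simp
  have gm: "((\<lambda>x. - \<sigma> * g x) has_derivative (\<lambda>v. (- G x) \<bullet> v)) (at x)" if "x \<in> U0" for x
    using has_derivative_mult_right[OF G0(1)[OF that], of "- \<sigma>"] unfolding G_def by simp
  have G': "(G has_derivative H x) (at x)" if "x \<in> U0" for x
    using has_derivative_scaleR_right[OF G0(2)[OF that], of \<sigma>] unfolding G_def H_def .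
  have Gc: "continuous_on U0 G"
    using G' has_derivative_continuous by (metis continuous_at_imp_continuous_on)
  have Hc: "continuous_on U0 (\<lambda>x. H x v)" for v unfolding H_def by (intro continuous_intros G0)
  have Hs: "H x u \<bullet> v = H x v \<bullet> u" if "x \<in> U0" for x u v
    by (rule symmetric_second_derivative_at[OF U0(1) that g' G'[OF that]])
  \<comment> \<open>One interior point \<open>z\<close> orients the normal at all frontier points of
    \<open>U\<close>, and the strict inequality also excludes \<open>G x = 0\<close>.\<close>
  define U where "U = {x \<in> U0. (z - x) \<bullet> G x < 0}"
  have "continuous_on U0 (\<lambda>x. (z - x) \<bullet> G x)" by (intro continuous_intros Gc)
  then have "open {x \<in> U0. (\<lambda>x. (z - x) \<bullet> G x) x \<in> {..<0}}"
    using continuous_open_preimage[OF _ U0(1), of "\<lambda>x. (z - x) \<bullet> G x" "{..<0}"]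
    by (auto simp: vimage_def Int_def)
  then have U: "open U" unfolding U_def by simp
  have pU: "p \<in> U" unfolding U_def G_def \<sigma>_def using U0(2) z(2) by auto
  have UG: "G x \<noteq> 0" "x \<in> U0" if "x \<in> U" for x using that unfolding U_def by auto
  define N where "N x = G x /\<^sub>R norm (G x)" for x
  define DN where "DN x h = (H x h - (H x h \<bullet> N x) *\<^sub>R N x) /\<^sub>R norm (G x)" for x h
  have N1: "norm (N x) = 1" if "x \<in> U" for x using UG[OF that] unfolding N_def by simp
  have N2: "N x \<bullet> N x = 1" if "x \<in> U" for x using N1[OF that] by (simp add: norm_eq_1)
  show thesis
  proof (rule that[OF U pU, of N DN])
    show "(N has_derivative DN x) (at x)" if "x \<in> U" for x
      using has_derivative_normalize[OF G'[OF UG(2)[OF that]] UG(1)[OF that]]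
      unfolding N_def[abs_def] DN_def[abs_def] .
    have "continuous_on U G" "continuous_on U (\<lambda>x. H x v)" for v
      using Gc Hc continuous_on_subset UG(2) by blast+
    then show "continuous_on U (\<lambda>x. DN x v)" for v
      unfolding DN_def N_def by (auto intro!: continuous_intros dest: UG(1))
    show "norm (N x) = 1" if "x \<in> U" for x by (rule N1[OF that])
    show "is_inward_unit_normal C c (- N c)" if c: "c \<in> frontier C" "c \<in> U" for c
    proof -
      have "frontier C \<inter> U0 = {x \<in> U0. - \<sigma> * g x = 0}" using U0(5) \<sigma> by auto
      moreover have "(z - c) \<bullet> (- G c) > 0" using c(2) unfolding U_def by auto
      ultimately have "is_inward_unit_normal C c ((- G c) /\<^sub>R norm (- G c))"
        using inward_normal_of_gradient[OF Cs(3,2) c(1) U0(1) UG(2)[OF c(2)] gm[OF UG(2)[OF c(2)]] _ z(1)]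
        by blast
      then show ?thesis unfolding N_def by simp
    qed
    show "DN x v \<bullet> N x = 0" if "x \<in> U" for x v
      unfolding DN_def using N2[OF that] by (simp add: inner_diff_left)
    show "DN x u \<bullet> v = DN x v \<bullet> u" if "x \<in> U" "u \<bullet> N x = 0" "v \<bullet> N x = 0" for x u v
      unfolding DN_def using that Hs[OF UG(2)[OF that(1)], of u v]
      by (simp add: inner_diff_left inner_commute[of "N x"])
  qed
qed

lemma inward_normal_outward_normal:
  assumes "convex_core C" "c \<in> frontier C"
  shows "is_inward_unit_normal C c (- outward_normal C c)"
proof -
  obtain n where n: "is_inward_unit_normal C c n"
    by (rule convex_core_local_normal[OF assms]) (use assms in blast)
  then show ?thesis using inward_unit_normal_eq[OF n] unfolding outward_normal_def by simp
qed

lemma outward_normal_eq: "is_inward_unit_normal C c (- n) \<Longrightarrow> outward_normal C c = n"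
  unfolding outward_normal_def using inward_unit_normal_eq[of C c "- n"] by simp

lemma norm_outward_normal:
  assumes "convex_core C" "c \<in> frontier C"
  shows "norm (outward_normal C c) = 1" "outward_normal C c \<bullet> outward_normal C c = 1"
  using inward_normal_outward_normal[OF assms] unfolding is_inward_unit_normal_def
  by (auto simp: norm_eq_1)

text \<open>A point strictly beyond the tangent plane would give a segment from \<open>c\<close>
  that leaves \<open>C\<close> at once, against convexity.\<close>

lemma convex_core_halfspace:
  assumes C: "convex_core C" "c \<in> frontier C" and y: "y \<in> C"
  shows "(y - c) \<bullet> outward_normal C c \<le> 0"
proof (rule ccontr)
  assume "\<not> (y - c) \<bullet> outward_normal C c \<le> 0"
  then have "(y - c) \<bullet> (- outward_normal C c) < 0" by simp
  then obtain d where d: "d > 0" "\<And>s. 0 < s \<Longrightarrow> s < d \<Longrightarrow> c + s *\<^sub>R (y - c) \<notin> C"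
    using inward_ray_out[OF inward_normal_outward_normal[OF C]] by blast
  define s where "s = min 1 (d/2)"
  have s: "0 < s" "s < d" "s \<le> 1" unfolding s_def using d by auto
  have "c \<in> C" using convex_core_simps(5)[OF C(1)] C(2) by blast
  then have "c + s *\<^sub>R (y - c) \<in> C"
    using convexD_alt[OF convex_core_simps(3)[OF C(1)], of c y s] y s by (auto simp: algebra_simps)
  then show False using d(2) s by blast
qed

text \<open>The outward normal of a convex body is a monotone map, hence its derivative is positive
  semidefinite.\<close>

lemma outward_normal_derivative_nonneg:
  assumes C: "convex_core C" "c \<in> frontier C"
    and D: "(outward_normal C has_derivative W) (at c within frontier C)"
    and v: "v \<bullet> outward_normal C c = 0"
  shows "W v \<bullet> v \<ge> 0"
proof -
  have v': "v \<bullet> - outward_normal C c = 0" using v by simp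
  obtain y where y: "\<And>k. y k \<in> frontier C" "(\<lambda>k. real (Suc k) *\<^sub>R (y k - c)) \<longlonglongrightarrow> v"
    using tangent_sequence[OF inward_normal_outward_normal[OF C] v'] by blast
  let ?\<nu> = "outward_normal C"
  have "(\<lambda>k. (real (Suc k) *\<^sub>R (?\<nu> (y k) - ?\<nu> c)) \<bullet> (real (Suc k) *\<^sub>R (y k - c))) \<longlonglongrightarrow> W v \<bullet> v"
    by (intro tendsto_inner y(2) tangent_sequence_derivative[OF D y])
  moreover have "(real (Suc k) *\<^sub>R (?\<nu> (y k) - ?\<nu> c)) \<bullet> (real (Suc k) *\<^sub>R (y k - c)) \<ge> 0" for k
  proof -
    have in_C: "y k \<in> C" "c \<in> C" using y C convex_core_simps(5)[OF C(1)] by auto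
    have "(y k - c) \<bullet> ?\<nu> c \<le> 0" "(c - y k) \<bullet> ?\<nu> (y k) \<le> 0"
      using convex_core_halfspace[OF C in_C(1)] convex_core_halfspace[OF C(1) y(1)[of k] in_C(2)] .
    then have "(?\<nu> (y k) - ?\<nu> c) \<bullet> (y k - c) \<ge> 0"
      by (simp add: inner_diff_left inner_diff_right inner_commute)
    then show ?thesis by (simp del: of_nat_Suc)
  qed
  ultimately show ?thesis by (intro LIMSEQ_le_const) auto
qed

section \<open>Derivatives along the boundary\<close>

lemma frechet_derivative_tangent:
  fixes f :: "'a::euclidean_space \<Rightarrow> 'b::real_normed_vector"
  assumes n: "is_inward_unit_normal S x n" and v: "v \<bullet> n = 0"
    and f: "(f has_derivative A) (at x within frontier S)"
  shows "frechet_derivative f (at x within frontier S) v = A v"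
proof -
  have "f differentiable (at x within frontier S)" using f differentiableI by blast
  then have "(f has_derivative frechet_derivative f (at x within frontier S)) (at x within frontier S)"
    using frechet_derivative_works by blast
  then show ?thesis using derivative_tangent_unique[OF n v _ f] by blast
qed

text \<open>Removing the normal component does not alter a derivative along the frontier. Two
  tangent representatives of the same derivative coincide, as seen by testing on their difference,
  which makes the \<open>THE\<close> well defined.\<close>

lemma surface_grad_eq:
  assumes n: "is_inward_unit_normal C c (- \<nu>)"
    and f: "(f has_derivative (\<lambda>v. \<gamma> \<bullet> v)) (at c within frontier C)"
  shows "surface_grad C f c = \<gamma> - (\<gamma> \<bullet> \<nu>) *\<^sub>R \<nu>"
proof -
  have \<nu>: "outward_normal C c = \<nu>" using outward_normal_eq[OF n] .
  have \<nu>\<nu>: "\<nu> \<bullet> \<nu> = 1" using n unfolding is_inward_unit_normal_def by (simp add: norm_eq_1)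
  let ?g = "\<gamma> - (\<gamma> \<bullet> \<nu>) *\<^sub>R \<nu>"
  have g: "?g \<bullet> \<nu> = 0" using \<nu>\<nu> by (simp add: inner_diff_left)
  have T: "tangent_space C c = {v. v \<bullet> \<nu> = 0}" unfolding tangent_space_def \<nu> ..
  show ?thesis unfolding surface_grad_def
  proof (rule the_equality)
    have "(f has_derivative (\<lambda>v. ?g \<bullet> v)) (at c within frontier C)"
    proof (rule has_derivative_frontier_cong[OF n f])
      show "linear ((\<bullet>) ?g)" by (intro bounded_linear.linear bounded_linear_inner_right)
    qed (simp add: inner_diff_left inner_diff_right inner_commute)
    then show "?g \<in> tangent_space C c \<and> (f has_derivative (\<bullet>) ?g) (at c within frontier C)"
      using g T by simp
    fix h assume h: "h \<in> tangent_space C c \<and> (f has_derivative (\<bullet>) h) (at c within frontier C)"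
    have "(h - ?g) \<bullet> \<nu> = 0" using h g T by (simp add: inner_diff_left)
    then have "h \<bullet> (h - ?g) = \<gamma> \<bullet> (h - ?g)" and tn: "\<nu> \<bullet> (h - ?g) = 0"
      using derivative_tangent_unique[OF n _ _ f, of "h - ?g" "(\<bullet>) h"] h by (auto simp: inner_commute)
    then have "(h - ?g) \<bullet> (h - ?g) = 0" by (simp add: inner_diff_left)
    then show "h = ?g" by simp
  qed
qed

lemma has_derivative_zero_small:
  fixes f :: "'a::real_normed_vector \<Rightarrow> 'b::real_normed_vector"
  assumes le: "\<forall>\<^sub>F c in at x within M. norm (f c - f x) \<le> \<kappa> c * norm (c - x)"
    and \<kappa>: "(\<kappa> \<longlongrightarrow> 0) (at x within M)"
  shows "(f has_derivative (\<lambda>h. 0)) (at x within M)"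
  unfolding has_derivative_within_alt2
proof (intro conjI allI impI)
  show "bounded_linear (\<lambda>h::'a. 0::'b)" by (rule bounded_linear_zero)
  fix e :: real assume "e > 0"
  then have "\<forall>\<^sub>F c in at x within M. \<kappa> c < e" using \<kappa> order_tendstoD(2) by blast
  with le show "\<forall>\<^sub>F y in at x within M. norm (f y - f x - 0) \<le> e * norm (y - x)"
  proof eventually_elim
    case (elim c)
    have "\<kappa> c * norm (c - x) \<le> e * norm (c - x)" using elim by (intro mult_right_mono) auto
    then show ?case using elim by simp
  qed
qed

lemma has_derivative_bound:
  fixes f :: "'a::real_normed_vector \<Rightarrow> 'b::real_normed_vector"
  assumes f: "(f has_derivative A) (at x within M)"
  obtains K where "K > 0" "\<forall>\<^sub>F c in at x within M. norm (f c - f x) \<le> K * norm (c - x)"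
proof -
  obtain B where B: "B > 0" "\<And>h. norm (A h) \<le> norm h * B"
    using bounded_linear.pos_bounded[OF has_derivative_bounded_linear[OF f]] by blast
  have "\<forall>\<^sub>F c in at x within M. norm (f c - f x - A (c - x)) \<le> 1 * norm (c - x)"
    using f unfolding has_derivative_within_alt2 by (metis zero_less_one)
  then have "\<forall>\<^sub>F c in at x within M. norm (f c - f x) \<le> (B + 1) * norm (c - x)"
  proof eventually_elim
    case (elim c)
    then show ?case using norm_triangle_sub[of "f c - f x" "A (c - x)"] B(2)[of "c - x"]
      by (simp add: algebra_simps)
  qed
  then show thesis using that[of "B + 1"] B by simp
qed

text \<open>In finite dimension, pointwise convergence of linear maps is convergence in norm;
  \<open>\<kappa>\<close> sums the errors on the basis. The C2 condition supplies only continuity of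
  each \<open>H x v\<close> in \<open>x\<close>, while the argument \<open>w c\<close> moves with
  \<open>c\<close>.\<close>

lemma linear_family_diff_bound:
  fixes W :: "'b \<Rightarrow> 'a::euclidean_space \<Rightarrow> 'a"
  assumes lin: "\<forall>\<^sub>F c in F. linear (W c)" and lin0: "linear W0"
    and lim: "\<And>v. ((\<lambda>c. W c v) \<longlongrightarrow> W0 v) F"
  obtains \<kappa> where "(\<kappa> \<longlongrightarrow> (0::real)) F" "\<forall>\<^sub>F c in F. \<forall>w. norm (W c w - W0 w) \<le> \<kappa> c * norm w"
proof -
  define \<kappa> where "\<kappa> c = (\<Sum>b\<in>Basis. norm (W c b - W0 b))" for c
  have "((\<lambda>c. W c b - W0 b) \<longlongrightarrow> 0) F" for b using lim[of b] by (simp add: LIM_zero)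
  then have "(\<kappa> \<longlongrightarrow> (\<Sum>b\<in>(Basis::'a set). 0)) F"
    unfolding \<kappa>_def by (intro tendsto_sum tendsto_norm_zero)
  moreover have "\<forall>\<^sub>F c in F. \<forall>w. norm (W c w - W0 w) \<le> \<kappa> c * norm w"
    using lin
  proof eventually_elim
    case (elim c)
    show ?case
    proof
      fix w
      have l: "linear (\<lambda>w. W c w - W0 w)" using linear_compose_sub[OF elim lin0] .
      have "W c w - W0 w = (\<lambda>w. W c w - W0 w) (\<Sum>b\<in>Basis. (w \<bullet> b) *\<^sub>R b)" by (simp add: euclidean_representation)
      also have "\<dots> = (\<Sum>b\<in>Basis. (w \<bullet> b) *\<^sub>R (W c b - W0 b))"
        using linear_sum[OF l, of "\<lambda>b. (w \<bullet> b) *\<^sub>R b" Basis] linear_scale[OF l] by simp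
      finally have "W c w - W0 w = (\<Sum>b\<in>Basis. (w \<bullet> b) *\<^sub>R (W c b - W0 b))" .
      then have "norm (W c w - W0 w) \<le> (\<Sum>b\<in>Basis. norm ((w \<bullet> b) *\<^sub>R (W c b - W0 b)))"
        using norm_sum by metis
      also have "\<dots> \<le> (\<Sum>b\<in>Basis. norm (W c b - W0 b) * norm w)"
        by (intro sum_mono) (simp add: mult.commute mult_right_mono Basis_le_norm)
      also have "\<dots> = \<kappa> c * norm w" unfolding \<kappa>_def by (simp add: sum_distrib_right)
      finally show "norm (W c w - W0 w) \<le> \<kappa> c * norm w" .
    qed
  qed
  ultimately show thesis using that by simp
qed

text \<open>Secants of the image curve join points of \<open>frontier \<Omega>\<close>, so their
  component along \<open>n\<close> is negligible; in the limit \<open>A v \<bullet> n\<close> is at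
  most any multiple of \<open>norm (A v)\<close>. Only the existence of the normal at the image
  point is used.\<close>

lemma frontier_map_tangent:
  fixes f :: "'a::euclidean_space \<Rightarrow> 'b::euclidean_space"
  assumes m: "is_inward_unit_normal S x m" and v: "v \<bullet> m = 0"
    and f: "(f has_derivative A) (at x within frontier S)" and im: "f ` frontier S \<subseteq> frontier \<Omega>"
    and n: "is_inward_unit_normal \<Omega> (f x) n"
  shows "A v \<bullet> n = 0"
proof -
  obtain y where y: "\<And>k. y k \<in> frontier S" "(\<lambda>k. real (Suc k) *\<^sub>R (y k - x)) \<longlonglongrightarrow> v"
    using tangent_sequence[OF m v] by blast
  have L: "(\<lambda>k. real (Suc k) *\<^sub>R (f (y k) - f x)) \<longlonglongrightarrow> A v"
    by (rule tangent_sequence_derivative[OF f y])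
  have fy: "(\<lambda>k. f (y k)) \<longlonglongrightarrow> f x" by (rule tangent_sequence_tendsto[OF L])
  have le: "\<bar>A v \<bullet> n\<bar> \<le> e * norm (A v)" if e: "e > 0" for e
  proof -
    obtain d where d: "d > 0" "\<And>z. z \<in> frontier \<Omega> \<Longrightarrow> norm (z - f x) < d \<Longrightarrow> \<bar>(z - f x) \<bullet> n\<bar> \<le> e * norm (z - f x)"
      using frontier_near_tangent[OF n e] by blast
    have "eventually (\<lambda>k. dist (f (y k)) (f x) < d) sequentially" using fy d(1) tendstoD by blast
    then have "eventually (\<lambda>k. \<bar>(real (Suc k) *\<^sub>R (f (y k) - f x)) \<bullet> n\<bar>
        \<le> e * norm (real (Suc k) *\<^sub>R (f (y k) - f x))) sequentially"
    proof eventually_elim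
      case (elim k)
      have "\<bar>(f (y k) - f x) \<bullet> n\<bar> \<le> e * norm (f (y k) - f x)"
        using d(2) im y(1) elim by (auto simp: dist_norm)
      then have "real (Suc k) * \<bar>(f (y k) - f x) \<bullet> n\<bar> \<le> real (Suc k) * (e * norm (f (y k) - f x))"
        by (intro mult_left_mono) auto
      then show ?case by (simp add: abs_mult mult.left_commute del: of_nat_Suc)
    qed
    moreover have "(\<lambda>k. \<bar>(real (Suc k) *\<^sub>R (f (y k) - f x)) \<bullet> n\<bar>) \<longlonglongrightarrow> \<bar>A v \<bullet> n\<bar>"
      by (intro tendsto_intros L)
    moreover have "(\<lambda>k. e * norm (real (Suc k) *\<^sub>R (f (y k) - f x))) \<longlonglongrightarrow> e * norm (A v)"
      by (intro tendsto_intros L)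
    ultimately show ?thesis using tendsto_le[OF sequentially_bot] by blast
  qed
  show ?thesis
  proof (rule ccontr)
    assume a: "A v \<bullet> n \<noteq> 0"
    then have pos: "norm (A v) > 0" by auto
    have "\<bar>A v \<bullet> n\<bar> \<le> \<bar>A v \<bullet> n\<bar> / 2" using le[of "\<bar>A v \<bullet> n\<bar> / (2 * norm (A v))"] a pos by simp
    then show False using a by simp
  qed
qed

section \<open>The first point of the core on a half-line\<close>

definition hit_time :: "'a::euclidean_space set \<Rightarrow> 'a \<Rightarrow> 'a \<Rightarrow> real" where
  "hit_time C x n = (LEAST t::real. 0 \<le> t \<and> x + t *\<^sub>R n \<in> C)"

text \<open>\<open>LEAST\<close> on the reals is meaningful only if the infimum is attained, and
  closedness of the core provides this.\<close>

lemma hit_time: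
  assumes C: "closed C" and h: "halfline_meets C x n"
  shows "0 \<le> hit_time C x n" "x + hit_time C x n *\<^sub>R n \<in> C"
    "\<And>s. 0 \<le> s \<Longrightarrow> s < hit_time C x n \<Longrightarrow> x + s *\<^sub>R n \<notin> C"
proof -
  define A where "A = {t. 0 \<le> t \<and> x + t *\<^sub>R n \<in> C}"
  have "A = {0..} \<inter> (\<lambda>t. x + t *\<^sub>R n) -` C" unfolding A_def by auto
  moreover have "closed ((\<lambda>t. x + t *\<^sub>R n) -` C)"
    by (intro closed_vimage C continuous_intros)
  ultimately have "closed A" by (simp add: closed_Int)
  moreover have "A \<noteq> {}" using h unfolding A_def halfline_meets_def by auto
  moreover have bb: "bdd_below A" unfolding A_def by (rule bdd_belowI[of _ 0]) auto
  ultimately have I: "Inf A \<in> A" by (intro closed_contains_Inf)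
  have eq: "hit_time C x n = Inf A" unfolding hit_time_def
  proof (rule Least_equality)
    show "0 \<le> Inf A \<and> x + Inf A *\<^sub>R n \<in> C" using I unfolding A_def by simp
    show "Inf A \<le> y" if "0 \<le> y \<and> x + y *\<^sub>R n \<in> C" for y
      by (rule cInf_lower[OF _ bb]) (use that in \<open>auto simp: A_def\<close>)
  qed
  show "0 \<le> hit_time C x n" "x + hit_time C x n *\<^sub>R n \<in> C"
    using I unfolding eq by (auto simp: A_def)
  show "x + s *\<^sub>R n \<notin> C" if "0 \<le> s" "s < hit_time C x n" for s
    using cInf_lower[OF _ bb, of s] that unfolding eq by (force simp: A_def)
qed

text \<open>At an interior point of the core, a slightly earlier point of the half-line would lie in
  the core as well.\<close>

lemma hit_time_frontier:
  assumes C: "closed C" and h: "halfline_meets C x n" and x: "x \<notin> C" and n: "norm n = 1"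
  shows "x + hit_time C x n *\<^sub>R n \<in> frontier C"
proof -
  let ?t = "hit_time C x n"
  note ht = hit_time[OF C h]
  have t0: "?t > 0" using ht(1,2) x by (cases "?t = 0") auto
  have "x + ?t *\<^sub>R n \<notin> interior C"
  proof
    assume "x + ?t *\<^sub>R n \<in> interior C"
    then obtain r where r: "r > 0" "ball (x + ?t *\<^sub>R n) r \<subseteq> C" by (meson mem_interior)
    define s where "s = max 0 (?t - r / 2)"
    have s: "0 \<le> s" "s < ?t" "\<bar>?t - s\<bar> < r" unfolding s_def using t0 r by auto
    have "dist (x + ?t *\<^sub>R n) (x + s *\<^sub>R n) = \<bar>?t - s\<bar>"
      using n by (simp add: dist_norm flip: scaleR_left_diff_distrib)
    then have "x + s *\<^sub>R n \<in> C" using r s by (auto simp: subset_eq)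
    then show False using ht(3) s by blast
  qed
  then show ?thesis unfolding frontier_def using ht(2) closure_subset by auto
qed

text \<open>Up to first order the core is the half-space below its tangent plane, and the lines are nearly
  normal to it, so that the travel time is stationary.\<close>

lemma hit_point_has_derivative:
  fixes C :: "'a::euclidean_space set"
  assumes C: "convex_core C" and p: "p \<in> frontier C"
    and X: "(X has_derivative A) (at p within M)" and n: "(n has_derivative B) (at p within M)"
    and pM: "p \<in> M"
  defines "\<nu> \<equiv> outward_normal C p"
  assumes Xp: "X p = p + d *\<^sub>R \<nu>" and np: "n p = - \<nu>" and d: "d \<ge> 0"
    and AB: "\<And>h. (A h + d *\<^sub>R B h) \<bullet> \<nu> = 0"
    and hl: "\<And>c. c \<in> M \<Longrightarrow> halfline_meets C (X c) (n c)"
  shows "hit_time C (X p) (n p) = d"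
    and "((\<lambda>c. X c + hit_time C (X c) (n c) *\<^sub>R n c) has_derivative (\<lambda>h. A h + d *\<^sub>R B h)) (at p within M)"
proof -
  note Cs = convex_core_simps[OF C]
  let ?t = "\<lambda>c. hit_time C (X c) (n c)"
  have \<nu>: "norm \<nu> = 1" "\<nu> \<bullet> \<nu> = 1" unfolding \<nu>_def using norm_outward_normal[OF C p] by auto
  have inw: "is_inward_unit_normal C p (- \<nu>)" unfolding \<nu>_def by (rule inward_normal_outward_normal[OF C p])
  have half: "(y - p) \<bullet> \<nu> \<le> 0" if "y \<in> C" for y unfolding \<nu>_def by (rule convex_core_halfspace[OF C p that])
  note ht = hit_time[OF Cs(2) hl]
  \<comment> \<open>At \<open>p\<close> the line is exactly normal: it reaches \<open>p\<close> at
    time \<open>d\<close>, and at earlier times it is still strictly above the tangent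
    plane.\<close>
  show tp: "?t p = d"
  proof (rule antisym)
    show "?t p \<le> d"
    proof (rule ccontr)
      assume "\<not> ?t p \<le> d"
      then have "X p + d *\<^sub>R n p \<notin> C" using ht(3)[OF pM, of d] d by simp
      then show False using Xp np p Cs by auto
    qed
    have "X p + ?t p *\<^sub>R n p - p = (d - ?t p) *\<^sub>R \<nu>" using Xp np by (simp add: algebra_simps)
    then show "d \<le> ?t p" using half[OF ht(2)[OF pM]] \<nu> by simp
  qed
  \<comment> \<open>Position at the fixed time \<open>d\<close>, relative to \<open>p\<close>. By
    \<open>AB\<close> its derivative is tangential, so \<open>R c \<bullet> \<nu>\<close> is of
    higher order: the fixed time misses the tangent plane only slightly.\<close>
  define R where "R c = X c + d *\<^sub>R n c - p" for c
  define Q where "Q h = A h + d *\<^sub>R B h" for h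
  have R: "(R has_derivative Q) (at p within M)"
    unfolding R_def Q_def by (auto intro!: derivative_eq_intros X n)
  have Rp: "R p = 0" unfolding R_def using Xp np by simp
  obtain K where K: "K > 0" "\<forall>\<^sub>F c in at p within M. norm (R c - R p) \<le> K * norm (c - p)"
    using has_derivative_bound[OF R] by blast
  have nc: "(n \<longlongrightarrow> - \<nu>) (at p within M)"
    using has_derivative_continuous[OF n] np unfolding continuous_within by simp
  have Xc: "(X \<longlongrightarrow> X p) (at p within M)"
    using has_derivative_continuous[OF X] unfolding continuous_within by simp
  have tder: "(?t has_derivative (\<lambda>h. 0)) (at p within M)"
    unfolding has_derivative_within_alt2
  proof (intro conjI allI impI)
    show "bounded_linear (\<lambda>h::'a. 0::real)" by (rule bounded_linear_zero)
    fix \<epsilon> :: real assume \<epsilon>: "\<epsilon> > 0"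
    \<comment> \<open>\<open>k * h\<close> bounds the distance from \<open>p\<close> at time
      \<open>d + \<epsilon> * h\<close>, where \<open>h\<close> is \<open>norm (c - p)\<close>. With
      \<open>e2\<close> the cone condition then costs at most \<open>\<epsilon> * h / 8\<close>, and
      \<open>\<eta>\<close> keeps the point in the range where the cone lies in
      \<open>C\<close>.\<close>
    define k where "k = K + 2 * \<epsilon>"
    have k: "k > 0" unfolding k_def using K(1) \<epsilon> by simp
    define e2 where "e2 = \<epsilon> / (8 * k)"
    have e2: "e2 > 0" "e2 * k = \<epsilon> / 8" unfolding e2_def using \<epsilon> k by auto
    obtain \<delta> where \<delta>: "\<delta> > 0" "\<And>y. y \<noteq> p \<Longrightarrow> norm (y - p) < \<delta> \<Longrightarrow> (y - p) \<bullet> (- \<nu>) > e2 * norm (y - p) \<Longrightarrow> y \<in> C"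
      using is_inward_unit_normalE[OF inw e2(1)] by metis
    define \<eta> where "\<eta> = \<delta> / (2 * k)"
    have \<eta>: "\<eta> > 0" "\<eta> * k < \<delta>" unfolding \<eta>_def using k \<delta>(1) by auto
    have "\<forall>\<^sub>F c in at p within M. norm (R c - R p - Q (c - p)) \<le> \<epsilon> / 4 * norm (c - p)"
      using R \<epsilon> unfolding has_derivative_within_alt2 by (metis divide_pos_pos zero_less_numeral)
    moreover note K(2)
    moreover have "\<forall>\<^sub>F c in at p within M. dist (n c) (- \<nu>) < 1 / 2" using nc by (rule tendstoD) simp
    moreover have "\<forall>\<^sub>F c in at p within M. dist c p < \<eta>"
      using tendsto_ident_at \<eta>(1) by (rule tendstoD)
    moreover have "\<forall>\<^sub>F c in at p within M. c \<in> M \<and> c \<noteq> p"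
      by (auto simp: eventually_at_filter)
    ultimately show "\<forall>\<^sub>F c in at p within M. norm (?t c - ?t p - 0) \<le> \<epsilon> * norm (c - p)"
    proof eventually_elim
      case (elim c)
      define h where "h = norm (c - p)"
      have h: "h > 0" "h < \<eta>" unfolding h_def using elim by (auto simp: dist_norm)
      define \<delta>n where "\<delta>n = n c + \<nu>"
      have dn: "norm \<delta>n < 1 / 2" using elim(3) unfolding \<delta>n_def by (simp add: dist_norm)
      then have dn': "\<bar>\<delta>n \<bullet> \<nu>\<bar> < 1 / 2" using Cauchy_Schwarz_ineq2[of \<delta>n \<nu>] \<nu> by simp
      have q: "X c + (d + s) *\<^sub>R n c - p = R c - s *\<^sub>R \<nu> + s *\<^sub>R \<delta>n" for s
        unfolding R_def \<delta>n_def by (simp add: algebra_simps)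
      have q\<nu>: "(X c + (d + s) *\<^sub>R n c - p) \<bullet> \<nu> = R c \<bullet> \<nu> - s + s * (\<delta>n \<bullet> \<nu>)" for s
        unfolding q using \<nu> by (simp add: inner_diff_left inner_add_left)
      have "R c \<bullet> \<nu> = (R c - R p - Q (c - p)) \<bullet> \<nu>"
        using AB[of "c - p"] Rp unfolding Q_def[symmetric] by (simp add: inner_diff_left)
      then have R\<nu>: "\<bar>R c \<bullet> \<nu>\<bar> \<le> \<epsilon> / 4 * h"
        using Cauchy_Schwarz_ineq2[of "R c - R p - Q (c - p)" \<nu>] \<nu> elim(1) unfolding h_def by simp
      have Rn: "norm (R c) \<le> K * h" using elim(2) Rp unfolding h_def by simp
      have cM: "c \<in> M" using elim by simp
      \<comment> \<open>By time \<open>d + \<epsilon> * h\<close> the point has sunk at least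
        \<open>\<epsilon> * h / 4\<close> below the tangent plane while staying at distance
        \<open>k * h\<close>, so it is in the cone inside \<open>C\<close>.\<close>
      have le: "?t c \<le> d + \<epsilon> * h"
      proof (rule ccontr)
        assume a: "\<not> ?t c \<le> d + \<epsilon> * h"
        let ?y = "X c + (d + \<epsilon> * h) *\<^sub>R n c"
        have eh: "\<epsilon> * h > 0" using \<epsilon> h by simp
        have "?y \<notin> C" using ht(3)[OF cM, of "d + \<epsilon> * h"] a d eh by simp
        have "\<epsilon> * h * (\<delta>n \<bullet> \<nu>) \<le> \<epsilon> * h * (1 / 2)" using dn' eh by (intro mult_left_mono) auto
        then have 1: "(?y - p) \<bullet> (- \<nu>) \<ge> \<epsilon> * h / 4" using q\<nu>[of "\<epsilon> * h"] R\<nu> by (simp add: field_simps)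
        have "norm (?y - p) \<le> norm (R c) + norm ((\<epsilon> * h) *\<^sub>R \<nu>) + norm ((\<epsilon> * h) *\<^sub>R \<delta>n)"
          unfolding q using norm_triangle_ineq[of "R c - (\<epsilon> * h) *\<^sub>R \<nu>" "(\<epsilon> * h) *\<^sub>R \<delta>n"]
            norm_triangle_ineq4[of "R c" "(\<epsilon> * h) *\<^sub>R \<nu>"] by linarith
        also have "\<dots> \<le> K * h + \<epsilon> * h + \<epsilon> * h"
        proof -
          have "norm ((\<epsilon> * h) *\<^sub>R \<nu>) = \<epsilon> * h" using \<nu> eh by simp
          moreover have "norm ((\<epsilon> * h) *\<^sub>R \<delta>n) \<le> \<epsilon> * h"
            using mult_left_mono[of "norm \<delta>n" 1 "\<epsilon> * h"] dn eh by simp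
          ultimately show ?thesis using Rn by linarith
        qed
        finally have 2: "norm (?y - p) \<le> k * h" unfolding k_def by (simp add: algebra_simps)
        have "k * h < k * \<eta>" using h k by (intro mult_strict_left_mono) auto
        then have 3: "norm (?y - p) < \<delta>" using 2 \<eta>(2) by (simp add: mult.commute)
        have "e2 * norm (?y - p) \<le> e2 * (k * h)" using 2 e2 by (intro mult_left_mono) auto
        also have "\<dots> = \<epsilon> / 8 * h" using e2(2) by (simp add: mult.assoc[symmetric])
        also have "\<dots> < \<epsilon> * h / 4" using eh by simp
        finally have "(?y - p) \<bullet> (- \<nu>) > e2 * norm (?y - p)" using 1 by linarith
        moreover have "?y \<noteq> p" using 1 eh by auto
        ultimately show False using \<delta>(2) 3 \<open>?y \<notin> C\<close> by blast
      qed
      \<comment> \<open>More than \<open>\<epsilon> * h\<close> before time \<open>d\<close> the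
        point is still above the tangent plane, which supports \<open>C\<close>.\<close>
      have ge: "?t c \<ge> d - \<epsilon> * h"
      proof (rule ccontr)
        assume a: "\<not> ?t c \<ge> d - \<epsilon> * h"
        define s where "s = ?t c - d"
        have s: "s < - (\<epsilon> * h)" unfolding s_def using a by simp
        have sn: "s < 0" using s \<epsilon> h by (smt (verit) mult_pos_pos)
        have "s * (\<delta>n \<bullet> \<nu>) \<ge> s * (1 / 2)" using dn' sn by (intro mult_left_mono_neg) auto
        moreover have "R c \<bullet> \<nu> - s + s * (\<delta>n \<bullet> \<nu>) \<le> 0"
          using half[OF ht(2)[OF cM]] q\<nu>[of s] unfolding s_def by simp
        ultimately have "- (s / 2) \<le> \<epsilon> / 4 * h" using R\<nu> by (simp add: abs_if split: if_splits)
        moreover have "\<epsilon> * h > 0" using \<epsilon> h by simp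
        ultimately show False using s by (simp add: field_simps)
      qed
      show ?case using le ge tp unfolding h_def by (simp add: abs_le_iff)
    qed
  qed
  show "((\<lambda>c. X c + ?t c *\<^sub>R n c) has_derivative (\<lambda>h. A h + d *\<^sub>R B h)) (at p within M)"
    using has_derivative_add[OF X has_derivative_scaleR[OF tder n]] tp by simp
qed

section \<open>Linearization of the return map\<close>

lemma return_map_eq:
  "return_map C \<Omega> c = radial_map C \<Omega> c +
     hit_time C (radial_map C \<Omega> c) (inward_unit_normal \<Omega> (radial_map C \<Omega> c)) *\<^sub>R
       inward_unit_normal \<Omega> (radial_map C \<Omega> c)"
  unfolding return_map_def reciprocal_map_def hit_time_def by (simp add: Let_def)

lemma return_configurationD:
  assumes conf: "return_configuration C \<Omega> p"
  shows "convex_core C" "\<Omega> \<in> domain_class C"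
    "\<And>b. b \<in> frontier C \<Longrightarrow> bdd_above (thickness_set C \<Omega> b)"
    "C2_on_hypersurface (frontier C) (thickness C \<Omega>)"
    "radial_map C \<Omega> ` frontier C \<subseteq> reciprocal_domain C \<Omega>"
    "p \<in> frontier C" "surface_grad C (thickness C \<Omega>) p = 0"
    "bij_betw (thickness_hess C \<Omega> p) (tangent_space C p) (tangent_space C p)"
proof -
  show "bij_betw (thickness_hess C \<Omega> p) (tangent_space C p) (tangent_space C p)"
    using assms unfolding return_configuration_def nondegenerate_critical_def
    by (auto simp: thickness_hess_def[abs_def])
qed (use assms in \<open>auto simp: return_configuration_def nondegenerate_critical_def\<close>)

text \<open>The thickness is positive because the radial point avoids \<open>C\<close> while
  \<open>c\<close> belongs to it. The inward normal has negative component along the outward normal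
  at \<open>c\<close>, because its half-line must descend from height \<open>d\<close> above the
  tangent plane to the core beneath it.\<close>

lemma radial_point:
  assumes conf: "return_configuration C \<Omega> p" and c: "c \<in> frontier C"
  defines "x \<equiv> radial_map C \<Omega> c"
  shows "x \<in> frontier \<Omega>" "x \<notin> C" "is_inward_unit_normal \<Omega> x (inward_unit_normal \<Omega> x)"
    "halfline_meets C x (inward_unit_normal \<Omega> x)" "norm (inward_unit_normal \<Omega> x) = 1"
    "thickness C \<Omega> c > 0" "inward_unit_normal \<Omega> x \<bullet> outward_normal C c < 0"
proof -
  note cd = return_configurationD[OF conf]
  have "x \<in> reciprocal_domain C \<Omega>" using cd(5) c unfolding x_def by blast
  then obtain n where n: "x \<in> frontier \<Omega>" "x \<notin> C" "is_inward_unit_normal \<Omega> x n" "halfline_meets C x n"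
    unfolding reciprocal_domain_def by blast
  have eq: "inward_unit_normal \<Omega> x = n" by (rule inward_unit_normal_eq[OF n(3)])
  show *: "x \<in> frontier \<Omega>" "x \<notin> C" "is_inward_unit_normal \<Omega> x (inward_unit_normal \<Omega> x)"
    "halfline_meets C x (inward_unit_normal \<Omega> x)" "norm (inward_unit_normal \<Omega> x) = 1"
    unfolding eq using n unfolding is_inward_unit_normal_def by auto
  have "0 \<le> thickness C \<Omega> c" unfolding thickness_def
    by (intro cSup_upper) (use cd(3)[OF c] in auto)
  moreover have "thickness C \<Omega> c \<noteq> 0"
    using n(2) c convex_core_simps(5)[OF cd(1)] unfolding x_def radial_map_def by auto
  ultimately show d: "thickness C \<Omega> c > 0" by simp
  obtain t where t: "t \<ge> 0" "x + t *\<^sub>R n \<in> C" using n(4) unfolding halfline_meets_def by blast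
  have "(x + t *\<^sub>R n - c) \<bullet> outward_normal C c \<le> 0" by (rule convex_core_halfspace[OF cd(1) c t(2)])
  then have "thickness C \<Omega> c + t * (n \<bullet> outward_normal C c) \<le> 0"
    unfolding x_def radial_map_def using norm_outward_normal(2)[OF cd(1) c] by (simp add: inner_add_left)
  then have "t * (n \<bullet> outward_normal C c) < 0" using d by linarith
  then show "inward_unit_normal \<Omega> x \<bullet> outward_normal C c < 0"
    unfolding eq using t(1) by (metis linorder_not_less mult_nonneg_nonneg)
qed

lemma return_map_frontier:
  assumes conf: "return_configuration C \<Omega> p"
  shows "return_map C \<Omega> ` frontier C \<subseteq> frontier C"
proof
  fix y assume "y \<in> return_map C \<Omega> ` frontier C"
  then obtain c where c: "c \<in> frontier C" "y = return_map C \<Omega> c" by blast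
  note rp = radial_point[OF conf c(1)]
  show "y \<in> frontier C" unfolding c(2) return_map_eq
    by (rule hit_time_frontier[OF convex_core_simps(2)[OF return_configurationD(1)[OF conf]] rp(4,2,5)])
qed

text \<open>Besides the orthogonality relation, this records the estimates that replace
  differentiability of the normal. Pairing the relation with \<open>w\<close> and using positivity
  of \<open>W\<close> gives \<open>norm w <= norm g\<close>; unit length of \<open>n\<close> makes
  \<open>b\<close> differ from 1 only to second order in \<open>w\<close>.\<close>

lemma domain_normal_equation:
  assumes conf: "return_configuration C \<Omega> p" and c: "c \<in> frontier C"
    and W: "(outward_normal C has_derivative W) (at c within frontier C)"
    and Wt: "\<And>v. W v \<bullet> outward_normal C c = 0"
    and Ws: "\<And>u v. u \<bullet> outward_normal C c = 0 \<Longrightarrow> v \<bullet> outward_normal C c = 0 \<Longrightarrow> W u \<bullet> v = W v \<bullet> u"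
    and D: "(thickness C \<Omega> has_derivative (\<lambda>v. \<gamma> \<bullet> v)) (at c within frontier C)"
  defines "n \<equiv> inward_unit_normal \<Omega> (radial_map C \<Omega> c)" and "\<nu> \<equiv> outward_normal C c"
    and "g \<equiv> surface_grad C (thickness C \<Omega>) c" and "d \<equiv> thickness C \<Omega> c"
  defines "b \<equiv> - (n \<bullet> \<nu>)"
  defines "w \<equiv> n + b *\<^sub>R \<nu>"
  shows "w \<bullet> \<nu> = 0" "w + d *\<^sub>R W w = b *\<^sub>R g" "norm w \<le> norm g" "0 < b" "b \<le> 1" "\<bar>b - 1\<bar> \<le> norm w ^ 2"
proof -
  note cd = return_configurationD[OF conf]
  note rp = radial_point[OF conf c, folded n_def \<nu>_def d_def]
  have \<nu>\<nu>: "\<nu> \<bullet> \<nu> = 1" "norm \<nu> = 1" unfolding \<nu>_def using norm_outward_normal[OF cd(1) c] by auto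
  have inw: "is_inward_unit_normal C c (- \<nu>)" unfolding \<nu>_def by (rule inward_normal_outward_normal[OF cd(1) c])
  have g: "g = \<gamma> - (\<gamma> \<bullet> \<nu>) *\<^sub>R \<nu>" unfolding g_def by (rule surface_grad_eq[OF inw D])
  have g\<nu>: "g \<bullet> \<nu> = 0" unfolding g using \<nu>\<nu> by (simp add: inner_diff_left)
  show w\<nu>: "w \<bullet> \<nu> = 0" unfolding w_def b_def using \<nu>\<nu> by (simp add: inner_add_left inner_diff_left)
  show b: "0 < b" unfolding b_def using rp(7) by simp
  have nw: "n = w - b *\<^sub>R \<nu>" unfolding w_def by simp
  have "n \<bullet> n = 1" using rp(5) by (simp add: norm_eq_1)
  then have bw: "b\<^sup>2 + (norm w)\<^sup>2 = 1"
    unfolding nw using w\<nu> \<nu>\<nu>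
    by (simp add: inner_diff_left inner_diff_right inner_commute power2_norm_eq_inner) (simp add: power2_eq_square)
  have "b\<^sup>2 \<le> 1" using bw zero_le_power2[of "norm w"] by linarith
  then show b1: "b \<le> 1" by (simp add: abs_square_le_1)
  \<comment> \<open>Hence \<open>1 - b\<close> is at most \<open>1 - b * b\<close>, which is the
    square of \<open>norm w\<close>.\<close>
  have "b\<^sup>2 \<le> b" using b b1 by (simp add: power2_eq_square mult_left_le)
  then show "\<bar>b - 1\<bar> \<le> norm w ^ 2" using bw b1 by simp
  have Phi: "(radial_map C \<Omega> has_derivative (\<lambda>h. h + (d *\<^sub>R W h + (\<gamma> \<bullet> h) *\<^sub>R \<nu>))) (at c within frontier C)"
    unfolding radial_map_def[abs_def] d_def \<nu>_def
    by (intro has_derivative_add has_derivative_ident has_derivative_scaleR D W)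
  have im: "radial_map C \<Omega> ` frontier C \<subseteq> frontier \<Omega>"
    using cd(5) unfolding reciprocal_domain_def by blast
  \<comment> \<open>The vector whose vanishing is the relation. It is tangent and orthogonal to all
    tangent vectors, in particular to itself.\<close>
  let ?z = "w + d *\<^sub>R W w - b *\<^sub>R g"
  have z\<nu>: "?z \<bullet> \<nu> = 0" using w\<nu> g\<nu> Wt by (simp add: inner_diff_left inner_add_left \<nu>_def)
  have "?z \<bullet> h = 0" if h: "h \<bullet> \<nu> = 0" for h
  proof -
    have "h \<bullet> (- \<nu>) = 0" using h by simp
    from frontier_map_tangent[OF inw this Phi im rp(3)]
    have "(h + (d *\<^sub>R W h + (\<gamma> \<bullet> h) *\<^sub>R \<nu>)) \<bullet> (w - b *\<^sub>R \<nu>) = 0" using nw by (simp add: n_def)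
    moreover have "\<gamma> \<bullet> h = g \<bullet> h" unfolding g using h by (simp add: inner_diff_left inner_diff_right inner_commute)
    moreover have "W h \<bullet> w = W w \<bullet> h" using Ws[of h w] h w\<nu> unfolding \<nu>_def by blast
    moreover have "W h \<bullet> \<nu> = 0" unfolding \<nu>_def by (rule Wt)
    ultimately have "h \<bullet> w + d * (W w \<bullet> h) - b * (g \<bullet> h) = 0"
      using h w\<nu> \<nu>\<nu> by (simp add: inner_add_left inner_diff_right inner_commute[of \<nu> w] algebra_simps)
    then show ?thesis by (simp add: inner_add_left inner_diff_left inner_add_right inner_diff_right inner_commute)
  qed
  from this[OF z\<nu>] show eq: "w + d *\<^sub>R W w = b *\<^sub>R g" by simp
  have "W w \<bullet> w \<ge> 0"
    using outward_normal_derivative_nonneg[OF cd(1) c W] w\<nu> unfolding \<nu>_def by blast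
  then have "(norm w)\<^sup>2 \<le> (w + d *\<^sub>R W w) \<bullet> w" using rp(6) by (simp add: inner_add_left power2_norm_eq_inner)
  also have "\<dots> = b * (g \<bullet> w)" unfolding eq by simp
  also have "\<dots> \<le> b * (norm g * norm w)" using b norm_cauchy_schwarz[of g w] by simp
  also have "\<dots> \<le> 1 * (norm g * norm w)" using b1 by (intro mult_right_mono) auto
  finally have "norm w * norm w \<le> norm g * norm w" by (simp add: power2_eq_square)
  then show "norm w \<le> norm g" by (cases "w = 0") auto
qed

text \<open>The operators are provided as linear maps of the whole space, although only their values
  on \<open>T\<close> have meaning; \<open>L\<close> is arranged to take tangent values everywhere.
  The last relation avoids the inverse of \<open>J\<close>, so symmetry can later be read off
  directly.\<close>

lemma return_map_linearization:
  fixes C \<Omega> :: "'a::euclidean_space set"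
  assumes conf: "return_configuration C \<Omega> p"
  defines "d \<equiv> thickness C \<Omega> p" and "T \<equiv> tangent_space C p"
  obtains H W L where "linear H" "linear W" "linear L"
    "\<And>v. v \<in> T \<Longrightarrow> thickness_hess C \<Omega> p v = H v" "\<And>v. v \<in> T \<Longrightarrow> H v \<in> T"
    "\<And>u v. u \<in> T \<Longrightarrow> v \<in> T \<Longrightarrow> H u \<bullet> v = H v \<bullet> u"
    "(surface_grad C (thickness C \<Omega>) has_derivative H) (at p within frontier C)"
    "\<And>v. v \<in> T \<Longrightarrow> shape_operator C p v = - W v" "\<And>v. v \<in> T \<Longrightarrow> W v \<in> T"
    "\<And>u v. u \<in> T \<Longrightarrow> v \<in> T \<Longrightarrow> W u \<bullet> v = W v \<bullet> u" "\<And>v. v \<in> T \<Longrightarrow> W v \<bullet> v \<ge> 0"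
    "return_map C \<Omega> p = p"
    "(return_map C \<Omega> has_derivative L) (at p within frontier C)"
    "\<And>v. L v \<in> T"
    "\<And>v. v \<in> T \<Longrightarrow> (L v - v) + d *\<^sub>R W (L v - v) = d *\<^sub>R H v"
proof -
  note cd = return_configurationD[OF conf]
  let ?M = "frontier C" and ?\<theta> = "thickness C \<Omega>" and ?\<nu> = "outward_normal C"
  note pM = cd(6)

  \<comment> \<open>Ambient extensions of the normal and of the thickness\<close>
  obtain U N DN where U: "open U" "p \<in> U"
    and N: "\<And>x. x \<in> U \<Longrightarrow> (N has_derivative DN x) (at x)"
    and DNc: "\<And>v. continuous_on U (\<lambda>x. DN x v)"
    and N1: "\<And>x. x \<in> U \<Longrightarrow> norm (N x) = 1"
    and Ni: "\<And>c. c \<in> ?M \<Longrightarrow> c \<in> U \<Longrightarrow> is_inward_unit_normal C c (- N c)"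
    and DNt: "\<And>x v. x \<in> U \<Longrightarrow> DN x v \<bullet> N x = 0"
    and DNs: "\<And>x u v. x \<in> U \<Longrightarrow> u \<bullet> N x = 0 \<Longrightarrow> v \<bullet> N x = 0 \<Longrightarrow> DN x u \<bullet> v = DN x v \<bullet> u"
    by (rule convex_core_local_normal[OF cd(1) pM], rule that, assumption+)
  obtain U2 D where U2: "open U2" "p \<in> U2" "C2_on U2 D" and \<theta>D: "\<And>x. x \<in> ?M \<inter> U2 \<Longrightarrow> ?\<theta> x = D x"
    using cd(4) pM unfolding C2_on_hypersurface_def by metis
  obtain G HD where G: "\<And>x. x \<in> U2 \<Longrightarrow> (D has_derivative (\<lambda>v. G x \<bullet> v)) (at x)"
    and HD: "\<And>x. x \<in> U2 \<Longrightarrow> (G has_derivative HD x) (at x)"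
    using U2(3) unfolding C2_on_def by blast
  define V where "V = U \<inter> U2"
  have V: "open V" "p \<in> V" unfolding V_def using U U2 by auto
  have nV: "\<forall>\<^sub>F c in at p within ?M. c \<in> ?M \<and> c \<in> V \<and> c \<noteq> p"
    unfolding eventually_at_filter using V by (auto simp: eventually_nhds intro!: exI[of _ V])
  have \<nu>N: "?\<nu> c = N c" if "c \<in> ?M" "c \<in> V" for c
    using outward_normal_eq Ni that unfolding V_def by blast
  have \<nu>der: "(?\<nu> has_derivative DN c) (at c within ?M)" if c: "c \<in> ?M" "c \<in> V" for c
  proof (rule has_derivative_transform_eventually)
    show "(N has_derivative DN c) (at c within ?M)" using N c has_derivative_at_withinI unfolding V_def by blast
    have "eventually (\<lambda>x. x \<in> V) (nhds c)" using V c(2) eventually_nhds by blast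
    then show "\<forall>\<^sub>F x in at c within ?M. N x = ?\<nu> x"
      unfolding eventually_at_filter by eventually_elim (simp add: \<nu>N)
  qed (use c \<nu>N in auto)
  have \<theta>der: "(?\<theta> has_derivative (\<lambda>v. G c \<bullet> v)) (at c within ?M)" if c: "c \<in> ?M" "c \<in> V" for c
  proof (rule has_derivative_transform_eventually)
    show "(D has_derivative (\<lambda>v. G c \<bullet> v)) (at c within ?M)" using G c has_derivative_at_withinI unfolding V_def by blast
    have "eventually (\<lambda>x. x \<in> V) (nhds c)" using V c(2) eventually_nhds by blast
    then show "\<forall>\<^sub>F x in at c within ?M. D x = ?\<theta> x"
      unfolding eventually_at_filter by eventually_elim (simp add: \<theta>D V_def)
  qed (use c \<theta>D V_def in auto)

  \<comment> \<open>Surface gradient and Hessian at the critical point\<close>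
  define gr where "gr = surface_grad C ?\<theta>"
  have gr: "gr c = G c - (G c \<bullet> N c) *\<^sub>R N c" if c: "c \<in> ?M" "c \<in> V" for c
    unfolding gr_def using surface_grad_eq[OF _ \<theta>der[OF c]] Ni c unfolding V_def by blast
  define \<nu> where "\<nu> = N p"
  define W where "W = DN p"
  have \<nu>p: "?\<nu> p = \<nu>" unfolding \<nu>_def by (rule \<nu>N[OF pM V(2)])
  have \<nu>1: "norm \<nu> = 1" "\<nu> \<bullet> \<nu> = 1" unfolding \<nu>_def using N1 V by (auto simp: V_def norm_eq_1)
  have T: "T = {v. v \<bullet> \<nu> = 0}" unfolding T_def tangent_space_def \<nu>p ..
  have inw: "is_inward_unit_normal C p (- \<nu>)" unfolding \<nu>_def using Ni pM V unfolding V_def by blast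
  have linW: "linear W" unfolding W_def using N[of p] V has_derivative_linear unfolding V_def by blast
  have Wt: "W v \<bullet> \<nu> = 0" for v unfolding W_def \<nu>_def using DNt V unfolding V_def by blast
  have Ws: "W u \<bullet> v = W v \<bullet> u" if "u \<in> T" "v \<in> T" for u v
    using DNs[of p u v] V that unfolding W_def T \<nu>_def V_def by blast
  have Wp: "W v \<bullet> v \<ge> 0" if "v \<in> T" for v
    using outward_normal_derivative_nonneg[OF cd(1) pM \<nu>der[OF pM V(2)]] that unfolding T \<nu>p W_def by blast
  have d: "d > 0" unfolding d_def by (rule radial_point(6)[OF conf pM])
  have gp: "gr p = 0" unfolding gr_def by (rule cd(7))
  then have Gp: "G p = (G p \<bullet> \<nu>) *\<^sub>R \<nu>" using gr[OF pM V(2)] unfolding \<nu>_def by simp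
  \<comment> \<open>The product rule for the tangential part of \<open>G\<close>. Since
    \<open>G p\<close> is normal at the critical point, on tangent vectors this is the tangential
    ambient Hessian corrected by the curvature term \<open>(G p \<bullet> \<nu>) W\<close>; both
    terms are symmetric there.\<close>
  define E where "E h = HD p h - ((HD p h \<bullet> \<nu> + G p \<bullet> W h) *\<^sub>R \<nu> + (G p \<bullet> \<nu>) *\<^sub>R W h)" for h
  have E1: "((\<lambda>c. G c - (G c \<bullet> N c) *\<^sub>R N c) has_derivative E) (at p within ?M)"
  proof -
    have a: "(G has_derivative HD p) (at p within ?M)" using HD U2 has_derivative_at_withinI by blast
    have b: "(N has_derivative W) (at p within ?M)" unfolding W_def using N U has_derivative_at_withinI by blast
    show ?thesis
      by (rule has_derivative_eq_rhs[OF has_derivative_diff[OF a has_derivative_scaleR[OF has_derivative_inner[OF a b] b]]])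
        (auto simp: E_def \<nu>_def algebra_simps)
  qed
  have E: "(gr has_derivative E) (at p within ?M)"
    by (rule has_derivative_transform_eventually[OF E1])
      (use nV gr pM V in \<open>auto elim!: eventually_mono\<close>)
  have linE: "linear E" using E has_derivative_linear by blast
  have Gw: "G p \<bullet> W h = 0" for h by (subst Gp) (simp add: Wt inner_commute[of \<nu>])
  have Et: "E h \<bullet> \<nu> = 0" for h
    unfolding E_def using \<nu>1 Gw Wt by (simp add: inner_diff_left inner_add_left)
  have Es: "E u \<bullet> v = E v \<bullet> u" if "u \<in> T" "v \<in> T" for u v
  proof -
    have "HD p u \<bullet> v = HD p v \<bullet> u"
      by (rule symmetric_second_derivative_at[OF U2(1,2) G HD[OF U2(2)]])
    then show ?thesis using Ws[OF that] that unfolding E_def T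
      by (simp add: inner_diff_left inner_add_left inner_commute[of \<nu>])
  qed
  have hess: "thickness_hess C \<Omega> p v = E v" if v: "v \<in> T" for v
  proof -
    have "frechet_derivative gr (at p within ?M) v = E v"
      using frechet_derivative_tangent[OF inw _ E] v unfolding T by simp
    then show ?thesis unfolding thickness_hess_def surface_hess_def gr_def[symmetric] tangent_proj_def \<nu>p
      using Et by simp
  qed
  have shape: "shape_operator C p v = - W v" if v: "v \<in> T" for v
    unfolding shape_operator_def
    using frechet_derivative_tangent[OF inw _ \<nu>der[OF pM V(2)]] v unfolding T W_def by simp

  \<comment> \<open>Invertibility of \<open>J\<close>\<close>
  define J where "J x = x + d *\<^sub>R W x" for x
  have linJ: "linear J" unfolding J_def
    by (intro linear_compose_add linear_compose_scale_right linW linear_ident)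
  \<comment> \<open>\<open>W\<close> has tangent values, so \<open>J\<close> preserves the normal
    component; a kernel vector is therefore tangent, and there \<open>J\<close> dominates the
    identity.\<close>
  have "inj J" unfolding linear_injective_0[OF linJ]
  proof (intro allI impI)
    fix x assume x: "J x = 0"
    have "J x \<bullet> \<nu> = x \<bullet> \<nu>" unfolding J_def using Wt by (simp add: inner_add_left)
    then have xT: "x \<in> T" unfolding T using x by simp
    have "x \<bullet> x + d * (W x \<bullet> x) = J x \<bullet> x" unfolding J_def by (simp add: inner_add_left)
    then have "x \<bullet> x \<le> 0" using x Wp[OF xT] d by (simp add: add_nonneg_eq_0_iff)
    then show "x = 0" using inner_gt_zero_iff[of x] by linarith
  qed
  then obtain J' where J': "linear J'" "J' \<circ> J = id" using linear_injective_left_inverse[OF linJ] by blast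
  have J'J: "J' (J x) = x" for x using J'(2) by (metis comp_apply id_apply)
  have "surj J" using linJ \<open>inj J\<close> by (rule linear_inj_imp_surj)
  then have JJ': "J (J' x) = x" for x using J'J by (metis surjD)

  \<comment> \<open>Differentiability of the normal of the domain along the radial map\<close>
  define n where "n c = inward_unit_normal \<Omega> (radial_map C \<Omega> c)" for c
  define b where "b c = - (n c \<bullet> ?\<nu> c)" for c
  define w where "w c = n c + b c *\<^sub>R ?\<nu> c" for c
  have dne: "w c \<bullet> ?\<nu> c = 0" "w c + ?\<theta> c *\<^sub>R DN c (w c) = b c *\<^sub>R gr c" "norm (w c) \<le> norm (gr c)"
      "0 < b c" "b c \<le> 1" "\<bar>b c - 1\<bar> \<le> norm (w c) ^ 2" if c: "c \<in> ?M" "c \<in> V" for c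
  proof -
    have cU: "c \<in> U" using c(2) unfolding V_def by simp
    have 1: "\<And>v. DN c v \<bullet> ?\<nu> c = 0" using DNt[OF cU] \<nu>N[OF c] by simp
    have 2: "\<And>u v. u \<bullet> ?\<nu> c = 0 \<Longrightarrow> v \<bullet> ?\<nu> c = 0 \<Longrightarrow> DN c u \<bullet> v = DN c v \<bullet> u"
      using DNs[OF cU] \<nu>N[OF c] by simp
    show "w c \<bullet> ?\<nu> c = 0" "w c + ?\<theta> c *\<^sub>R DN c (w c) = b c *\<^sub>R gr c" "norm (w c) \<le> norm (gr c)"
      "0 < b c" "b c \<le> 1" "\<bar>b c - 1\<bar> \<le> norm (w c) ^ 2"
      unfolding w_def b_def n_def gr_def
      by (rule domain_normal_equation[OF conf c(1) \<nu>der[OF c] 1 2 \<theta>der[OF c]]; assumption)+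
  qed
  have wp: "w p = 0" using dne(3)[OF pM V(2)] gp by simp
  have bp: "b p = 1" using dne(6)[OF pM V(2)] wp by simp
  have np: "n p = - \<nu>" using wp bp unfolding w_def \<nu>p by (simp add: add_eq_0_iff)
  obtain K where K: "K > 0" "\<forall>\<^sub>F c in at p within ?M. norm (gr c - gr p) \<le> K * norm (c - p)"
    using has_derivative_bound[OF E] by blast
  have wK: "\<forall>\<^sub>F c in at p within ?M. norm (w c) \<le> K * norm (c - p)"
    using K(2) nV
  proof eventually_elim
    case (elim c)
    then show ?case using dne(3)[of c] gp by simp
  qed
  have id0: "((\<lambda>c. norm (c - p)) \<longlongrightarrow> 0) (at p within ?M)"
    using tendsto_norm[OF LIM_zero[OF tendsto_ident_at]] by simp
  \<comment> \<open>\<open>b - 1\<close> is quadratic in \<open>norm (c - p)\<close>, so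
    \<open>b\<close> has zero derivative at \<open>p\<close>.\<close>
  have bsmall: "\<forall>\<^sub>F c in at p within ?M. \<bar>b c - 1\<bar> \<le> (K * K * norm (c - p)) * norm (c - p)"
    using wK nV
  proof eventually_elim
    case (elim c)
    have "\<bar>b c - 1\<bar> \<le> norm (w c) ^ 2" using dne(6)[of c] elim by simp
    also have "\<dots> \<le> (K * norm (c - p)) ^ 2" using elim by (intro power_mono) auto
    finally show ?case by (simp add: power2_eq_square mult_ac)
  qed
  have Kid0: "((\<lambda>c. K * K * norm (c - p)) \<longlongrightarrow> 0) (at p within ?M)"
    using tendsto_mult_left[OF id0, of "K * K"] by simp
  have bder: "(b has_derivative (\<lambda>h. 0)) (at p within ?M)"
    by (rule has_derivative_zero_small[OF _ Kid0]) (use bsmall bp in simp)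
  have btend: "((\<lambda>c. \<bar>b c - 1\<bar>) \<longlongrightarrow> 0) (at p within ?M)"
  proof -
    have "(b \<longlongrightarrow> 1) (at p within ?M)"
      using has_derivative_continuous[OF bder] bp unfolding continuous_within by simp
    then show ?thesis using tendsto_rabs_zero LIM_zero by blast
  qed
  have \<theta>tend: "(?\<theta> \<longlongrightarrow> d) (at p within ?M)"
    using has_derivative_continuous[OF \<theta>der[OF pM V(2)]] unfolding continuous_within d_def .
  obtain \<kappa> where \<kappa>: "(\<kappa> \<longlongrightarrow> 0) (at p within ?M)"
    "\<forall>\<^sub>F c in at p within ?M. \<forall>v. norm (?\<theta> c *\<^sub>R DN c v - d *\<^sub>R W v) \<le> \<kappa> c * norm v"
  proof (rule linear_family_diff_bound)
    show "\<forall>\<^sub>F c in at p within ?M. linear (\<lambda>v. ?\<theta> c *\<^sub>R DN c v)"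
      using nV
    proof eventually_elim
      case (elim c)
      then have "linear (DN c)" using N has_derivative_linear unfolding V_def by blast
      then show ?case by (rule linear_compose_scale_right)
    qed
    show "linear (\<lambda>v. d *\<^sub>R W v)" by (rule linear_compose_scale_right[OF linW])
    show "((\<lambda>c. ?\<theta> c *\<^sub>R DN c v) \<longlongrightarrow> d *\<^sub>R W v) (at p within ?M)" for v
    proof (rule tendsto_scaleR[OF \<theta>tend])
      have "isCont (\<lambda>x. DN x v) p" using DNc U by (simp add: continuous_on_eq_continuous_at)
      then have "((\<lambda>c. DN c v) \<longlongrightarrow> W v) (at p)" unfolding isCont_def W_def .
      then show "((\<lambda>c. DN c v) \<longlongrightarrow> W v) (at p within ?M)" using tendsto_within_subset by blast
    qed
  qed
  \<comment> \<open>The error of writing the relation at \<open>c\<close> with the operator of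
    \<open>p\<close> and with \<open>b = 1\<close>. Each part is a vanishing factor times
    \<open>gr c\<close> or \<open>w c\<close>, both of first order, so \<open>J (w c)\<close> has
    the same derivative as \<open>gr\<close>.\<close>
  define r where "r c = J (w c) - gr c" for c
  have rp0: "r p = 0" unfolding r_def using wp gp linear_0[OF linJ] by simp
  have rder: "(r has_derivative (\<lambda>h. 0)) (at p within ?M)"
  proof (rule has_derivative_zero_small)
    show "((\<lambda>c. (\<bar>b c - 1\<bar> + \<kappa> c) * K) \<longlongrightarrow> 0) (at p within ?M)"
      using tendsto_mult_right[OF tendsto_add[OF btend \<kappa>(1)], of K] by simp
    show "\<forall>\<^sub>F c in at p within ?M. norm (r c - r p) \<le> ((\<bar>b c - 1\<bar> + \<kappa> c) * K) * norm (c - p)"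
      using nV \<kappa>(2) wK K(2)
    proof eventually_elim
      case (elim c)
      have "r c = (b c - 1) *\<^sub>R gr c - (?\<theta> c *\<^sub>R DN c (w c) - d *\<^sub>R W (w c))"
        using dne(2)[of c] elim(1) unfolding r_def J_def by (simp add: algebra_simps)
      then have "norm (r c) \<le> norm ((b c - 1) *\<^sub>R gr c) + norm (?\<theta> c *\<^sub>R DN c (w c) - d *\<^sub>R W (w c))"
        using norm_triangle_ineq4 by metis
      also have "norm ((b c - 1) *\<^sub>R gr c) \<le> \<bar>b c - 1\<bar> * (K * norm (c - p))"
        using elim(4) gp by (simp add: mult_left_mono)
      also have "norm (?\<theta> c *\<^sub>R DN c (w c) - d *\<^sub>R W (w c)) \<le> \<kappa> c * (K * norm (c - p))"
      \<comment> \<open>Nonnegativity of \<open>\<kappa>\<close> is not part of its specification;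
        the operator bound at the unit vector \<open>\<nu>\<close> supplies it.\<close>
      proof (cases "\<kappa> c \<ge> 0")
        case True
        have "norm (?\<theta> c *\<^sub>R DN c (w c) - d *\<^sub>R W (w c)) \<le> \<kappa> c * norm (w c)" using elim(2) by blast
        also have "\<dots> \<le> \<kappa> c * (K * norm (c - p))" using elim(3) True by (intro mult_left_mono) auto
        finally show ?thesis .
      next
        case False
        have "0 \<le> \<kappa> c * norm \<nu>" using elim(2) norm_ge_zero order_trans by blast
        then show ?thesis using False \<nu>1 by simp
      qed
      finally show ?case using rp0 by (simp add: algebra_simps)
    qed
  qed
  have wder: "(w has_derivative (\<lambda>h. J' (E h))) (at p within ?M)"
  proof -
    have "((\<lambda>c. gr c + r c) has_derivative (\<lambda>h. E h + 0)) (at p within ?M)"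
      by (rule has_derivative_add[OF E rder])
    then have "((\<lambda>c. J (w c)) has_derivative E) (at p within ?M)" unfolding r_def by simp
    moreover have "bounded_linear J'" using J'(1) linear_conv_bounded_linear by blast
    ultimately have "((\<lambda>c. J' (J (w c))) has_derivative (\<lambda>h. J' (E h))) (at p within ?M)"
      using bounded_linear.has_derivative by blast
    then show ?thesis unfolding J'J .
  qed
  define Q where "Q h = J' (E h)" for h
  have JQ: "J (Q h) = E h" for h unfolding Q_def by (rule JJ')
  have Qt: "Q h \<bullet> \<nu> = 0" for h
    using Et[of h] Wt unfolding JQ[symmetric] J_def by (simp add: inner_add_left)
  have linQ: "linear Q" unfolding Q_def using linear_compose[OF linE J'(1)] by (simp add: o_def)
  have nder: "(n has_derivative (\<lambda>h. Q h - W h)) (at p within ?M)"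
  proof -
    have "((\<lambda>c. w c - b c *\<^sub>R ?\<nu> c) has_derivative (\<lambda>h. Q h - (b p *\<^sub>R W h + 0 *\<^sub>R ?\<nu> p))) (at p within ?M)"
      unfolding Q_def W_def by (intro has_derivative_diff wder has_derivative_scaleR bder \<nu>der pM V)
    then show ?thesis unfolding w_def using bp by simp
  qed

  \<comment> \<open>Assembling the derivative of the return map\<close>
  \<comment> \<open>The normal component of \<open>h\<close> is discarded so that \<open>A\<close>
    is tangent valued on the whole space, as the derivative of the hit point requires for every
    \<open>h\<close>.\<close>
  define A where "A h = h - (h \<bullet> \<nu>) *\<^sub>R \<nu> + d *\<^sub>R W h" for h
  have linP: "linear (\<lambda>h. h - (h \<bullet> \<nu>) *\<^sub>R \<nu>)"
    by (rule linearI) (auto simp: inner_add_left algebra_simps)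
  have Phi: "(radial_map C \<Omega> has_derivative A) (at p within ?M)"
  proof (rule has_derivative_frontier_cong[OF inw])
    show "(radial_map C \<Omega> has_derivative (\<lambda>h. h + (?\<theta> p *\<^sub>R DN p h + (G p \<bullet> h) *\<^sub>R ?\<nu> p))) (at p within ?M)"
      unfolding radial_map_def[abs_def]
      by (intro has_derivative_add has_derivative_ident has_derivative_scaleR \<theta>der \<nu>der pM V)
    show "linear A" unfolding A_def
      by (intro linear_compose_add linear_compose_scale_right linW linP)
    fix v assume v: "v \<bullet> - \<nu> = 0"
    then have "G p \<bullet> v = 0" by (subst Gp) (simp add: inner_commute)
    then show "v + (?\<theta> p *\<^sub>R DN p v + (G p \<bullet> v) *\<^sub>R ?\<nu> p) = A v"
      using v unfolding A_def W_def d_def by simp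
  qed
  define L where "L h = h - (h \<bullet> \<nu>) *\<^sub>R \<nu> + d *\<^sub>R Q h" for h
  \<comment> \<open>The curvature terms cancel: \<open>d W\<close> gained by moving out along the
    normals is lost through the turning of the return direction.\<close>
  have LA: "A h + d *\<^sub>R (Q h - W h) = L h" for h unfolding A_def L_def by (simp add: algebra_simps)
  have Lt: "L h \<bullet> \<nu> = 0" for h
    unfolding L_def using \<nu>1 Qt by (simp add: inner_add_left inner_diff_left)
  have Fp: "radial_map C \<Omega> p = p + d *\<^sub>R ?\<nu> p" unfolding radial_map_def d_def ..
  have np': "n p = - ?\<nu> p" using np \<nu>p by simp
  have AB: "(A h + d *\<^sub>R (Q h - W h)) \<bullet> ?\<nu> p = 0" for h unfolding LA \<nu>p by (rule Lt)
  have hl: "halfline_meets C (radial_map C \<Omega> c) (n c)" if "c \<in> ?M" for c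
    unfolding n_def by (rule radial_point(4)[OF conf that])
  have hp: "hit_time C (radial_map C \<Omega> p) (n p) = d"
    "((\<lambda>c. radial_map C \<Omega> c + hit_time C (radial_map C \<Omega> c) (n c) *\<^sub>R n c)
      has_derivative (\<lambda>h. A h + d *\<^sub>R (Q h - W h))) (at p within ?M)"
    by (rule hit_point_has_derivative[OF cd(1) pM Phi nder pM Fp np' less_imp_le[OF d] AB], erule hl)+
  have F: "return_map C \<Omega> = (\<lambda>c. radial_map C \<Omega> c + hit_time C (radial_map C \<Omega> c) (n c) *\<^sub>R n c)"
    unfolding return_map_eq[abs_def] n_def ..
  show thesis
  proof (rule that[of E W L])
    show "linear E" "linear W" by fact+
    show "linear L" unfolding L_def by (intro linear_compose_add linear_compose_scale_right linQ linP)
    have "return_map C \<Omega> p = radial_map C \<Omega> p + d *\<^sub>R n p" unfolding F hp(1) ..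
    then show "return_map C \<Omega> p = p" using Fp np' by simp
    show "(return_map C \<Omega> has_derivative L) (at p within ?M)" using hp(2) unfolding F LA .
    show "L v - v + d *\<^sub>R W (L v - v) = d *\<^sub>R E v" if v: "v \<in> T" for v
    proof -
      have "L v - v = d *\<^sub>R Q v" unfolding L_def using v T by simp
      moreover have "d *\<^sub>R Q v + d *\<^sub>R W (d *\<^sub>R Q v) = d *\<^sub>R J (Q v)"
        unfolding J_def by (simp add: linear_scale[OF linW] scaleR_add_right)
      ultimately show ?thesis unfolding JQ by simp
    qed
  qed (use hess Et Es E[unfolded gr_def] shape Wt Ws Wp Lt T in auto)
qed

section \<open>Self-adjoint linearizations and stability\<close>

text \<open>First-order condition at the minimum \<open>t = 0\<close>. It takes the place of a
  Lagrange multiplier in the eigenvalue argument.\<close>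

lemma nonneg_quadratic_linear_zero:
  fixes a b :: real
  assumes "\<And>t. 2 * t * a + t\<^sup>2 * b \<ge> 0"
  shows "a = 0"
proof (rule ccontr)
  assume a: "a \<noteq> 0"
  \<comment> \<open>Positive and larger than \<open>b\<close>, so at \<open>t = - a / c\<close> the
    linear term outweighs the quadratic one.\<close>
  define c where "c = \<bar>b\<bar> + 1"
  have c: "c > 0" "b < c" unfolding c_def by auto
  have "2 * (- a / c) * a + (- a / c)\<^sup>2 * b = a\<^sup>2 / c * (b / c - 2)"
    using c by (simp add: field_simps power2_eq_square)
  moreover have "b / c - 2 < 0" using c by (simp add: field_simps)
  moreover have "a\<^sup>2 / c > 0" using a c by simp
  ultimately have "2 * (- a / c) * a + (- a / c)\<^sup>2 * b < 0" using mult_pos_neg by metis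
  then show False using assms[of "- a / c"] by simp
qed

text \<open>Here \<open>u \<bullet> J v\<close> is an inner product on \<open>T\<close>, and the bound says that \<open>\<mu>\<close> is the operator norm of
  \<open>L\<close>; it is attained at a maximizer of \<open>J (L x) \<bullet> L x\<close>, which is an eigenvector of \<open>L \<circ> L\<close>.\<close>

lemma selfadjoint_dominant_eigenvalue:
  fixes T :: "'a::euclidean_space set" and L J :: "'a \<Rightarrow> 'a"
  assumes T: "subspace T" "x0 \<in> T" "x0 \<noteq> 0" and L: "linear L" "\<And>v. v \<in> T \<Longrightarrow> L v \<in> T"
    and J: "linear J" "\<And>u v. u \<in> T \<Longrightarrow> v \<in> T \<Longrightarrow> J u \<bullet> v = J v \<bullet> u"
    "\<And>u. u \<in> T \<Longrightarrow> J u \<bullet> u \<ge> u \<bullet> u"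
    and sa: "\<And>u v. u \<in> T \<Longrightarrow> v \<in> T \<Longrightarrow> J (L u) \<bullet> v = J u \<bullet> L v"
  obtains \<mu> \<rho> u where "\<bar>\<rho>\<bar> = \<mu>" "u \<in> T" "u \<noteq> 0" "L u = \<rho> *\<^sub>R u"
    "\<And>x. x \<in> T \<Longrightarrow> J (L x) \<bullet> L x \<le> \<mu>\<^sup>2 * (J x \<bullet> x)"
proof -
  have contL: "continuous_on A L" and contJ: "continuous_on A J" for A
    using L(1) J(1) by (auto intro: linear_continuous_on simp: linear_conv_bounded_linear[symmetric])
  have contJL: "continuous_on A (\<lambda>x. J (L x))" for A
    using linear_compose[OF L(1) J(1)] by (auto intro: linear_continuous_on simp: linear_conv_bounded_linear[symmetric] o_def)
  have q0: "J u \<bullet> u > 0" if "u \<in> T" "u \<noteq> 0" for u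
    using J(3)[OF that(1)] that(2) inner_gt_zero_iff[of u] by linarith
  define S where "S = {x \<in> T. J x \<bullet> x = 1}"
  have "closed S"
  proof -
    have "closed {x. J x \<bullet> x = 1}"
      by (intro closed_Collect_eq continuous_intros contJ)
    moreover have "S = T \<inter> {x. J x \<bullet> x = 1}" unfolding S_def by auto
    ultimately show ?thesis using closed_subspace[OF T(1)] by (simp add: closed_Int)
  qed
  moreover have "bounded S"
  proof (rule boundedI)
    fix x assume "x \<in> S"
    then have "(norm x)\<^sup>2 \<le> 1" using J(3)[of x] unfolding S_def by (simp add: power2_norm_eq_inner)
    then show "norm x \<le> 1" by (simp add: abs_square_le_1)
  qed
  ultimately have "compact S" by (simp add: compact_eq_bounded_closed)
  have scal: "\<exists>y\<in>S. x = sqrt (J x \<bullet> x) *\<^sub>R y" if x: "x \<in> T" "x \<noteq> 0" for x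
  proof
    define s where "s = sqrt (J x \<bullet> x)"
    have s: "s > 0" "s * s = J x \<bullet> x" unfolding s_def using q0[OF x] by auto
    show "x = sqrt (J x \<bullet> x) *\<^sub>R (x /\<^sub>R s)" unfolding s_def[symmetric] using s by simp
    have "J (x /\<^sub>R s) \<bullet> (x /\<^sub>R s) = inverse s * (inverse s * (J x \<bullet> x))"
      unfolding linear_scale[OF J(1)] inner_scaleR_left inner_scaleR_right by simp
    also have "\<dots> = 1" unfolding s(2)[symmetric] using s(1) by (simp add: field_simps)
    finally show "x /\<^sub>R s \<in> S" unfolding S_def using subspace_scale[OF T(1) x(1)] by simp
  qed
  have "S \<noteq> {}" using scal[OF T(2,3)] by blast
  have "continuous_on S (\<lambda>x. J (L x) \<bullet> L x)" by (intro continuous_intros contL contJL)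
  then obtain e where e: "e \<in> S" "\<And>y. y \<in> S \<Longrightarrow> J (L y) \<bullet> L y \<le> J (L e) \<bullet> L e"
    using continuous_attains_sup[OF \<open>compact S\<close> \<open>S \<noteq> {}\<close>] by blast
  have eT: "e \<in> T" "J e \<bullet> e = 1" using e(1) unfolding S_def by auto
  then have e0: "e \<noteq> 0" by auto
  define m where "m = J (L e) \<bullet> L e"
  have m0: "m \<ge> 0" unfolding m_def using J(3)[OF L(2)[OF eT(1)]] inner_ge_zero[of "L e"] by linarith
  have le: "J (L x) \<bullet> L x \<le> m * (J x \<bullet> x)" if x: "x \<in> T" for x
  proof (cases "x = 0")
    case True
    then show ?thesis using linear_0[OF J(1)] linear_0[OF L(1)] by simp
  next
    case False
    then obtain y where y: "y \<in> S" "x = sqrt (J x \<bullet> x) *\<^sub>R y" using scal[OF x] by blast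
    define s where "s = sqrt (J x \<bullet> x)"
    have ss: "s * s = J x \<bullet> x" unfolding s_def using q0[OF x False] by simp
    have "L x = s *\<^sub>R L y" using y(2) linear_scale[OF L(1)] unfolding s_def by metis
    then have "J (L x) \<bullet> L x = (s * s) * (J (L y) \<bullet> L y)" using linear_scale[OF J(1)] by simp
    also have "\<dots> \<le> (s * s) * m" using e(2)[OF y(1)] unfolding m_def by (intro mult_left_mono) auto
    finally show ?thesis unfolding ss by (simp add: mult.commute)
  qed
  \<comment> \<open>The residual of the eigenvector equation for \<open>L \<circ> L\<close>. The gap
    in \<open>le\<close> is nonnegative and vanishes at \<open>e\<close>; its first variation in
    this very direction turns out to be \<open>J z \<bullet> z\<close>.\<close>
  define z where "z = m *\<^sub>R e - L (L e)"
  have zT: "z \<in> T" unfolding z_def by (intro subspace_diff T subspace_scale L eT)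
  have "m * (J e \<bullet> z) - J (L e) \<bullet> L z = 0"
  proof (rule nonneg_quadratic_linear_zero)
    fix t :: real
    have tT: "e + t *\<^sub>R z \<in> T" by (intro subspace_add T subspace_scale zT eT)
    have s1: "J (e + t *\<^sub>R z) \<bullet> (e + t *\<^sub>R z) = 1 + 2 * t * (J e \<bullet> z) + t\<^sup>2 * (J z \<bullet> z)"
      using J(2)[OF zT eT(1)] eT(2)
      by (simp add: linear_add[OF J(1)] linear_scale[OF J(1)] inner_add_left inner_add_right power2_eq_square algebra_simps)
    have s2: "J (L (e + t *\<^sub>R z)) \<bullet> L (e + t *\<^sub>R z) = m + 2 * t * (J (L e) \<bullet> L z) + t\<^sup>2 * (J (L z) \<bullet> L z)"
      using J(2)[OF L(2)[OF zT] L(2)[OF eT(1)]] unfolding m_def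
      by (simp add: linear_add[OF J(1)] linear_scale[OF J(1)] linear_add[OF L(1)] linear_scale[OF L(1)]
          inner_add_left inner_add_right power2_eq_square algebra_simps)
    show "0 \<le> 2 * t * (m * (J e \<bullet> z) - J (L e) \<bullet> L z) + t\<^sup>2 * (m * (J z \<bullet> z) - J (L z) \<bullet> L z)"
      using le[OF tT] unfolding s1 s2 by (simp add: algebra_simps)
  qed
  then have "m * (J e \<bullet> z) = J (L e) \<bullet> L z" by simp
  also have "\<dots> = J (L (L e)) \<bullet> z" using sa[OF L(2)[OF eT(1)] zT] by simp
  finally have "J z \<bullet> z = 0"
    unfolding z_def by (simp add: linear_diff[OF J(1)] linear_scale[OF J(1)] inner_diff_left)
  then have "z = 0" using q0[OF zT] by force
  then have LL: "L (L e) = m *\<^sub>R e" unfolding z_def by simp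
  define \<mu> where "\<mu> = sqrt m"
  have \<mu>: "\<mu> \<ge> 0" "\<mu> * \<mu> = m" "\<mu>\<^sup>2 = m" unfolding \<mu>_def using m0 by auto
  show thesis
  \<comment> \<open>\<open>L (L e) = m e\<close> factors as
    \<open>(L - \<mu>) (L + \<mu>) e = 0\<close>: either \<open>e\<close> belongs to
    \<open>- \<mu>\<close>, or \<open>L e + \<mu> e\<close> is a nonzero eigenvector for
    \<open>\<mu>\<close>.\<close>
  proof (cases "L e + \<mu> *\<^sub>R e = 0")
    case True
    then have "L e = (- \<mu>) *\<^sub>R e" by (simp add: add_eq_0_iff)
    then show thesis using that[of "- \<mu>" \<mu> e] eT e0 le \<mu> by simp
  next
    case False
    have "L (L e + \<mu> *\<^sub>R e) = \<mu> *\<^sub>R (L e + \<mu> *\<^sub>R e)"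
      using \<mu>(2) by (simp add: linear_add[OF L(1)] linear_scale[OF L(1)] LL algebra_simps)
    moreover have "L e + \<mu> *\<^sub>R e \<in> T" by (intro subspace_add T subspace_scale L eT)
    ultimately show thesis using that[of \<mu> \<mu> "L e + \<mu> *\<^sub>R e"] False le \<mu> by simp
  qed
qed

lemma funpow_has_derivative:
  fixes F :: "'a::real_normed_vector \<Rightarrow> 'a"
  assumes F: "F ` M \<subseteq> M" "F p = p" "p \<in> M" "(F has_derivative L) (at p within M)"
  shows "((F ^^ k) has_derivative (L ^^ k)) (at p within M)"
proof (induction k)
  case 0
  show ?case by (simp add: id_def)
next
  case (Suc k)
  have im: "(F ^^ k) ` M \<subseteq> M"
  proof (induction k)
    case (Suc k)
    then show ?case using F(1) by (auto simp: image_subset_iff)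
  qed simp
  have "(F ^^ k) p = p" by (induction k) (use F(2) in auto)
  then have "(F has_derivative L) (at ((F ^^ k) p) within (F ^^ k) ` M)"
    using has_derivative_subset[OF F(4) im] by simp
  from diff_chain_within[OF Suc.IH this] show ?case by (simp add: comp_def)
qed

text \<open>The spectrum lies in the disc of radius \<open>\<mu>\<close> and meets its boundary, and
  \<open>L ^^ k\<close> is bounded on \<open>T\<close> by \<open>c * \<mu> ^ k\<close> with
  \<open>c\<close> independent of \<open>k\<close>. The absence of a factor growing with
  \<open>k\<close> is what rules out expansion when \<open>\<mu> = 1\<close>.\<close>

lemma fixpoint_type_selfadjoint:
  fixes F L J :: "'a::euclidean_space \<Rightarrow> 'a"
  assumes n: "is_inward_unit_normal S p n" and T: "T = {v. v \<bullet> n = 0}" "x0 \<in> T" "x0 \<noteq> 0"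
    and F: "F ` frontier S \<subseteq> frontier S" "F p = p" "p \<in> frontier S"
      "(F has_derivative L) (at p within frontier S)"
    and L: "linear L" "\<And>v. v \<in> T \<Longrightarrow> L v \<in> T"
    and J: "linear J" "\<And>u v. u \<in> T \<Longrightarrow> v \<in> T \<Longrightarrow> J u \<bullet> v = J v \<bullet> u"
    "\<And>u. u \<in> T \<Longrightarrow> J u \<bullet> u \<ge> u \<bullet> u"
    and sa: "\<And>u v. u \<in> T \<Longrightarrow> v \<in> T \<Longrightarrow> J (L u) \<bullet> v = J u \<bullet> L v"
  shows "fixpoint_type (frontier S) F p =
    (let \<Lambda> = spectrum_on T L in
      if \<forall>z\<in>\<Lambda>. cmod z < 1 then Contraction else if \<exists>z\<in>\<Lambda>. cmod z > 1 then Expansion else Marginal)"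
proof -
  have sT: "subspace T" unfolding T by (rule subspace_hyperplane2)
  obtain \<mu> \<rho> u where ev: "\<bar>\<rho>\<bar> = \<mu>" "u \<in> T" "u \<noteq> 0" "L u = \<rho> *\<^sub>R u"
    and le: "\<And>x. x \<in> T \<Longrightarrow> J (L x) \<bullet> L x \<le> \<mu>\<^sup>2 * (J x \<bullet> x)"
    by (rule selfadjoint_dominant_eigenvalue[OF sT T(2,3) L J sa], assumption+, rule that, assumption+)
  have \<mu>0: "\<mu> \<ge> 0" using ev(1) by auto
  let ?\<Lambda> = "spectrum_on T L"
  have q0: "J v \<bullet> v > 0" if "v \<in> T" "v \<noteq> 0" for v
    using J(3)[OF that(1)] that(2) inner_gt_zero_iff[of v] by linarith
  have \<Lambda>1: "Complex \<rho> 0 \<in> ?\<Lambda>" unfolding spectrum_on_def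
    using ev subspace_0[OF sT] linear_0[OF L(1)] by force
  have \<Lambda>2: "cmod z \<le> \<mu>" if z: "z \<in> ?\<Lambda>" for z
  proof -
    obtain a b x y where z: "z = Complex a b" and xy: "x \<in> T" "y \<in> T" "x \<noteq> 0 \<or> y \<noteq> 0"
      "L x = a *\<^sub>R x - b *\<^sub>R y" "L y = b *\<^sub>R x + a *\<^sub>R y"
      using z unfolding spectrum_on_def by blast
    \<comment> \<open>Self-adjointness tested on the real and imaginary parts of a complex
      eigenvector leaves \<open>b\<close> times a positive number equal to zero.\<close>
    have "J (L x) \<bullet> y = J x \<bullet> L y" by (rule sa[OF xy(1,2)])
    then have "b * (J x \<bullet> x + J y \<bullet> y) = 0"
      unfolding xy by (simp add: linear_diff[OF J(1)] linear_scale[OF J(1)] inner_diff_left inner_add_right algebra_simps)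
    moreover have "J x \<bullet> x + J y \<bullet> y > 0"
    proof -
      have "J x \<bullet> x \<ge> 0" "J y \<bullet> y \<ge> 0"
        using J(3)[OF xy(1)] J(3)[OF xy(2)] inner_ge_zero[of x] inner_ge_zero[of y] by linarith+
      then show ?thesis using xy(3) q0[OF xy(1)] q0[OF xy(2)] by linarith
    qed
    ultimately have b: "b = 0" by simp
    have "\<exists>v\<in>T. v \<noteq> 0 \<and> L v = a *\<^sub>R v" using xy b by auto
    then obtain v where v: "v \<in> T" "v \<noteq> 0" "L v = a *\<^sub>R v" by blast
    have "a\<^sup>2 * (J v \<bullet> v) \<le> \<mu>\<^sup>2 * (J v \<bullet> v)"
      using le[OF v(1)] unfolding v(3) by (simp add: linear_scale[OF J(1)] power2_eq_square mult_ac)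
    then have "a\<^sup>2 \<le> \<mu>\<^sup>2" using q0[OF v(1,2)] by simp
    then have "\<bar>a\<bar> \<le> \<mu>" using \<mu>0 abs_le_square_iff[of a \<mu>] by simp
    then show ?thesis unfolding z b by (simp add: cmod_def)
  qed
  have \<rho>\<mu>: "cmod (Complex \<rho> 0) = \<mu>" using ev(1) by (simp add: cmod_def)
  have c1: "(\<forall>z\<in>?\<Lambda>. cmod z < 1) \<longleftrightarrow> \<mu> < 1" using \<Lambda>1 \<Lambda>2 \<rho>\<mu> le_less_trans by metis
  have c2: "(\<exists>z\<in>?\<Lambda>. cmod z > 1) \<longleftrightarrow> \<mu> > 1" using \<Lambda>1 \<Lambda>2 \<rho>\<mu> less_le_trans by metis
  have nn: "n \<bullet> n = 1" "norm n = 1" using n unfolding is_inward_unit_normal_def by (auto simp: norm_eq_1)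
  have LkT: "(L ^^ k) x \<in> T" if "x \<in> T" for k x by (induction k) (use that L(2) in auto)
  have Lkl: "linear (L ^^ k)" for k
  proof (induction k)
    case 0 show ?case by (simp add: linear_ident)
  next
    case (Suc k) then show ?case using linear_compose[OF Suc L(1)] by (simp add: o_def)
  qed
  have Lku: "(L ^^ k) u = \<rho> ^ k *\<^sub>R u" for k
    by (induction k) (use ev(4) in \<open>auto simp: linear_scale[OF L(1)] mult.commute\<close>)
  have Lkq: "J ((L ^^ k) x) \<bullet> (L ^^ k) x \<le> (\<mu> ^ k)\<^sup>2 * (J x \<bullet> x)" if x: "x \<in> T" for k x
  proof (induction k)
    case (Suc k)
    have "J ((L ^^ Suc k) x) \<bullet> (L ^^ Suc k) x \<le> \<mu>\<^sup>2 * (J ((L ^^ k) x) \<bullet> (L ^^ k) x)"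
      using le[OF LkT[OF x]] by simp
    also have "\<dots> \<le> \<mu>\<^sup>2 * ((\<mu> ^ k)\<^sup>2 * (J x \<bullet> x))" using Suc by (intro mult_left_mono) auto
    finally show ?case by (simp add: power_mult_distrib mult.assoc)
  qed simp
  obtain B where B: "B > 0" "\<And>x. norm (J x) \<le> norm x * B"
    using bounded_linear.pos_bounded[of J] J(1) linear_conv_bounded_linear by blast
  \<comment> \<open>Euclidean length and the length defined by \<open>J\<close> are comparable: the
    square of \<open>norm x\<close> is at most \<open>J x \<bullet> x\<close>, which is at most
    \<open>B\<close> times that square. The square root of \<open>B\<close> is paid once, not at
    every iterate.\<close>
  define c where "c = sqrt B"
  have c: "c > 0" "c\<^sup>2 = B" unfolding c_def using B by auto
  have Lkn: "norm ((L ^^ k) x) \<le> c * \<mu> ^ k * norm x" if x: "x \<in> T" for k x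
  proof (rule power2_le_imp_le)
    have "(norm ((L ^^ k) x))\<^sup>2 \<le> J ((L ^^ k) x) \<bullet> (L ^^ k) x"
      using J(3)[OF LkT[OF x]] by (simp add: power2_norm_eq_inner)
    also have "\<dots> \<le> (\<mu> ^ k)\<^sup>2 * (J x \<bullet> x)" by (rule Lkq[OF x])
    also have "\<dots> \<le> (\<mu> ^ k)\<^sup>2 * (B * (norm x)\<^sup>2)"
    proof (rule mult_left_mono)
      have "J x \<bullet> x \<le> norm (J x) * norm x" by (rule norm_cauchy_schwarz)
      also have "\<dots> \<le> (norm x * B) * norm x" using B by (intro mult_right_mono) auto
      finally show "J x \<bullet> x \<le> B * (norm x)\<^sup>2" by (simp add: power2_eq_square mult_ac)
    qed simp
    also have "\<dots> = (c * \<mu> ^ k * norm x)\<^sup>2" using c by (simp add: power_mult_distrib)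
    finally show "(norm ((L ^^ k) x))\<^sup>2 \<le> (c * \<mu> ^ k * norm x)\<^sup>2" .
    show "0 \<le> c * \<mu> ^ k * norm x" using c \<mu>0 by simp
  qed
  have Fp: "(F ^^ k) p = p" for k by (induction k) (use F(2) in auto)
  have Fder: "((F ^^ k) has_derivative (L ^^ k)) (at p within frontier S)" for k
    by (rule funpow_has_derivative[OF F])
  \<comment> \<open>The power bound holds on \<open>T\<close> only, so the derivative of each
    iterate is precomposed with the tangential projection, which changes nothing on tangent
    vectors.\<close>
  define P where "P h = h - (h \<bullet> n) *\<^sub>R n" for h
  have PT: "P h \<in> T" for h unfolding P_def T using nn by (simp add: inner_diff_left)
  have Pn: "norm (P h) \<le> norm h" for h
  proof (rule power2_le_imp_le)
    have "(norm (P h))\<^sup>2 = (norm h)\<^sup>2 - (h \<bullet> n)\<^sup>2"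
      unfolding P_def power2_norm_eq_inner using nn
      by (simp add: inner_diff_left inner_diff_right inner_commute power2_eq_square)
    then show "(norm (P h))\<^sup>2 \<le> (norm h)\<^sup>2" by simp
  qed simp
  have linP: "linear P" unfolding P_def by (rule linearI) (auto simp: inner_add_left algebra_simps)
  have upper: "\<forall>\<^sub>F x in at p within frontier S. dist ((F ^^ k) x) p \<le> (c * \<mu> ^ k + e) * dist x p"
    if e: "e > 0" for e k
  proof -
    have "((F ^^ k) has_derivative (\<lambda>h. (L ^^ k) (P h))) (at p within frontier S)"
    proof (rule has_derivative_frontier_cong[OF n Fder])
      show "linear (\<lambda>h. (L ^^ k) (P h))" using linear_compose[OF linP Lkl] by (simp add: o_def)
    qed (simp add: P_def)
    then have "\<forall>\<^sub>F x in at p within frontier S.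
        norm ((F ^^ k) x - (F ^^ k) p - (L ^^ k) (P (x - p))) \<le> e * norm (x - p)"
      using e unfolding has_derivative_within_alt2 by blast
    then show ?thesis
    proof eventually_elim
      case (elim x)
      have "norm ((L ^^ k) (P (x - p))) \<le> c * \<mu> ^ k * norm (P (x - p))" by (rule Lkn[OF PT])
      also have "\<dots> \<le> c * \<mu> ^ k * norm (x - p)" using Pn c \<mu>0 by (intro mult_left_mono) auto
      finally show ?case
        using elim norm_triangle_sub[of "(F ^^ k) x - p" "(L ^^ k) (P (x - p))"]
        unfolding Fp dist_norm by (simp add: distrib_right)
    qed
  qed
  \<comment> \<open>The dominant eigenvector shows that no iterate can have a better local Lipschitz
    bound at \<open>p\<close> than \<open>\<mu> ^ k\<close>.\<close>
  have lower: "\<mu> ^ k \<le> K"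
    if "\<forall>\<^sub>F x in at p within frontier S. dist ((F ^^ k) x) p \<le> K * dist x p" for k K
  proof -
    have "norm ((L ^^ k) u) \<le> K * norm u"
      using derivative_tangent_le[OF n _ Fder, of u k K] that ev(2) unfolding Fp dist_norm T by blast
    then have "\<mu> ^ k * norm u \<le> K * norm u" unfolding Lku using ev(1) by (simp add: power_abs)
    then show ?thesis using ev(3) by simp
  qed
  let ?con = "\<exists>k. \<exists>K<1. \<forall>\<^sub>F x in at p within frontier S. dist ((F ^^ k) x) p \<le> K * dist x p"
  let ?exp = "\<forall>K. \<exists>k. \<exists>\<^sub>F x in at p within frontier S. K * dist x p \<le> dist ((F ^^ k) x) p"
  have con: "?con \<longleftrightarrow> \<mu> < 1"
  proof
    assume ?con
    then obtain k K where K: "K < 1" "\<mu> ^ k \<le> K" using lower by blast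
    then show "\<mu> < 1" using one_le_power[of \<mu> k] by linarith
  next
    assume \<mu>: "\<mu> < 1"
    obtain k where k: "\<mu> ^ k < 1 / (2 * c)"
      using real_arch_pow_inv[of "1 / (2 * c)" \<mu>] \<mu> c(1) by auto
    have "c * \<mu> ^ k < 1 / 2" using k c(1) by (simp add: field_simps)
    then have "c * \<mu> ^ k + 1 / 4 < 1" by simp
    moreover have "\<forall>\<^sub>F x in at p within frontier S. dist ((F ^^ k) x) p \<le> (c * \<mu> ^ k + 1/4) * dist x p"
      by (rule upper) simp
    ultimately show ?con by blast
  qed
  have exp: "?exp \<longleftrightarrow> \<mu> > 1"
  proof
    assume \<mu>: "\<mu> > 1"
    show ?exp
    proof
      fix K
      obtain k where k: "K < \<mu> ^ k" using real_arch_pow[OF \<mu>] by blast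
      have "\<exists>\<^sub>F x in at p within frontier S. K * dist x p \<le> dist ((F ^^ k) x) p"
      proof (rule ccontr)
        assume "\<not> (\<exists>\<^sub>F x in at p within frontier S. K * dist x p \<le> dist ((F ^^ k) x) p)"
        then have "\<forall>\<^sub>F x in at p within frontier S. dist ((F ^^ k) x) p \<le> K * dist x p"
          unfolding frequently_def not_not by (auto elim!: eventually_mono)
        then show False using lower k by fastforce
      qed
      then show "\<exists>k. \<exists>\<^sub>F x in at p within frontier S. K * dist x p \<le> dist ((F ^^ k) x) p" by blast
    qed
  next
    assume ?exp
    \<comment> \<open>For \<open>\<mu> <= 1\<close> every iterate magnifies by at most
      \<open>c + 1\<close> near \<open>p\<close>, on a neighbourhood depending on \<open>k\<close>.
      The factor \<open>c + 2\<close> is thus out of reach of all iterates.\<close>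
    then obtain k where k: "\<exists>\<^sub>F x in at p within frontier S. (c + 2) * dist x p \<le> dist ((F ^^ k) x) p" by blast
    show "\<mu> > 1"
    proof (rule ccontr)
      assume "\<not> \<mu> > 1"
      then have "\<mu> ^ k \<le> 1" using \<mu>0 by (simp add: power_le_one)
      then have ck: "c * \<mu> ^ k \<le> c" using c(1) by simp
      have "\<forall>\<^sub>F x in at p within frontier S. dist ((F ^^ k) x) p \<le> (c * \<mu> ^ k + 1) * dist x p"
        by (rule upper) simp
      moreover have "\<forall>\<^sub>F x in at p within frontier S. x \<noteq> p" by (auto simp: eventually_at_filter)
      ultimately have "\<forall>\<^sub>F x in at p within frontier S. \<not> (c + 2) * dist x p \<le> dist ((F ^^ k) x) p"
      proof eventually_elim
        case (elim x)
        have "(c * \<mu> ^ k + 1) * dist x p < (c + 2) * dist x p"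
          using ck elim(2) by (intro mult_strict_right_mono) auto
        then show ?case using elim(1) by linarith
      qed
      then show False using k unfolding frequently_def by blast
    qed
  qed
  show ?thesis unfolding fixpoint_type_def con exp Let_def c1 c2 ..
qed

section \<open>Homotheties\<close>

text \<open>\<open>b\<close> is the image of the origin and not the centre; the centre
  \<open>p\<close> corresponds to \<open>b = (1 - k) p\<close>.\<close>

definition homothety :: "'a::euclidean_space \<Rightarrow> real \<Rightarrow> 'a \<Rightarrow> 'a" where
  "homothety b k x = b + k *\<^sub>R x"

context
  fixes b :: "'a::euclidean_space" and k :: real
  assumes k: "k > 0"
begin

lemma homothety_inverse:
  "homothety b k ((y - b) /\<^sub>R k) = y" "(homothety b k x - b) /\<^sub>R k = x"
  unfolding homothety_def using k by auto

lemma homothety_image_iff: "y \<in> homothety b k ` S \<longleftrightarrow> (y - b) /\<^sub>R k \<in> S"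
  using homothety_inverse by (metis image_iff)

lemma homothety_mem_iff: "homothety b k x \<in> homothety b k ` S \<longleftrightarrow> x \<in> S"
  unfolding homothety_image_iff homothety_inverse ..

lemma inj_homothety: "inj (homothety b k)"
  unfolding inj_def using homothety_inverse(2) by metis

lemma homothety_image_eq: "homothety b k ` S = (+) b ` (*\<^sub>R) k ` S"
  unfolding homothety_def image_image ..

lemma homothety_diff: "homothety b k x - homothety b k y = k *\<^sub>R (x - y)"
  unfolding homothety_def by (simp add: algebra_simps)

lemma homothety_ray: "homothety b k x + (k * t) *\<^sub>R n = homothety b k (x + t *\<^sub>R n)"
  unfolding homothety_def by (simp add: algebra_simps)

lemma homothety_ray_mem: "homothety b k x + t *\<^sub>R n \<in> homothety b k ` S \<longleftrightarrow> x + (t / k) *\<^sub>R n \<in> S"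
  using homothety_ray[of x "t / k" n] k homothety_mem_iff[of "x + (t / k) *\<^sub>R n" S] by simp

lemma interior_homothety: "interior (homothety b k ` S) = homothety b k ` interior S"
  unfolding homothety_image_eq interior_translation
  using interior_injective_linear_image[of "(*\<^sub>R) k" S] k
  by (simp add: inj_def linear_scaleR)

lemma closure_homothety: "closure (homothety b k ` S) = homothety b k ` closure S"
  unfolding homothety_image_eq closure_translation
  using closure_injective_linear_image[of "(*\<^sub>R) k" S] k
  by (simp add: inj_def linear_scaleR)

lemma frontier_homothety: "frontier (homothety b k ` S) = homothety b k ` frontier S"
  unfolding frontier_def interior_homothety closure_homothety
  using image_set_diff[OF inj_homothety] by metis

lemma open_homothety: "open S \<Longrightarrow> open (homothety b k ` S)"
  unfolding homothety_def using open_affinity[of S k b] k by simp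

lemma continuous_homothety: "continuous_on S (homothety b k)"
  unfolding homothety_def by (intro continuous_intros)

text \<open>Both cone conditions are homogeneous in \<open>y - x\<close>, so only the radius of
  validity is rescaled.\<close>

lemma is_inward_unit_normal_homothety:
  assumes n: "is_inward_unit_normal S x n"
  shows "is_inward_unit_normal (homothety b k ` S) (homothety b k x) n"
  unfolding is_inward_unit_normal_def
proof (intro conjI allI impI)
  show "norm n = 1" using n unfolding is_inward_unit_normal_def by simp
  fix e :: real assume e: "e > 0"
  obtain d where d: "d > 0"
    "\<And>y. y \<noteq> x \<Longrightarrow> norm (y - x) < d \<Longrightarrow> (y - x) \<bullet> n > e * norm (y - x) \<Longrightarrow> y \<in> S"
    "\<And>y. y \<noteq> x \<Longrightarrow> norm (y - x) < d \<Longrightarrow> (y - x) \<bullet> n < - e * norm (y - x) \<Longrightarrow> y \<notin> S"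
    using is_inward_unit_normalE[OF n e] by metis
  show "\<forall>\<^sub>F y in at (homothety b k x).
      ((y - homothety b k x) \<bullet> n > e * norm (y - homothety b k x) \<longrightarrow> y \<in> homothety b k ` S) \<and>
      ((y - homothety b k x) \<bullet> n < - e * norm (y - homothety b k x) \<longrightarrow> y \<notin> homothety b k ` S)"
    unfolding eventually_at
  proof (intro exI[of _ "k * d"] conjI[of "_ < _"] ballI impI)
    show "0 < k * d" using k d by simp
    fix y assume y: "y \<noteq> homothety b k x \<and> dist y (homothety b k x) < k * d"
    define z where "z = (y - b) /\<^sub>R k"
    have yz: "y = homothety b k z" unfolding z_def homothety_inverse ..
    have diff: "y - homothety b k x = k *\<^sub>R (z - x)" unfolding yz homothety_diff ..
    have "z \<noteq> x" using y yz by auto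
    moreover have "norm (z - x) < d" using y k unfolding dist_norm diff by simp
    ultimately have
      "((z - x) \<bullet> n > e * norm (z - x) \<longrightarrow> z \<in> S) \<and> ((z - x) \<bullet> n < - e * norm (z - x) \<longrightarrow> z \<notin> S)"
      using d by blast
    moreover have "(k *\<^sub>R (z - x)) \<bullet> n > e * norm (k *\<^sub>R (z - x)) \<longleftrightarrow> (z - x) \<bullet> n > e * norm (z - x)"
      using mult_less_cancel_left_pos[OF k, of "e * norm (z - x)" "(z - x) \<bullet> n"] k
      by (simp add: mult.left_commute)
    moreover have "(k *\<^sub>R (z - x)) \<bullet> n < - e * norm (k *\<^sub>R (z - x)) \<longleftrightarrow> (z - x) \<bullet> n < - e * norm (z - x)"
      using mult_less_cancel_left_pos[OF k, of "(z - x) \<bullet> n" "- e * norm (z - x)"] k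
      by (simp add: mult.left_commute)
    moreover have "y \<in> homothety b k ` S \<longleftrightarrow> z \<in> S" unfolding yz homothety_mem_iff ..
    ultimately show "((y - homothety b k x) \<bullet> n > e * norm (y - homothety b k x) \<longrightarrow> y \<in> homothety b k ` S) \<and>
      ((y - homothety b k x) \<bullet> n < - e * norm (y - homothety b k x) \<longrightarrow> y \<notin> homothety b k ` S)"
      unfolding diff by blast
  qed
qed

section \<open>Differentiability under a homothety\<close>

lemma has_derivative_homothety:
  assumes f: "(f has_derivative A) (at x within S)"
  shows "((\<lambda>y. f ((y - b) /\<^sub>R k)) has_derivative (\<lambda>h. A (h /\<^sub>R k))) (at (homothety b k x) within homothety b k ` S)"
proof (rule has_derivative_in_compose[of "\<lambda>y. (y - b) /\<^sub>R k" "\<lambda>h. h /\<^sub>R k" _ _ f A])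
  show "((\<lambda>y. (y - b) /\<^sub>R k) has_derivative (\<lambda>h. h /\<^sub>R k)) (at (homothety b k x) within homothety b k ` S)"
    by (auto intro!: derivative_eq_intros)
  show "(f has_derivative A) (at ((homothety b k x - b) /\<^sub>R k) within (\<lambda>y. (y - b) /\<^sub>R k) ` homothety b k ` S)"
    unfolding image_image homothety_inverse using f by simp
qed

lemma has_derivative_homothety_at:
  assumes f: "(f has_derivative A) (at ((y - b) /\<^sub>R k))"
  shows "((\<lambda>y. f ((y - b) /\<^sub>R k)) has_derivative (\<lambda>h. A (h /\<^sub>R k))) (at y)"
proof -
  have "surj (homothety b k)" unfolding surj_def using homothety_inverse(1) by metis
  then show ?thesis using has_derivative_homothety[OF f] homothety_inverse(1) by simp
qed

text \<open>The factor \<open>m\<close> is free because two values occur: 1 for functions defining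
  the hypersurface, and the ratio itself for the thickness.\<close>

lemma C2_on_homothety:
  assumes "C2_on U f"
  shows "C2_on (homothety b k ` U) (\<lambda>y. m * f ((y - b) /\<^sub>R k))"
proof -
  obtain G H where G: "\<And>x. x \<in> U \<Longrightarrow> (f has_derivative (\<lambda>v. G x \<bullet> v)) (at x)"
    "\<And>x. x \<in> U \<Longrightarrow> (G has_derivative H x) (at x)" "\<And>v. continuous_on U (\<lambda>x. H x v)"
    using assms unfolding C2_on_def by blast
  define G' where "G' y = (m / k) *\<^sub>R G ((y - b) /\<^sub>R k)" for y
  define H' where "H' y v = (m / k) *\<^sub>R H ((y - b) /\<^sub>R k) (v /\<^sub>R k)" for y v
  show ?thesis unfolding C2_on_def
  proof (intro exI[of _ G'] exI[of _ H'] conjI ballI allI)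
    fix y assume "y \<in> homothety b k ` U"
    then have y: "(y - b) /\<^sub>R k \<in> U" unfolding homothety_image_iff .
    show "((\<lambda>y. m * f ((y - b) /\<^sub>R k)) has_derivative (\<bullet>) (G' y)) (at y)"
      using has_derivative_mult_right[OF has_derivative_homothety_at[OF G(1)[OF y]], of m]
      by (rule has_derivative_eq_rhs) (auto simp: G'_def divide_inverse)
    show "(G' has_derivative H' y) (at y)"
      unfolding G'_def H'_def by (rule has_derivative_scaleR_right[OF has_derivative_homothety_at[OF G(2)[OF y]]])
  next
    fix v
    have "continuous_on (homothety b k ` U) (\<lambda>y. H ((y - b) /\<^sub>R k) (v /\<^sub>R k))"
      by (rule continuous_on_compose2[OF G(3)]) (auto intro!: continuous_intros simp: homothety_inverse)
    then show "continuous_on (homothety b k ` U) (\<lambda>y. H' y v)"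
      unfolding H'_def by (intro continuous_intros)
  qed
qed

lemma C2_hypersurface_homothety:
  assumes M: "C2_hypersurface M"
  shows "C2_hypersurface (homothety b k ` M)"
  unfolding C2_hypersurface_def
proof
  fix q assume "q \<in> homothety b k ` M"
  then obtain p where p: "p \<in> M" "q = homothety b k p" by blast
  obtain U g where U: "open U" "p \<in> U" "C2_on U g" "\<not> (g has_derivative (\<lambda>v. 0)) (at p)"
    "M \<inter> U = {x \<in> U. g x = 0}"
    using M p(1) unfolding C2_hypersurface_def by blast
  have "\<not> ((\<lambda>y. g ((y - b) /\<^sub>R k)) has_derivative (\<lambda>v. 0)) (at q)"
  proof
    assume g: "((\<lambda>y. g ((y - b) /\<^sub>R k)) has_derivative (\<lambda>v. 0)) (at q)"
    have "(homothety b k has_derivative (\<lambda>h. k *\<^sub>R h)) (at p)"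
      unfolding homothety_def[abs_def] by (auto intro!: derivative_eq_intros)
    from has_derivative_compose[OF this, of _ "\<lambda>v. 0"] g p(2)
    have "((\<lambda>x. g ((homothety b k x - b) /\<^sub>R k)) has_derivative (\<lambda>h. 0)) (at p)" by blast
    then show False using U(4) unfolding homothety_inverse by simp
  qed
  moreover have "homothety b k ` M \<inter> homothety b k ` U = {y \<in> homothety b k ` U. 1 * g ((y - b) /\<^sub>R k) = 0}"
  proof -
    have "homothety b k ` M \<inter> homothety b k ` U = homothety b k ` (M \<inter> U)"
      using image_Int[OF inj_homothety] by metis
    also have "\<dots> = homothety b k ` {x \<in> U. g x = 0}" unfolding U(5) ..
    also have "\<dots> = {y \<in> homothety b k ` U. 1 * g ((y - b) /\<^sub>R k) = 0}"
      by (auto simp: homothety_image_iff homothety_inverse)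
    finally show ?thesis .
  qed
  ultimately show "\<exists>U g. open U \<and> q \<in> U \<and> C2_on U g \<and> \<not> (g has_derivative (\<lambda>v. 0)) (at q) \<and>
      homothety b k ` M \<inter> U = {x \<in> U. g x = 0}"
    using open_homothety[OF U(1)] U(2) p(2) C2_on_homothety[OF U(3), of 1]
    by (intro exI[of _ "homothety b k ` U"] exI[of _ "\<lambda>y. 1 * g ((y - b) /\<^sub>R k)"]) auto
qed

lemma C2_on_hypersurface_homothety:
  assumes f: "C2_on_hypersurface M f" and f': "\<And>x. x \<in> M \<Longrightarrow> f' (homothety b k x) = m * f x"
  shows "C2_on_hypersurface (homothety b k ` M) f'"
  unfolding C2_on_hypersurface_def
proof
  fix q assume "q \<in> homothety b k ` M"
  then obtain p where p: "p \<in> M" "q = homothety b k p" by blast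
  obtain U g where U: "open U" "p \<in> U" "C2_on U g" "\<forall>x\<in>M \<inter> U. f x = g x"
    using f p(1) unfolding C2_on_hypersurface_def by blast
  have "f' y = m * g ((y - b) /\<^sub>R k)" if "y \<in> homothety b k ` M \<inter> homothety b k ` U" for y
    using that f'[of "(y - b) /\<^sub>R k"] U(4) unfolding homothety_image_iff Int_iff homothety_inverse by simp
  then show "\<exists>U g. open U \<and> q \<in> U \<and> C2_on U g \<and> (\<forall>x\<in>homothety b k ` M \<inter> U. f' x = g x)"
    using open_homothety[OF U(1)] U(2) p(2) C2_on_homothety[OF U(3), of m] by blast
qed

section \<open>The core, its normals and the thickness under a homothety\<close>

lemma convex_core_homothety:
  assumes C: "convex_core C"
  shows "convex_core (homothety b k ` C)"
  unfolding convex_core_def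
proof (intro conjI)
  show "compact (homothety b k ` C)"
    using C continuous_homothety compact_continuous_image unfolding convex_core_def by blast
  show "convex (homothety b k ` C)"
    using C convex_affinity[of C b k] unfolding convex_core_def homothety_def by simp
  show "interior (homothety b k ` C) \<noteq> {}" using C unfolding interior_homothety convex_core_def by simp
  show "C2_hypersurface (frontier (homothety b k ` C))"
    using C C2_hypersurface_homothety unfolding frontier_homothety convex_core_def by simp
qed

lemma outward_normal_homothety:
  assumes C: "convex_core C" "c \<in> frontier C"
  shows "outward_normal (homothety b k ` C) (homothety b k c) = outward_normal C c"
  by (rule outward_normal_eq[OF is_inward_unit_normal_homothety[OF inward_normal_outward_normal[OF C]]])

lemma tangent_space_homothety:
  assumes C: "convex_core C" "c \<in> frontier C"
  shows "tangent_space (homothety b k ` C) (homothety b k c) = tangent_space C c"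
  unfolding tangent_space_def outward_normal_homothety[OF C] ..

lemma thickness_set_homothety:
  assumes C: "convex_core C" "c \<in> frontier C"
  shows "thickness_set (homothety b k ` C) (homothety b k ` \<Omega>) (homothety b k c) = (*) k ` thickness_set C \<Omega> c"
proof (intro set_eqI iffI)
  fix r assume "r \<in> thickness_set (homothety b k ` C) (homothety b k ` \<Omega>) (homothety b k c)"
  then have "r / k \<in> thickness_set C \<Omega> c"
    using k unfolding thickness_set_def outward_normal_homothety[OF C] homothety_ray_mem by simp
  then show "r \<in> (*) k ` thickness_set C \<Omega> c" using k by (intro image_eqI[of _ _ "r / k"]) auto
next
  fix r assume "r \<in> (*) k ` thickness_set C \<Omega> c"
  then show "r \<in> thickness_set (homothety b k ` C) (homothety b k ` \<Omega>) (homothety b k c)"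
    using k unfolding thickness_set_def outward_normal_homothety[OF C] homothety_ray_mem by auto
qed

lemma thickness_homothety:
  assumes C: "convex_core C" "c \<in> frontier C" and bd: "bdd_above (thickness_set C \<Omega> c)"
  shows "thickness (homothety b k ` C) (homothety b k ` \<Omega>) (homothety b k c) = k * thickness C \<Omega> c"
proof -
  \<comment> \<open>Scaling is monotone and continuous, so it passes through the supremum of a
    nonempty bounded set.\<close>
  have "k * Sup (insert 0 (thickness_set C \<Omega> c)) = (SUP s\<in>insert 0 (thickness_set C \<Omega> c). k * s)"
    using k bd by (intro continuous_at_Sup_mono continuous_intros) (auto simp: mono_def)
  then show ?thesis unfolding thickness_def thickness_set_homothety[OF C] by simp
qed

lemma radial_map_homothety:
  assumes C: "convex_core C" "c \<in> frontier C" and bd: "bdd_above (thickness_set C \<Omega> c)"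
  shows "radial_map (homothety b k ` C) (homothety b k ` \<Omega>) (homothety b k c) = homothety b k (radial_map C \<Omega> c)"
  unfolding radial_map_def thickness_homothety[OF assms] outward_normal_homothety[OF C] homothety_ray ..

lemma halfline_meets_homothety:
  "halfline_meets (homothety b k ` C) (homothety b k x) n \<longleftrightarrow> halfline_meets C x n"
proof
  assume "halfline_meets (homothety b k ` C) (homothety b k x) n"
  then obtain t where "t \<ge> 0" "x + (t / k) *\<^sub>R n \<in> C" unfolding halfline_meets_def homothety_ray_mem by blast
  then show "halfline_meets C x n" using k unfolding halfline_meets_def by (metis divide_nonneg_pos)
next
  assume "halfline_meets C x n"
  then obtain t where t: "t \<ge> 0" "x + t *\<^sub>R n \<in> C" unfolding halfline_meets_def by blast
  then show "halfline_meets (homothety b k ` C) (homothety b k x) n"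
    using k unfolding halfline_meets_def homothety_ray_mem by (intro exI[of _ "k * t"]) simp
qed

lemma hit_time_homothety:
  assumes C: "closed C" and h: "halfline_meets C x n"
  shows "hit_time (homothety b k ` C) (homothety b k x) n = k * hit_time C x n"
proof -
  note ht = hit_time[OF C h]
  show ?thesis unfolding hit_time_def[of "homothety b k ` C"] homothety_ray_mem
  proof (rule Least_equality)
    show "0 \<le> k * hit_time C x n \<and> x + (k * hit_time C x n / k) *\<^sub>R n \<in> C" using ht k by simp
    fix t assume t: "0 \<le> t \<and> x + (t / k) *\<^sub>R n \<in> C"
    then have "hit_time C x n \<le> t / k" using ht(3)[of "t / k"] k by (meson divide_nonneg_pos not_le)
    then show "k * hit_time C x n \<le> t" using k by (simp add: field_simps)
  qed
qed

section \<open>The conditions on the domain under a homothety\<close>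

lemma lipschitz_boundary_at_homothety:
  assumes "lipschitz_boundary_at \<Omega> x"
  shows "lipschitz_boundary_at (homothety b k ` \<Omega>) (homothety b k x)"
proof -
  obtain e and \<phi> :: "'a \<Rightarrow> real" and L r where e: "norm e = 1" "r > 0"
    and lip: "L-lipschitz_on {z. z \<bullet> e = 0} \<phi>"
    and eq: "\<And>y. y \<in> ball x r \<Longrightarrow> y \<in> \<Omega> \<longleftrightarrow> \<phi> (y - (y \<bullet> e) *\<^sub>R e) < y \<bullet> e"
    using assms unfolding lipschitz_boundary_at_def by blast
  have ee: "e \<bullet> e = 1" using e by (simp add: norm_eq_1)
  define b' where "b' = b - (b \<bullet> e) *\<^sub>R e"
  have b': "b' \<bullet> e = 0" unfolding b'_def using ee by (simp add: inner_diff_left)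
  \<comment> \<open>The same axis \<open>e\<close> serves: the hyperplane part \<open>b'\<close> of
    the translation shifts the argument and \<open>b \<bullet> e\<close> shifts the height. The
    factors \<open>k\<close> and \<open>1 / k\<close> cancel, so the Lipschitz constant is
    unchanged.\<close>
  define \<phi>' where "\<phi>' z = b \<bullet> e + k * \<phi> ((z - b') /\<^sub>R k)" for z
  have "L-lipschitz_on {z. z \<bullet> e = 0} \<phi>'"
  proof (rule lipschitz_onI)
    show "0 \<le> L" using lip lipschitz_on_nonneg by blast
    fix z w assume "z \<in> {z. z \<bullet> e = 0}" "w \<in> {z. z \<bullet> e = 0}"
    then have "dist (\<phi> ((z - b') /\<^sub>R k)) (\<phi> ((w - b') /\<^sub>R k)) \<le> L * dist ((z - b') /\<^sub>R k) ((w - b') /\<^sub>R k)"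
      using b' by (intro lipschitz_onD[OF lip]) (auto simp: inner_diff_left)
    also have "dist ((z - b') /\<^sub>R k) ((w - b') /\<^sub>R k) = dist z w / k"
      unfolding dist_norm using k by (simp flip: scaleR_right_diff_distrib add: divide_inverse_commute)
    finally have "k * dist (\<phi> ((z - b') /\<^sub>R k)) (\<phi> ((w - b') /\<^sub>R k)) \<le> L * dist z w"
      using k by (simp add: field_simps)
    then show "dist (\<phi>' z) (\<phi>' w) \<le> L * dist z w"
      unfolding \<phi>'_def dist_real_def using k by (simp flip: right_diff_distrib add: abs_mult)
  qed
  moreover have "y \<in> homothety b k ` \<Omega> \<longleftrightarrow> \<phi>' (y - (y \<bullet> e) *\<^sub>R e) < y \<bullet> e"
    if y: "y \<in> ball (homothety b k x) (k * r)" for y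
  proof -
    define z where "z = (y - b) /\<^sub>R k"
    have yz: "y = homothety b k z" unfolding z_def homothety_inverse ..
    have "dist (homothety b k x) y = k * dist x z" unfolding yz dist_norm homothety_diff using k by simp
    then have "z \<in> ball x r" using y k by simp
    then have "y \<in> homothety b k ` \<Omega> \<longleftrightarrow> \<phi> (z - (z \<bullet> e) *\<^sub>R e) < z \<bullet> e"
      using eq unfolding yz homothety_mem_iff by blast
    also have "z - (z \<bullet> e) *\<^sub>R e = (y - (y \<bullet> e) *\<^sub>R e - b') /\<^sub>R k"
      unfolding yz b'_def homothety_def using k by (simp add: inner_add_left algebra_simps)
    also have "\<phi> ((y - (y \<bullet> e) *\<^sub>R e - b') /\<^sub>R k) < z \<bullet> e \<longleftrightarrow> \<phi>' (y - (y \<bullet> e) *\<^sub>R e) < y \<bullet> e"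
    proof -
      have "y \<bullet> e = b \<bullet> e + k * (z \<bullet> e)" unfolding yz homothety_def by (simp add: inner_add_left)
      then show ?thesis unfolding \<phi>'_def using k by simp
    qed
    finally show ?thesis .
  qed
  moreover have "k * r > 0" using k e by simp
  ultimately show ?thesis unfolding lipschitz_boundary_at_def using e(1) by blast
qed

text \<open>Diameters scale by \<open>k\<close>, so a cover for \<open>\<delta> / k\<close> and
  \<open>\<epsilon> / k ^ s\<close> is carried to one for \<open>\<delta>\<close> and
  \<open>\<epsilon>\<close>.\<close>

lemma hausdorff_null_homothety:
  assumes A: "hausdorff_null s A"
  shows "hausdorff_null s (homothety b k ` A)"
  unfolding hausdorff_null_def
proof (intro allI impI)
  fix \<delta> \<epsilon> :: real assume \<delta>: "\<delta> > 0" and \<epsilon>: "\<epsilon> > 0"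
  have "\<delta> / k > 0" "\<epsilon> / k ^ s > 0" using \<delta> \<epsilon> k by auto
  then obtain U :: "nat \<Rightarrow> 'a set" where U: "A \<subseteq> (\<Union>i. U i)" "\<And>i. bounded (U i)" "\<And>i. diameter (U i) \<le> \<delta> / k"
    "summable (\<lambda>i. diameter (U i) ^ s)" "(\<Sum>i. diameter (U i) ^ s) < \<epsilon> / k ^ s"
    using A unfolding hausdorff_null_def by meson
  define V where "V i = homothety b k ` U i" for i
  have bV: "bounded (V i)" for i
    unfolding V_def homothety_image_eq by (intro bounded_translation bounded_scaling U)
  have dV: "diameter (V i) \<le> k * diameter (U i)" for i
  proof (rule diameter_le)
    show "V i \<noteq> {} \<or> 0 \<le> k * diameter (U i)" using k diameter_ge_0[OF U(2)] by simp
    fix x y assume "x \<in> V i" "y \<in> V i"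
    then obtain u v where uv: "u \<in> U i" "v \<in> U i" "x = homothety b k u" "y = homothety b k v"
      unfolding V_def by blast
    have "norm (x - y) = k * dist u v" unfolding uv homothety_diff dist_norm using k by simp
    also have "\<dots> \<le> k * diameter (U i)"
      using k diameter_bounded_bound[OF U(2) uv(1,2)] by (intro mult_left_mono) auto
    finally show "norm (x - y) \<le> k * diameter (U i)" .
  qed
  have dVs: "diameter (V i) ^ s \<le> k ^ s * diameter (U i) ^ s" for i
    using power_mono[OF dV diameter_ge_0[OF bV], of i s] by (simp add: power_mult_distrib)
  have sm: "summable (\<lambda>i. k ^ s * diameter (U i) ^ s)" by (intro summable_mult U)
  have sV: "summable (\<lambda>i. diameter (V i) ^ s)"
    by (rule summable_comparison_test'[OF sm]) (use dVs diameter_ge_0[OF bV] in auto)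
  have "(\<Sum>i. diameter (V i) ^ s) \<le> (\<Sum>i. k ^ s * diameter (U i) ^ s)" by (intro suminf_le dVs sV sm)
  also have "\<dots> = k ^ s * (\<Sum>i. diameter (U i) ^ s)" by (rule suminf_mult[OF U(4)])
  also have "\<dots> < \<epsilon>" using U(5) k by (simp add: field_simps)
  finally have lt: "(\<Sum>i. diameter (V i) ^ s) < \<epsilon>" .
  have "diameter (V i) \<le> \<delta>" for i using dV[of i] U(3)[of i] k by (simp add: field_simps)
  moreover have "homothety b k ` A \<subseteq> (\<Union>i. V i)" unfolding V_def using U(1) by blast
  ultimately show "\<exists>U::nat \<Rightarrow> 'a set. homothety b k ` A \<subseteq> (\<Union>i. U i) \<and> (\<forall>i. bounded (U i) \<and> diameter (U i) \<le> \<delta>) \<and>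
      summable (\<lambda>i. diameter (U i) ^ s) \<and> (\<Sum>i. diameter (U i) ^ s) < \<epsilon>"
    using bV sV lt by blast
qed

end

lemma is_inward_unit_normal_homothety_iff:
  assumes k: "k > 0"
  shows "is_inward_unit_normal (homothety b k ` S) (homothety b k x) n \<longleftrightarrow> is_inward_unit_normal S x n"
proof
  assume n: "is_inward_unit_normal (homothety b k ` S) (homothety b k x) n"
  \<comment> \<open>The inverse is again a homothety, with ratio \<open>1 / k\<close>, so one
    implication yields the other.\<close>
  have inv: "homothety (- b /\<^sub>R k) (inverse k) (homothety b k y) = y" for y
    unfolding homothety_def using k by (simp add: algebra_simps)
  have "inverse k > 0" using k by simp
  from is_inward_unit_normal_homothety[OF this n, of "- b /\<^sub>R k"] show "is_inward_unit_normal S x n"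
    unfolding image_image inv by simp
qed (rule is_inward_unit_normal_homothety[OF k])

lemma inward_unit_normal_homothety:
  assumes k: "k > 0"
  shows "inward_unit_normal (homothety b k ` S) (homothety b k x) = inward_unit_normal S x"
  unfolding inward_unit_normal_def is_inward_unit_normal_homothety_iff[OF k] ..

lemma domain_class_homothety:
  assumes k: "k > 0" and C: "convex_core C" and \<Omega>: "\<Omega> \<in> domain_class C"
  shows "homothety b k ` \<Omega> \<in> domain_class (homothety b k ` C)"
proof -
  let ?h = "homothety b k"
  have \<Omega>': "open \<Omega>" "interior C \<subseteq> \<Omega>" "\<And>x. x \<in> frontier \<Omega> - C \<Longrightarrow> lipschitz_boundary_at \<Omega> x"
    "\<And>c. c \<in> frontier C \<Longrightarrow> connected ({c + t *\<^sub>R outward_normal C c |t. 0 \<le> t} \<inter> \<Omega>)"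
    "hausdorff_null (DIM('a) - 1) {x \<in> frontier \<Omega>. \<exists>n. is_inward_unit_normal \<Omega> x n \<and> \<not> halfline_meets C x n}"
    using \<Omega> unfolding domain_class_def by blast+
  have "lipschitz_boundary_at (?h ` \<Omega>) y" if y: "y \<in> frontier (?h ` \<Omega>) - ?h ` C" for y
  proof -
    obtain x where "y = ?h x" "x \<in> frontier \<Omega>" "x \<notin> C"
      using y unfolding frontier_homothety[OF k] by blast
    then show ?thesis using lipschitz_boundary_at_homothety[OF k \<Omega>'(3)] by blast
  qed
  moreover have "connected ({c + t *\<^sub>R outward_normal (?h ` C) c |t. 0 \<le> t} \<inter> ?h ` \<Omega>)"
    if c: "c \<in> frontier (?h ` C)" for c
  proof -
    obtain a where a: "c = ?h a" "a \<in> frontier C" using c unfolding frontier_homothety[OF k] by blast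
    let ?R = "{a + t *\<^sub>R outward_normal C a |t. 0 \<le> t}"
    have "{c + t *\<^sub>R outward_normal (?h ` C) c |t. 0 \<le> t} = ?h ` ?R"
    proof (intro set_eqI iffI)
      fix y assume "y \<in> {c + t *\<^sub>R outward_normal (?h ` C) c |t. 0 \<le> t}"
      then obtain t where t: "t \<ge> 0" "y = ?h a + t *\<^sub>R outward_normal C a"
        unfolding a(1) outward_normal_homothety[OF k C a(2)] by blast
      then have "y = ?h (a + (t / k) *\<^sub>R outward_normal C a)"
        using homothety_ray[OF k, of b a "t / k" "outward_normal C a"] k by simp
      moreover have "t / k \<ge> 0" using t k by simp
      ultimately show "y \<in> ?h ` ?R" by blast
    next
      fix y assume "y \<in> ?h ` ?R"
      then obtain t where t: "t \<ge> 0" "y = ?h (a + t *\<^sub>R outward_normal C a)" by blast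
      then have "y = c + (k * t) *\<^sub>R outward_normal (?h ` C) c"
        unfolding a(1) outward_normal_homothety[OF k C a(2)] homothety_ray[OF k] by simp
      moreover have "k * t \<ge> 0" using t k by simp
      ultimately show "y \<in> {c + t *\<^sub>R outward_normal (?h ` C) c |t. 0 \<le> t}" by blast
    qed
    then have "{c + t *\<^sub>R outward_normal (?h ` C) c |t. 0 \<le> t} \<inter> ?h ` \<Omega> = ?h ` (?R \<inter> \<Omega>)"
      by (simp only: image_Int[OF inj_homothety[OF k]])
    then show ?thesis
      using connected_continuous_image[OF continuous_homothety[OF k] \<Omega>'(4)[OF a(2)]] by (simp only:)
  qed
  moreover have "{y \<in> frontier (?h ` \<Omega>). \<exists>n. is_inward_unit_normal (?h ` \<Omega>) y n \<and> \<not> halfline_meets (?h ` C) y n}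
      = ?h ` {x \<in> frontier \<Omega>. \<exists>n. is_inward_unit_normal \<Omega> x n \<and> \<not> halfline_meets C x n}"
    (is "?N' = ?h ` ?N")
  proof -
    have "y \<in> ?N' \<longleftrightarrow> y \<in> ?h ` ?N" for y
    proof -
      obtain x where x: "y = ?h x" using homothety_inverse(1)[OF k] by metis
      show ?thesis
        unfolding x frontier_homothety[OF k] homothety_mem_iff[OF k] mem_Collect_eq
          is_inward_unit_normal_homothety_iff[OF k] halfline_meets_homothety[OF k] ..
    qed
    then show ?thesis by blast
  qed
  moreover have "interior (?h ` C) \<subseteq> ?h ` \<Omega>" unfolding interior_homothety[OF k] using \<Omega>'(2) by (rule image_mono)
  ultimately show ?thesis
    using open_homothety[OF k \<Omega>'(1)] hausdorff_null_homothety[OF k \<Omega>'(5)]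
    unfolding domain_class_def mem_Collect_eq by (simp only:) blast
qed

text \<open>The factor \<open>k\<close> on the values cancels the \<open>1 / k\<close> from the
  chain rule: a function that scales like a length keeps its gradient.\<close>

lemma surface_grad_homothety:
  assumes k: "k > 0" and C: "convex_core C" "c \<in> frontier C"
    and f: "C2_on_hypersurface (frontier C) f"
    and f': "\<And>x. x \<in> frontier C \<Longrightarrow> f' (homothety b k x) = k * f x"
  shows "surface_grad (homothety b k ` C) f' (homothety b k c) = surface_grad C f c"
proof -
  obtain U g where U: "open U" "c \<in> U" "C2_on U g" "\<forall>x\<in>frontier C \<inter> U. f x = g x"
    using f C(2) unfolding C2_on_hypersurface_def by blast
  obtain \<gamma> where g: "(g has_derivative (\<lambda>v. \<gamma> \<bullet> v)) (at c)" using U(2,3) unfolding C2_on_def by blast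
  have fd: "(f has_derivative (\<lambda>v. \<gamma> \<bullet> v)) (at c within frontier C)"
  proof (rule has_derivative_transform_eventually)
    show "(g has_derivative (\<lambda>v. \<gamma> \<bullet> v)) (at c within frontier C)" using g has_derivative_at_withinI by blast
    have "eventually (\<lambda>x. x \<in> U) (nhds c)" using U eventually_nhds by blast
    then show "\<forall>\<^sub>F x in at c within frontier C. g x = f x"
      unfolding eventually_at_filter by eventually_elim (simp add: U(4))
  qed (use U C in auto)
  have inw: "is_inward_unit_normal C c (- outward_normal C c)" by (rule inward_normal_outward_normal[OF C])
  have "((\<lambda>y. k * f ((y - b) /\<^sub>R k)) has_derivative (\<lambda>h. k * (\<gamma> \<bullet> (h /\<^sub>R k))))
      (at (homothety b k c) within homothety b k ` frontier C)"
    by (rule has_derivative_mult_right[OF has_derivative_homothety[OF k fd]])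
  then have "((\<lambda>y. k * f ((y - b) /\<^sub>R k)) has_derivative (\<lambda>h. \<gamma> \<bullet> h))
      (at (homothety b k c) within frontier (homothety b k ` C))"
    unfolding frontier_homothety[OF k] by (rule has_derivative_eq_rhs) (use k in auto)
  then have "(f' has_derivative (\<lambda>h. \<gamma> \<bullet> h)) (at (homothety b k c) within frontier (homothety b k ` C))"
    by (rule has_derivative_transform[rotated 2])
      (use C f' in \<open>auto simp: frontier_homothety[OF k] homothety_inverse[OF k]\<close>)
  from surface_grad_eq[OF is_inward_unit_normal_homothety[OF k inw] this] surface_grad_eq[OF inw fd]
  show ?thesis by simp
qed

lemma return_map_homothety:
  assumes k: "k > 0" and conf: "return_configuration C \<Omega> p" and c: "c \<in> frontier C"
  shows "return_map (homothety b k ` C) (homothety b k ` \<Omega>) (homothety b k c) = homothety b k (return_map C \<Omega> c)"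
proof -
  note cd = return_configurationD[OF conf]
  note rp = radial_point[OF conf c]
  show ?thesis
    unfolding return_map_eq radial_map_homothety[OF k cd(1) c cd(3)[OF c]] inward_unit_normal_homothety[OF k]
      hit_time_homothety[OF k convex_core_simps(2)[OF cd(1)] rp(4)] homothety_ray[OF k] ..
qed

text \<open>The gradient field is only transported, so differentiating it once more leaves one
  uncancelled factor \<open>1 / k\<close>.\<close>

lemma thickness_hess_homothety:
  assumes k: "k > 0" and conf: "return_configuration C \<Omega> p" and v: "v \<in> tangent_space C p"
  shows "thickness_hess (homothety b k ` C) (homothety b k ` \<Omega>) (homothety b k p) v = thickness_hess C \<Omega> p v /\<^sub>R k"
proof -
  note cd = return_configurationD[OF conf]
  let ?C = "homothety b k ` C" and ?\<Omega> = "homothety b k ` \<Omega>" and ?p = "homothety b k p"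
  have inw: "is_inward_unit_normal C p (- outward_normal C p)" by (rule inward_normal_outward_normal[OF cd(1,6)])
  have vn: "v \<bullet> (- outward_normal C p) = 0" using v unfolding tangent_space_def by simp
  obtain H where H: "linear H" "(surface_grad C (thickness C \<Omega>) has_derivative H) (at p within frontier C)"
    by (rule return_map_linearization[OF conf], rule that, assumption+)
  have "((\<lambda>y. surface_grad C (thickness C \<Omega>) ((y - b) /\<^sub>R k)) has_derivative (\<lambda>h. H (h /\<^sub>R k)))
      (at ?p within frontier ?C)"
    unfolding frontier_homothety[OF k] by (rule has_derivative_homothety[OF k H(2)])
  then have "(surface_grad ?C (thickness ?C ?\<Omega>) has_derivative (\<lambda>h. H (h /\<^sub>R k))) (at ?p within frontier ?C)"
  proof (rule has_derivative_transform[rotated 2])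
    show "?p \<in> frontier ?C" using cd(6) unfolding frontier_homothety[OF k] by blast
    show "surface_grad ?C (thickness ?C ?\<Omega>) y = surface_grad C (thickness C \<Omega>) ((y - b) /\<^sub>R k)"
      if "y \<in> frontier ?C" for y
    proof -
      obtain c where c: "y = homothety b k c" "c \<in> frontier C" using \<open>y \<in> _\<close> unfolding frontier_homothety[OF k] by blast
      show ?thesis unfolding c(1) homothety_inverse[OF k]
        by (rule surface_grad_homothety[OF k cd(1) c(2) cd(4)]) (rule thickness_homothety[OF k cd(1) _ cd(3)])
    qed
  qed
  then have "frechet_derivative (surface_grad ?C (thickness ?C ?\<Omega>)) (at ?p within frontier ?C) v = H v /\<^sub>R k"
    using frechet_derivative_tangent[OF is_inward_unit_normal_homothety[OF k inw] vn] linear_scale[OF H(1)] by metis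
  moreover have "frechet_derivative (surface_grad C (thickness C \<Omega>)) (at p within frontier C) v = H v"
    by (rule frechet_derivative_tangent[OF inw vn H(2)])
  ultimately show ?thesis
    unfolding thickness_hess_def surface_hess_def tangent_proj_def outward_normal_homothety[OF k cd(1,6)]
    by (simp add: scaleR_diff_right)
qed

lemma return_configuration_homothety:
  assumes k: "k > 0" and conf: "return_configuration C \<Omega> p"
  shows "return_configuration (homothety b k ` C) (homothety b k ` \<Omega>) (homothety b k p)"
proof -
  note cd = return_configurationD[OF conf]
  let ?C = "homothety b k ` C" and ?\<Omega> = "homothety b k ` \<Omega>" and ?p = "homothety b k p"
  let ?T = "tangent_space C p"
  have th: "thickness ?C ?\<Omega> (homothety b k c) = k * thickness C \<Omega> c" if "c \<in> frontier C" for c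
    by (rule thickness_homothety[OF k cd(1) that cd(3)[OF that]])
  have 1: "convex_core ?C" by (rule convex_core_homothety[OF k cd(1)])
  have 2: "?\<Omega> \<in> domain_class ?C" by (rule domain_class_homothety[OF k cd(1,2)])
  have 3: "\<forall>y\<in>frontier ?C. bdd_above (thickness_set ?C ?\<Omega> y)"
  proof
    fix y assume "y \<in> frontier ?C"
    then obtain c where c: "y = homothety b k c" "c \<in> frontier C" unfolding frontier_homothety[OF k] by blast
    have "mono ((*) k)" using k by (simp add: mono_def)
    then show "bdd_above (thickness_set ?C ?\<Omega> y)"
      unfolding c(1) thickness_set_homothety[OF k cd(1) c(2)] by (rule bdd_above_image_mono[OF _ cd(3)[OF c(2)]])
  qed
  have 4: "C2_on_hypersurface (frontier ?C) (thickness ?C ?\<Omega>)"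
    unfolding frontier_homothety[OF k] by (rule C2_on_hypersurface_homothety[OF k cd(4) th])
  have 5: "radial_map ?C ?\<Omega> ` frontier ?C \<subseteq> reciprocal_domain ?C ?\<Omega>"
  proof
    fix y assume "y \<in> radial_map ?C ?\<Omega> ` frontier ?C"
    then obtain c where c: "y = radial_map ?C ?\<Omega> (homothety b k c)" "c \<in> frontier C"
      unfolding frontier_homothety[OF k] by blast
    have y: "y = homothety b k (radial_map C \<Omega> c)"
      unfolding c(1) by (rule radial_map_homothety[OF k cd(1) c(2) cd(3)[OF c(2)]])
    have "radial_map C \<Omega> c \<in> reciprocal_domain C \<Omega>" using cd(5) c(2) by blast
    then show "y \<in> reciprocal_domain ?C ?\<Omega>"
      unfolding y reciprocal_domain_def frontier_homothety[OF k] mem_Collect_eq Diff_iff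
        homothety_mem_iff[OF k] is_inward_unit_normal_homothety_iff[OF k] halfline_meets_homothety[OF k] .
  qed
  have "surface_grad ?C (thickness ?C ?\<Omega>) ?p = 0"
    using surface_grad_homothety[OF k cd(1,6,4) th] cd(7) by simp
  moreover have "bij_betw (surface_hess ?C (thickness ?C ?\<Omega>) ?p) (tangent_space ?C ?p) (tangent_space ?C ?p)"
  proof -
    have "bij_betw ((\<lambda>v. v /\<^sub>R k) \<circ> thickness_hess C \<Omega> p) ?T ?T"
    proof (rule bij_betw_trans[OF cd(8)])
      have "\<forall>v\<in>?T. v /\<^sub>R k \<in> ?T \<and> k *\<^sub>R v \<in> ?T" unfolding tangent_space_def by simp
      then show "bij_betw (\<lambda>v. v /\<^sub>R k) ?T ?T"
        using k by (intro bij_betwI[of _ _ _ "\<lambda>v. k *\<^sub>R v"]) auto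
    qed
    then have "bij_betw (thickness_hess ?C ?\<Omega> ?p) ?T ?T"
      by (rule bij_betw_cong[THEN iffD1, rotated]) (simp add: thickness_hess_homothety[OF k conf])
    then show ?thesis
      unfolding tangent_space_homothety[OF k cd(1,6)] thickness_hess_def[abs_def] .
  qed
  ultimately have 6: "nondegenerate_critical ?C (thickness ?C ?\<Omega>) ?p"
    unfolding nondegenerate_critical_def frontier_homothety[OF k] using cd(6) by blast
  show ?thesis unfolding return_configuration_def using 1 2 3 4 5 6 by blast
qed

section \<open>What the linearization determines\<close>

text \<open>Coercivity gives injectivity, and equality of dimensions then gives surjectivity onto
  \<open>T\<close>.\<close>

lemma bij_betw_subspace_coercive:
  fixes T :: "'a::euclidean_space set"
  assumes T: "subspace T" and J: "linear J" "\<And>v. v \<in> T \<Longrightarrow> J v \<in> T" "\<And>v. v \<in> T \<Longrightarrow> J v \<bullet> v \<ge> v \<bullet> v"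
  shows "bij_betw J T T"
proof -
  have inj: "inj_on J T"
  proof (rule inj_onI)
    fix x y assume xy: "x \<in> T" "y \<in> T" "J x = J y"
    have "x - y \<in> T" by (rule subspace_diff[OF T xy(1,2)])
    moreover have "J (x - y) = 0" using xy(3) by (simp add: linear_diff[OF J(1)])
    ultimately have "(x - y) \<bullet> (x - y) \<le> 0" using J(3)[of "x - y"] by simp
    then show "x = y" by (metis inner_gt_zero_iff linorder_not_less right_minus_eq)
  qed
  have "span T = T" by (rule span_eq_iff[THEN iffD2, OF T])
  then have "inj_on J (span T)" using inj by (simp only:)
  then have "dim (J ` T) = dim T" by (rule dim_image_eq[OF J(1)])
  moreover have "J ` T \<subseteq> T" using J(2) by blast
  moreover have "subspace (J ` T)" by (rule linear_subspace_image[OF J(1) T])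
  ultimately have "J ` T = T" using subspace_dim_equal[OF _ T] by simp
  then show ?thesis using inj unfolding bij_betw_def by simp
qed

text \<open>One vector spans at most a line. A nonzero tangent vector ensures a nonempty spectrum
  and room for two Hessians to differ.\<close>

lemma tangent_space_nontrivial:
  fixes C :: "'a::euclidean_space set"
  assumes "2 \<le> DIM('a)"
  obtains v where "v \<in> tangent_space C c" "v \<noteq> 0"
proof -
  have "\<exists>v. v \<noteq> 0 \<and> orthogonal (outward_normal C c) v"
  proof -
    have "span {outward_normal C c} \<noteq> (UNIV :: 'a set)"
    proof
      assume "span {outward_normal C c} = (UNIV :: 'a set)"
      then have "DIM('a) = dim {outward_normal C c}" using dim_span[of "{outward_normal C c}"] by simp
      also have "\<dots> \<le> 1" using dim_le_card'[of "{outward_normal C c}"] by simp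
      finally show False using assms by simp
    qed
    then have "span {outward_normal C c} \<subset> span (UNIV :: 'a set)" by auto
    from orthogonal_to_subspace_exists_gen[OF this] show ?thesis
      by (metis orthogonal_commute span_base singletonI)
  qed
  then show thesis using that unfolding tangent_space_def orthogonal_def by (auto simp: inner_commute)
qed

text \<open>On \<open>T\<close> the linearization satisfies \<open>J L = J + d H\<close> with
  \<open>J\<close> and \<open>H\<close> symmetric; this is the self-adjointness of \<open>L\<close>
  for the inner product of \<open>J\<close>. The mask is \<open>- d\<close> times the inverse of
  \<open>J\<close>, because \<open>shape_operator\<close> is \<open>- W\<close> there.\<close>

lemma return_configuration_operators:
  fixes C \<Omega> :: "'a::euclidean_space set"
  assumes conf: "return_configuration C \<Omega> p"
  defines "T \<equiv> tangent_space C p"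
  obtains L J where "linear L" "linear J"
    "\<And>v. v \<in> T \<Longrightarrow> L v \<in> T"
    "\<And>u v. u \<in> T \<Longrightarrow> v \<in> T \<Longrightarrow> J u \<bullet> v = J v \<bullet> u" "\<And>v. v \<in> T \<Longrightarrow> J v \<bullet> v \<ge> v \<bullet> v"
    "\<And>u v. u \<in> T \<Longrightarrow> v \<in> T \<Longrightarrow> J (L u) \<bullet> v = J u \<bullet> L v"
    "return_map C \<Omega> p = p" "(return_map C \<Omega> has_derivative L) (at p within frontier C)"
    "\<And>v. v \<in> T \<Longrightarrow> return_deriv C \<Omega> p v = L v"
    "\<And>v. v \<in> T \<Longrightarrow> geometric_mask C \<Omega> p (thickness_hess C \<Omega> p v) = v - L v"
    "bij_betw (geometric_mask C \<Omega> p) T T"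
proof -
  note cd = return_configurationD[OF conf]
  define d where "d = thickness C \<Omega> p"
  have d: "d > 0" unfolding d_def by (rule radial_point(6)[OF conf cd(6)])
  obtain H W L where F: "return_map C \<Omega> p = p" "(return_map C \<Omega> has_derivative L) (at p within frontier C)"
    and H: "\<And>v. v \<in> T \<Longrightarrow> thickness_hess C \<Omega> p v = H v" "\<And>v. v \<in> T \<Longrightarrow> H v \<in> T"
      "\<And>u v. u \<in> T \<Longrightarrow> v \<in> T \<Longrightarrow> H u \<bullet> v = H v \<bullet> u"
    and W: "\<And>v. v \<in> T \<Longrightarrow> shape_operator C p v = - W v" "\<And>v. v \<in> T \<Longrightarrow> W v \<in> T"
      "\<And>u v. u \<in> T \<Longrightarrow> v \<in> T \<Longrightarrow> W u \<bullet> v = W v \<bullet> u" "\<And>v. v \<in> T \<Longrightarrow> W v \<bullet> v \<ge> 0"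
    and L: "\<And>v. L v \<in> T" "\<And>v. v \<in> T \<Longrightarrow> (L v - v) + d *\<^sub>R W (L v - v) = d *\<^sub>R H v"
    and lin: "linear H" "linear W" "linear L"
    by (rule return_map_linearization[OF conf, folded T_def d_def], rule that, assumption+)
  have inw: "is_inward_unit_normal C p (- outward_normal C p)" by (rule inward_normal_outward_normal[OF cd(1,6)])
  have T: "subspace T" unfolding T_def tangent_space_def by (rule subspace_hyperplane2)
  define J where "J v = v + d *\<^sub>R W v" for v
  have linJ: "linear J" unfolding J_def
    by (intro linear_compose_add linear_compose_scale_right lin linear_ident)
  have JT: "J v \<in> T" if "v \<in> T" for v
    unfolding J_def by (intro subspace_add subspace_scale T W that)
  have Js: "J u \<bullet> v = J v \<bullet> u" if "u \<in> T" "v \<in> T" for u v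
    unfolding J_def using W(3)[OF that] by (simp add: inner_add_left inner_commute[of v u])
  have Jp: "J v \<bullet> v \<ge> v \<bullet> v" if "v \<in> T" for v
    unfolding J_def using W(4)[OF that] d by (simp add: inner_add_left)
  have JL: "J (L v) = J v + d *\<^sub>R H v" if "v \<in> T" for v
    using L(2)[OF that] linear_diff[OF linJ, of "L v" v] unfolding J_def by (simp add: algebra_simps)
  have sa: "J (L u) \<bullet> v = J u \<bullet> L v" if uv: "u \<in> T" "v \<in> T" for u v
  proof -
    have "J (L u) \<bullet> v = J u \<bullet> v + d * (H u \<bullet> v)" unfolding JL[OF uv(1)] by (simp add: inner_add_left)
    also have "\<dots> = J v \<bullet> u + d * (H v \<bullet> u)" using Js[OF uv] H(3)[OF uv] by simp
    also have "\<dots> = J (L v) \<bullet> u" unfolding JL[OF uv(2)] by (simp add: inner_add_left)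
    also have "\<dots> = J u \<bullet> L v" by (rule Js[OF L(1) uv(1)])
    finally show ?thesis .
  qed
  let ?N = "\<lambda>u. u - d *\<^sub>R shape_operator C p u"
  have N: "?N u = J u" if "u \<in> T" for u unfolding J_def using W(1)[OF that] by simp
  have bijJ: "bij_betw J T T" by (rule bij_betw_subspace_coercive[OF T linJ JT Jp])
  then have bijN: "bij_betw ?N T T" using bij_betw_cong[of T ?N J] N by blast
  have mask: "geometric_mask C \<Omega> p v = - (d *\<^sub>R inv_into T ?N v)" for v
    unfolding geometric_mask_def d_def T_def ..
  have maskJ: "geometric_mask C \<Omega> p (J u) = - (d *\<^sub>R u)" if u: "u \<in> T" for u
    using bij_betw_inv_into_left[OF bijN u] unfolding mask N[OF u] by simp
  have mh: "geometric_mask C \<Omega> p (thickness_hess C \<Omega> p v) = v - L v" if v: "v \<in> T" for v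
  proof -
    have z: "(L v - v) /\<^sub>R d \<in> T" by (intro subspace_scale subspace_diff T L v)
    have "J (L v - v) = d *\<^sub>R H v" using L(2)[OF v] unfolding J_def .
    \<comment> \<open>This exhibits the \<open>J\<close>-preimage of the Hessian value inside
      \<open>T\<close>, where the mask is known from \<open>maskJ\<close>.\<close>
    then have "J ((L v - v) /\<^sub>R d) = H v" using d by (simp add: linear_scale[OF linJ])
    then show ?thesis using maskJ[OF z] d unfolding H(1)[OF v] by simp
  qed
  have "bij_betw ((\<lambda>u. - (d *\<^sub>R u)) \<circ> inv_into T ?N) T T"
  proof (rule bij_betw_trans[OF bij_betw_inv_into[OF bijN]])
    have "- (d *\<^sub>R u) \<in> T" "- (u /\<^sub>R d) \<in> T" if "u \<in> T" for u
      using that by (intro subspace_neg subspace_scale T; simp)+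
    then show "bij_betw (\<lambda>u. - (d *\<^sub>R u)) T T"
      using d by (intro bij_betwI[of _ _ _ "\<lambda>u. - (u /\<^sub>R d)"]) auto
  qed
  then have bijm: "bij_betw (geometric_mask C \<Omega> p) T T" unfolding comp_def mask[symmetric] .
  have rd: "return_deriv C \<Omega> p v = L v" if "v \<in> T" for v
    unfolding return_deriv_def
    by (rule frechet_derivative_tangent[OF inw _ F(2)]) (use that in \<open>simp add: T_def tangent_space_def\<close>)
  show thesis by (rule that[OF lin(3) linJ L(1) Js Jp sa F rd mh bijm])
qed

text \<open>The homothety with ratio \<open>2\<close> and centre \<open>p\<close> conjugates the return maps and halves the
  Hessian of the thickness.\<close>

lemma thickness_hess_not_determined:
  fixes C \<Omega> :: "'a::euclidean_space set"
  assumes dim: "2 \<le> DIM('a)" and conf: "return_configuration C \<Omega> p"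
  shows "\<exists>C' \<Omega>'. return_configuration C' \<Omega>' p \<and> tangent_space C' p = tangent_space C p \<and>
        (\<forall>v\<in>tangent_space C p. return_deriv C' \<Omega>' p v = return_deriv C \<Omega> p v) \<and>
        (\<exists>v\<in>tangent_space C p. thickness_hess C' \<Omega>' p v \<noteq> thickness_hess C \<Omega> p v)"
proof -
  note cd = return_configurationD[OF conf]
  let ?T = "tangent_space C p"
  \<comment> \<open>The map sending \<open>x\<close> to \<open>2 x - p\<close>, which fixes
    \<open>p\<close>.\<close>
  define h where "h = homothety (- p) 2"
  let ?C = "h ` C" and ?\<Omega> = "h ` \<Omega>"
  have two: "(2::real) > 0" by simp
  have hp: "h p = p" unfolding h_def homothety_def by (simp add: scaleR_2)
  have conf': "return_configuration ?C ?\<Omega> p"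
    using return_configuration_homothety[OF two conf, of "- p"] hp unfolding h_def by simp
  have tan: "tangent_space ?C p = ?T"
    using tangent_space_homothety[OF two cd(1,6), of "- p"] hp unfolding h_def by simp
  obtain L where L: "(return_map C \<Omega> has_derivative L) (at p within frontier C)"
      "\<And>v. v \<in> ?T \<Longrightarrow> return_deriv C \<Omega> p v = L v" "linear L"
    by (rule return_configuration_operators[OF conf], rule that, assumption+)
  obtain L' where L': "(return_map ?C ?\<Omega> has_derivative L') (at p within frontier ?C)"
      "\<And>v. v \<in> tangent_space ?C p \<Longrightarrow> return_deriv ?C ?\<Omega> p v = L' v"
    by (rule return_configuration_operators[OF conf'], rule that, assumption+)
  have fr: "frontier ?C = h ` frontier C" unfolding h_def by (rule frontier_homothety[OF two])
  have "((\<lambda>y. - p + 2 *\<^sub>R return_map C \<Omega> ((y - - p) /\<^sub>R 2)) has_derivative (\<lambda>v. 0 + 2 *\<^sub>R L (v /\<^sub>R 2)))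
      (at (h p) within h ` frontier C)"
    unfolding h_def
    by (intro has_derivative_add has_derivative_const has_derivative_scaleR_right has_derivative_homothety L) simp
  \<comment> \<open>A linear map commutes with scaling, so conjugation by the homothety leaves
    \<open>L\<close> itself as the derivative.\<close>
  then have "((\<lambda>y. h (return_map C \<Omega> ((y - - p) /\<^sub>R 2))) has_derivative L) (at p within frontier ?C)"
    unfolding hp fr by (simp add: linear_scale[OF L(3)] h_def homothety_def)
  then have Lder: "(return_map ?C ?\<Omega> has_derivative L) (at p within frontier ?C)"
  proof (rule has_derivative_transform[rotated 2])
    show "p \<in> frontier ?C" using cd(6) hp fr by force
    show "return_map ?C ?\<Omega> y = h (return_map C \<Omega> ((y - - p) /\<^sub>R 2))" if "y \<in> frontier ?C" for y
    proof -
      obtain c where c: "y = h c" "c \<in> frontier C" using \<open>y \<in> _\<close> fr by blast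
      have "(y - - p) /\<^sub>R 2 = c" unfolding c(1) h_def by (rule homothety_inverse(2)[OF two])
      then show ?thesis using return_map_homothety[OF two conf c(2), of "- p"] c(1) unfolding h_def by simp
    qed
  qed
  have inw: "is_inward_unit_normal ?C p (- outward_normal ?C p)"
    using inward_normal_outward_normal return_configurationD[OF conf'] by blast
  have DF: "return_deriv ?C ?\<Omega> p v = return_deriv C \<Omega> p v" if v: "v \<in> ?T" for v
  proof -
    have "v \<in> tangent_space ?C p" using v tan by simp
    then show ?thesis
      using derivative_tangent_unique[OF inw _ L'(1) Lder, of v] L'(2) L(2)[OF v]
      by (simp add: tangent_space_def)
  qed
  obtain w where w: "w \<in> ?T" "w \<noteq> 0" by (rule tangent_space_nontrivial[OF dim])
  \<comment> \<open>Nondegeneracy makes the Hessian onto, so it takes a nonzero value, which halving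
    changes.\<close>
  have "w \<in> thickness_hess C \<Omega> p ` ?T" using bij_betw_imp_surj_on[OF cd(8)] w(1) by simp
  then obtain v where v: "v \<in> ?T" "thickness_hess C \<Omega> p v = w" by blast
  have "thickness_hess ?C ?\<Omega> p v = w /\<^sub>R 2"
    using thickness_hess_homothety[OF two conf v(1), of "- p"] hp v(2) unfolding h_def by simp
  moreover have "w /\<^sub>R 2 \<noteq> w"
  proof
    assume "w /\<^sub>R 2 = w"
    then have "2 *\<^sub>R (w /\<^sub>R 2) = 2 *\<^sub>R w" by (rule arg_cong)
    then show False using w(2) by (simp add: scaleR_2)
  qed
  ultimately have "thickness_hess ?C ?\<Omega> p v \<noteq> thickness_hess C \<Omega> p v" using v(2) by simp
  then show ?thesis using conf' tan DF v(1) by blast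
qed

text \<open>The mask is characterized among all functions \<open>A\<close>, not just linear ones:
  the Hessian is onto the tangent space, so the relation fixes \<open>A\<close> there. Observability
  only through the mask is expressed by comparing configurations at the same point with the same
  tangent space: equal derivatives mean equal composites. Non-identifiability is expressed by a
  second configuration with the same derivative and another Hessian.\<close>

theorem theorem7p7:
  fixes C \<Omega> :: "'a::euclidean_space set" and p :: 'a
  assumes dim: "2 \<le> DIM('a)"
    and conf: "return_configuration C \<Omega> p"
  shows
    "(return_map C \<Omega> ` frontier C \<subseteq> frontier C \<and> return_map C \<Omega> p = p \<and>
      return_map C \<Omega> differentiable (at p within frontier C) \<and>
      (\<forall>v\<in>tangent_space C p.
         geometric_mask C \<Omega> p (thickness_hess C \<Omega> p v) = v - return_deriv C \<Omega> p v) \<and>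
      (\<forall>A. (\<forall>v\<in>tangent_space C p. return_deriv C \<Omega> p v = v - A (thickness_hess C \<Omega> p v)) \<longrightarrow>
         (\<forall>v\<in>tangent_space C p. A v = geometric_mask C \<Omega> p v))) \<and>
     (fixpoint_type (frontier C) (return_map C \<Omega>) p =
        (let \<Lambda> = spectrum_on (tangent_space C p) (return_deriv C \<Omega> p) in
         if \<forall>z\<in>\<Lambda>. cmod z < 1 then Contraction
         else if \<exists>z\<in>\<Lambda>. cmod z > 1 then Expansion
         else Marginal)) \<and>
     (\<forall>C' \<Omega>'. return_configuration C' \<Omega>' p \<and> tangent_space C' p = tangent_space C p \<longrightarrow>
        ((\<forall>v\<in>tangent_space C p. return_deriv C' \<Omega>' p v = return_deriv C \<Omega> p v) \<longleftrightarrow>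
         (\<forall>v\<in>tangent_space C p. geometric_mask C' \<Omega>' p (thickness_hess C' \<Omega>' p v) =
                                 geometric_mask C \<Omega> p (thickness_hess C \<Omega> p v)))) \<and>
     (\<exists>C' \<Omega>'. return_configuration C' \<Omega>' p \<and> tangent_space C' p = tangent_space C p \<and>
        (\<forall>v\<in>tangent_space C p. return_deriv C' \<Omega>' p v = return_deriv C \<Omega> p v) \<and>
        (\<exists>v\<in>tangent_space C p. thickness_hess C' \<Omega>' p v \<noteq> thickness_hess C \<Omega> p v)) \<and>
     (bij_betw (geometric_mask C \<Omega> p) (tangent_space C p) (tangent_space C p) \<and>
      (\<forall>v\<in>tangent_space C p. thickness_hess C \<Omega> p v =
         inv_into (tangent_space C p) (geometric_mask C \<Omega> p) (v - return_deriv C \<Omega> p v)))"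
proof -
  note cd = return_configurationD[OF conf]
  let ?T = "tangent_space C p"
  obtain L J where F: "return_map C \<Omega> p = p" "(return_map C \<Omega> has_derivative L) (at p within frontier C)"
    and DF: "\<And>v. v \<in> ?T \<Longrightarrow> return_deriv C \<Omega> p v = L v" and LT: "\<And>v. v \<in> ?T \<Longrightarrow> L v \<in> ?T"
    and J: "\<And>u v. u \<in> ?T \<Longrightarrow> v \<in> ?T \<Longrightarrow> J u \<bullet> v = J v \<bullet> u" "\<And>v. v \<in> ?T \<Longrightarrow> J v \<bullet> v \<ge> v \<bullet> v"
    and sa: "\<And>u v. u \<in> ?T \<Longrightarrow> v \<in> ?T \<Longrightarrow> J (L u) \<bullet> v = J u \<bullet> L v"
    and lin: "linear L" "linear J"
    and mask: "\<And>v. v \<in> ?T \<Longrightarrow> geometric_mask C \<Omega> p (thickness_hess C \<Omega> p v) = v - L v"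
    and bij: "bij_betw (geometric_mask C \<Omega> p) ?T ?T"
    by (rule return_configuration_operators[OF conf], rule that, assumption+)
  have MM: "return_map C \<Omega> ` frontier C \<subseteq> frontier C" by (rule return_map_frontier[OF conf])
  have dF: "return_map C \<Omega> differentiable (at p within frontier C)" using F(2) differentiableI by blast
  have inw: "is_inward_unit_normal C p (- outward_normal C p)" by (rule inward_normal_outward_normal[OF cd(1,6)])
  have mD: "geometric_mask C \<Omega> p (thickness_hess C \<Omega> p v) = v - return_deriv C \<Omega> p v" if "v \<in> ?T" for v
    using mask[OF that] DF[OF that] by simp
  have hT: "thickness_hess C \<Omega> p v \<in> ?T" if "v \<in> ?T" for v using cd(8) that bij_betwE by blast
  have uniq: "\<forall>A. (\<forall>v\<in>?T. return_deriv C \<Omega> p v = v - A (thickness_hess C \<Omega> p v)) \<longrightarrow>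
      (\<forall>v\<in>?T. A v = geometric_mask C \<Omega> p v)"
  proof (intro allI impI ballI)
    fix A v assume A: "\<forall>v\<in>?T. return_deriv C \<Omega> p v = v - A (thickness_hess C \<Omega> p v)" and v: "v \<in> ?T"
    have "v \<in> thickness_hess C \<Omega> p ` ?T" using bij_betw_imp_surj_on[OF cd(8)] v by simp
    then obtain u where u: "u \<in> ?T" "v = thickness_hess C \<Omega> p u" by blast
    then show "A v = geometric_mask C \<Omega> p v" using A mD[OF u(1)] by simp
  qed
  have spec: "spectrum_on ?T (return_deriv C \<Omega> p) = spectrum_on ?T L"
    unfolding spectrum_on_def by (simp only: DF cong: bex_cong)
  obtain x0 where x0: "x0 \<in> ?T" "x0 \<noteq> 0" by (rule tangent_space_nontrivial[OF dim])
  have T: "?T = {v. v \<bullet> (- outward_normal C p) = 0}" unfolding tangent_space_def by simp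
  have stab: "fixpoint_type (frontier C) (return_map C \<Omega>) p =
        (let \<Lambda> = spectrum_on ?T (return_deriv C \<Omega> p) in
         if \<forall>z\<in>\<Lambda>. cmod z < 1 then Contraction else if \<exists>z\<in>\<Lambda>. cmod z > 1 then Expansion else Marginal)"
    unfolding spec by (rule fixpoint_type_selfadjoint[OF inw T x0 MM F(1) cd(6) F(2) lin(1) LT lin(2) J sa])
  have obs: "\<forall>C' \<Omega>'. return_configuration C' \<Omega>' p \<and> tangent_space C' p = ?T \<longrightarrow>
      ((\<forall>v\<in>?T. return_deriv C' \<Omega>' p v = return_deriv C \<Omega> p v) \<longleftrightarrow>
         (\<forall>v\<in>?T. geometric_mask C' \<Omega>' p (thickness_hess C' \<Omega>' p v) =
                 geometric_mask C \<Omega> p (thickness_hess C \<Omega> p v)))"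
  proof (intro allI impI)
    fix C' \<Omega>' assume c': "return_configuration C' \<Omega>' p \<and> tangent_space C' p = ?T"
    obtain L' where L': "\<And>v. v \<in> tangent_space C' p \<Longrightarrow> return_deriv C' \<Omega>' p v = L' v"
        "\<And>v. v \<in> tangent_space C' p \<Longrightarrow> geometric_mask C' \<Omega>' p (thickness_hess C' \<Omega>' p v) = v - L' v"
      by (rule return_configuration_operators[OF conjunct1[OF c']], rule that, assumption+)
    show "(\<forall>v\<in>?T. return_deriv C' \<Omega>' p v = return_deriv C \<Omega> p v) \<longleftrightarrow>
         (\<forall>v\<in>?T. geometric_mask C' \<Omega>' p (thickness_hess C' \<Omega>' p v) =
                 geometric_mask C \<Omega> p (thickness_hess C \<Omega> p v))"
      using L'[unfolded conjunct2[OF c']] DF mask by simp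
  qed
  have inv: "thickness_hess C \<Omega> p v = inv_into ?T (geometric_mask C \<Omega> p) (v - return_deriv C \<Omega> p v)"
    if "v \<in> ?T" for v
    using bij_betw_inv_into_left[OF bij hT[OF that]] mD[OF that] by simp
  show ?thesis
    by (intro conjI MM F(1) dF ballI[OF mD] uniq stab obs bij ballI[OF inv] thickness_hess_not_determined[OF dim conf])
qed

end
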